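(* Let $d\geq 1$ be an integer, let $\alpha\in(0,2)$, $\beta>0$, $\gamma>0$, and let $s\in\mathbb{R}$ satisfy $\alpha/2<|s|\leq 1$. Then the Fourier transform on $\mathbb{R}^d$ of the function $x\mapsto E_{\alpha,\beta}(e^{i\pi s}|x|^{\gamma})$ belongs to $L^{p}(\mathbb{R}^{d})$ whenever $1<p\leq\infty$ and $\gamma p'>d$, where $p'$ is the conjugate exponent of $p$, $\frac1p+\frac1{p'}=1$ (with $p'=1$ if $p=\infty$). In other words, $\mathcal{F}\big[E_{\alpha,\beta}(e^{i\pi s}|\cdot|^{\gamma})\big]\in L^{p}(\mathbb{R}^{d})$ for all $$\begin{cases} 1<p<\dfrac{d}{d-\gamma}, & \text{if } 0<\gamma<d;\\[2mm] 1<p<\infty, & \text{if } \gamma=d;\\[1mm] 1<p\leq\infty, & \text{if } \gamma>d.\end{cases}$$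
   Context: $E_{\alpha,\beta}$ is the (entire) two-parameter Mittag-Leffler function $E_{\alpha,\beta}(z)=\sum_{k=0}^{\infty}\frac{z^{k}}{\Gamma(\alpha k+\beta)}$, $z\in\mathbb{C}$. For $\alpha/2<|s|\le 1$ the function $x\mapsto E_{\alpha,\beta}(e^{i\pi s}|x|^{\gamma})$ is continuous and bounded on $\mathbb{R}^d$, and its Fourier transform $\mathcal{F}$ is understood in the sense of tempered distributions, with the convention $\mathcal{F}f(\xi)=\int_{\mathbb{R}^d}e^{-2\pi i x\cdot\xi}f(x)\,dx$ for integrable $f$. Saying that it belongs to $L^p(\mathbb{R}^d)$ means that this tempered distribution is represented by a function in $L^p(\mathbb{R}^d)$. *)

theory Defs
  imports "HOL-Analysis.Analysis"
begin

definition mittag_leffler :: "real \<Rightarrow> real \<Rightarrow> complex \<Rightarrow> complex" where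
  "mittag_leffler \<alpha> \<beta> z = (\<Sum>k. z ^ k / of_real (Gamma (\<alpha> * real k + \<beta>)))"

definition partial_deriv :: "'n::finite \<Rightarrow> (real ^ 'n \<Rightarrow> complex) \<Rightarrow> real ^ 'n \<Rightarrow> complex" where
  "partial_deriv i f x = frechet_derivative f (at x) (axis i 1)"

text \<open>Multi-indices are lists of coordinates: \<open>[i, j]\<close> stands for the second-order
  derivative with respect to the coordinates \<open>j\<close> and then \<open>i\<close>.\<close>

primrec partial_derivs :: "'n::finite list \<Rightarrow> (real ^ 'n \<Rightarrow> complex) \<Rightarrow> real ^ 'n \<Rightarrow> complex" where
  "partial_derivs [] f = f"
| "partial_derivs (i # js) f = partial_deriv i (partial_derivs js f)"

text \<open>Differentiability of all iterated partial derivatives is equivalent to smoothness.\<close>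

definition schwartz_space :: "(real ^ 'n::finite \<Rightarrow> complex) set" where
  "schwartz_space =
     {\<phi>. \<forall>js. (\<forall>x. partial_derivs js \<phi> differentiable (at x)) \<and>
              (\<forall>k. bounded (range (\<lambda>x. norm x ^ k *\<^sub>R partial_derivs js \<phi> x)))}"

definition schwartz_seminorm :: "nat \<Rightarrow> 'n::finite list \<Rightarrow> (real ^ 'n \<Rightarrow> complex) \<Rightarrow> real" where
  "schwartz_seminorm k js \<phi> = (SUP x. norm x ^ k * norm (partial_derivs js \<phi> x))"

text \<open>Distributions are functionals on all functions, but only their values on the Schwartz
  space matter. Continuity is stated as domination by a finite sum of the defining seminorms.\<close>

definition tempered_distribution :: "((real ^ 'n::finite \<Rightarrow> complex) \<Rightarrow> complex) \<Rightarrow> bool" where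
  "tempered_distribution T \<longleftrightarrow>
     (\<forall>\<phi>\<in>schwartz_space. \<forall>\<psi>\<in>schwartz_space. T (\<lambda>x. \<phi> x + \<psi> x) = T \<phi> + T \<psi>) \<and>
     (\<forall>c. \<forall>\<phi>\<in>schwartz_space. T (\<lambda>x. c * \<phi> x) = c * T \<phi>) \<and>
     (\<exists>C N. \<forall>\<phi>\<in>schwartz_space.
        norm (T \<phi>) \<le> C * (\<Sum>k\<le>N. \<Sum>js | length js \<le> N. schwartz_seminorm k js \<phi>))"

definition function_distr :: "(real ^ 'n::finite \<Rightarrow> complex) \<Rightarrow> (real ^ 'n \<Rightarrow> complex) \<Rightarrow> complex" where
  "function_distr f \<phi> = (LINT x|lborel. f x * \<phi> x)"

text \<open>The integrability clause matters because non-integrable functions have Bochner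
  integral \<open>0\<close>.\<close>

definition tempered_function :: "(real ^ 'n::finite \<Rightarrow> complex) \<Rightarrow> bool" where
  "tempered_function f \<longleftrightarrow>
     f \<in> borel_measurable lborel \<and>
     (\<forall>\<phi>\<in>schwartz_space. integrable lborel (\<lambda>x. f x * \<phi> x)) \<and>
     tempered_distribution (function_distr f)"

definition fourier :: "(real ^ 'n::finite \<Rightarrow> complex) \<Rightarrow> real ^ 'n \<Rightarrow> complex" where
  "fourier f \<xi> = (LINT x|lborel. exp (- 2 * of_real pi * \<i> * of_real (x \<bullet> \<xi>)) * f x)"

definition fourier_distr ::
    "((real ^ 'n::finite \<Rightarrow> complex) \<Rightarrow> complex) \<Rightarrow> (real ^ 'n \<Rightarrow> complex) \<Rightarrow> complex" where
  "fourier_distr T \<phi> = T (fourier \<phi>)"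

definition Lp_space :: "ennreal \<Rightarrow> (real ^ 'n::finite \<Rightarrow> complex) set" where
  "Lp_space p =
     {g. g \<in> borel_measurable lborel \<and>
         (if p = \<infinity> then \<exists>C. AE x in lborel. norm (g x) \<le> C
          else integrable lborel (\<lambda>x. norm (g x) powr enn2real p))}"

text \<open>For \<open>1 \<le> p\<close>, the products of \<open>g\<close> with Schwartz functions are integrable by the
  Hoelder inequality.\<close>

definition distr_in_Lp :: "ennreal \<Rightarrow> ((real ^ 'n::finite \<Rightarrow> complex) \<Rightarrow> complex) \<Rightarrow> bool" where
  "distr_in_Lp p T \<longleftrightarrow> (\<exists>g\<in>Lp_space p. \<forall>\<phi>\<in>schwartz_space. T \<phi> = function_distr g \<phi>)"

definition fourier_in_Lp :: "ennreal \<Rightarrow> (real ^ 'n::finite \<Rightarrow> complex) \<Rightarrow> bool" where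
  "fourier_in_Lp p f \<longleftrightarrow> tempered_function f \<and> distr_in_Lp p (fourier_distr (function_distr f))"

end

theory Submission
  imports Defs "HOL-Complex_Analysis.Complex_Analysis"
begin

text \<open>
  The function is written as a superposition of complex Gaussians \<open>exp (- z |x|^2)\<close> with \<open>Re z\<close>
  comparable to \<open>|z|\<close>. Their Fourier transforms are again Gaussians, with \<open>L^p\<close> norm a constant
  times \<open>|z| powr - q\<close>, \<open>q = d / (2 p')\<close>, so it suffices that the coefficient is integrable
  against \<open>1\<close> and against \<open>|z| powr - q\<close>; everything else is Fubini's theorem, and no
  Hausdorff-Young inequality is needed.

  To find the superposition put \<open>F w = E (exp (i pi s) exp (\<gamma> w / 2))\<close>, so that the function is
  \<open>F (2 ln |x|)\<close>. Hankel's formula for \<open>1 / Gamma\<close> gives \<open>|E z| \<le> C / (1 + |z|)\<close> in a sector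
  about the ray of angle \<open>\<pi> s\<close>, hence \<open>F w\<close> decays like \<open>exp (- \<gamma> Re w / 2)\<close> as \<open>Re w\<close> tends to infinity
  in a thin strip about the real axis. Subtracting \<open>E 0 exp (- exp w)\<close>, that is the Gaussian \<open>E 0 exp (- |x|^2)\<close>,
  produces a function that also decays at minus infinity. Cauchy's formula on the boundary of the
  strip, with a kernel chosen to be a Laplace integral in \<open>|x|^2\<close>, is the desired superposition,
  and \<open>\<gamma> p' > d\<close> is exactly the condition \<open>q < \<gamma> / 2\<close> for its coefficient to be integrable.
\<close>

section \<open>Integration on Euclidean space\<close>

text \<open>The kernel is shaped by small \<open>|z|\<close>. Put
  \<open>v = |x|^2 exp (- w)\<close>. The plain Cauchy kernel \<open>1 / (1 - v)\<close> is a
  Laplace integral along a ray starting at \<open>0\<close>; its Gaussians would have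
  \<open>z = \<tau> \<kappa> exp (- w)\<close> with \<tau> down to \<open>0\<close>, and
  integrability of \<open>|z| powr - q\<close> would force \<open>q < 1\<close>, although
  \<open>q\<close> grows with the dimension. The factor \<open>exp (1 - v)\<close> leaves the
  residue unchanged and makes the ray start at \<open>1\<close>: now
  \<open>z = (1 + \<tau> \<kappa>) exp (- w)\<close>, \<open>|z|\<close> is at least a constant
  times \<open>exp (- Re w)\<close>, and \<open>|z| powr - q\<close> costs at most a constant times
  \<open>exp (q Re w)\<close>. The decay \<open>exp (- \<gamma> Re w / 2)\<close> pays for this in
  every dimension. The strip must have positive width: on its boundary lines \<open>v\<close> has
  argument \<delta> or - \<delta>, which leaves room for a direction \<kappa> with
  \<open>Re \<kappa> < 0 < Re (\<kappa> v)\<close>. The first sign makes the coefficient decay in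
  \<tau>, the second keeps \<open>z\<close> in a sector inside the right half-plane. On the real
  axis no such direction exists.\<close>

lemma
  fixes f :: "'n::finite \<Rightarrow> real \<Rightarrow> complex"
  assumes int: "\<And>i. integrable lborel (f i)"
  shows integrable_lborel_vec_prod: "integrable lborel (\<lambda>x::real^'n. \<Prod>i\<in>UNIV. f i (x $ i))"
    and integral_lborel_vec_prod:
      "(LINT x|lborel. (\<Prod>i\<in>UNIV. f i ((x::real^'n) $ i))) = (\<Prod>i\<in>UNIV. (LINT t|lborel. f i t))"
proof -
  interpret product_sigma_finite "\<lambda>_::real^'n. lborel :: real measure"
    by standard
  \<comment> \<open>Lebesgue measure is the image of a product measure indexed by basis vectors, not
    by \<open>'n\<close>; \<open>k\<close> turns a basis vector back into its index.\<close>
  define k where "k b = (THE i. b = axis i (1::real))" for b :: "real^'n"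
  have k: "k (axis i 1) = i" for i
    unfolding k_def by (auto simp: axis_eq_axis)
  have inj: "inj_on (\<lambda>i::'n. axis i (1::real)) UNIV"
    by (auto simp: inj_on_def axis_eq_axis)
  have Basis: "(Basis :: (real^'n) set) = (\<lambda>i. axis i 1) ` UNIV"
    by (auto simp: Basis_vec_def)
  have prod_Basis: "(\<Prod>b\<in>Basis. F b) = (\<Prod>i\<in>UNIV. F (axis i 1))" for F :: "real^'n \<Rightarrow> complex"
    unfolding Basis by (subst prod.reindex[OF inj]) simp
  define S where "S u = (\<Sum>b\<in>Basis. u b *\<^sub>R b)" for u :: "real^'n \<Rightarrow> real"
  have S: "S u $ i = u (axis i 1)" for u i
  proof -
    have "S u \<bullet> axis i 1 = u (axis i 1)"
      unfolding S_def by (rule inner_sum_left_Basis) (auto simp: Basis)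
    then show ?thesis by (simp add: inner_axis)
  qed
  have [measurable]: "f i \<in> borel_measurable borel" for i
    using borel_measurable_integrable[OF int[of i]] by simp
  have S_meas [measurable]: "S \<in> measurable (\<Pi>\<^sub>M b\<in>Basis. lborel) borel"
    unfolding S_def[abs_def] by measurable
  have prod_meas [measurable]: "(\<lambda>x::real^'n. \<Prod>i\<in>UNIV. f i (x $ i)) \<in> borel_measurable borel"
    by measurable
  have lb: "lborel = distr (\<Pi>\<^sub>M b\<in>Basis. lborel) borel S"
    unfolding S_def[abs_def] by (rule lborel_eq)
  have eq: "(\<Prod>i\<in>UNIV. f i (S u $ i)) = (\<Prod>b\<in>Basis. f (k b) (u b))" for u
    by (simp add: prod_Basis k S)
  show "integrable lborel (\<lambda>x::real^'n. \<Prod>i\<in>UNIV. f i (x $ i))"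
    unfolding lb by (subst integrable_distr_eq) (auto simp: eq int intro!: product_integrable_prod)
  show "(LINT x|lborel. (\<Prod>i\<in>UNIV. f i ((x::real^'n) $ i))) = (\<Prod>i\<in>UNIV. (LINT t|lborel. f i t))"
    unfolding lb
    using product_integral_prod[of Basis "\<lambda>b. f (k b)"] int
    by (subst integral_distr) (simp_all add: S prod_Basis k)
qed

lemma integrable_inverse_one_plus_square: "integrable lborel (\<lambda>t::real. 1 / (1 + t\<^sup>2))"
proof -
  have "set_integrable lborel (einterval (-\<infinity>) \<infinity>) (\<lambda>t::real. 1 / (1 + t\<^sup>2))"
  proof (rule interval_integral_FTC_nonneg(1)[where F = arctan and A = "-pi/2" and B = "pi/2"])
    show "DERIV arctan t :> 1 / (1 + t\<^sup>2)" for t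
      by (auto intro!: derivative_eq_intros simp: field_simps)
    show "isCont (\<lambda>t::real. 1 / (1 + t\<^sup>2)) t" for t
      by (auto intro!: continuous_intros simp: add_nonneg_eq_0_iff)
    show "((arctan \<circ> real_of_ereal) \<longlongrightarrow> - pi / 2) (at_right (- \<infinity>))"
      using tendsto_arctan_at_bot by (simp add: ereal_tendsto_simps1)
    show "((arctan \<circ> real_of_ereal) \<longlongrightarrow> pi / 2) (at_left \<infinity>)"
      using tendsto_arctan_at_top by (simp add: ereal_tendsto_simps1)
  qed auto
  then show ?thesis
    by (simp add: set_integrable_def)
qed

lemma prod_one_plus_square_le:
  "(\<Prod>i\<in>UNIV. 1 + (x $ i)\<^sup>2) \<le> (1 + (norm x)\<^sup>2) ^ CARD('n)" for x :: "real^'n::finite"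
proof -
  have "(x $ i)\<^sup>2 \<le> (norm x)\<^sup>2" for i
    using component_le_norm_cart[of x i] by (metis abs_ge_zero power2_abs power_mono)
  then have "(\<Prod>i\<in>UNIV. 1 + (x $ i)\<^sup>2) \<le> (\<Prod>i\<in>(UNIV::'n set). 1 + (norm x)\<^sup>2)"
    by (intro prod_mono) auto
  then show ?thesis by simp
qed

lemma power_one_plus_le: "(1 + t) ^ n \<le> 2 ^ n * (1 + t ^ n)" if "0 \<le> t" for t :: real
proof -
  have "(1 + t) ^ n \<le> (2 * max 1 t) ^ n"
    using that by (intro power_mono) auto
  also have "\<dots> \<le> 2 ^ n * (1 + t ^ n)"
    using that by (auto simp: power_mult_distrib max_def)
  finally show ?thesis .
qed

text \<open>The product over the coordinates of \<open>1 / (1 + (x $ i)\<^sup>2)\<close> factorizes,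
  which reduces integrability to dimension one; bounding every factor through the norm costs the
  exponent \<open>2 * CARD('n)\<close>. This is the common majorant for Schwartz functions and their
  Fourier transforms.\<close>

lemma integrable_inverse_one_plus_norm_power:
  "integrable lborel (\<lambda>x::real^'n::finite. 1 / (1 + norm x ^ (2 * CARD('n))))"
proof (rule Bochner_Integration.integrable_bound)
  have "integrable lborel (\<lambda>x::real^'n. \<Prod>i\<in>UNIV. complex_of_real (1 / (1 + (x $ i)\<^sup>2)))"
    by (rule integrable_lborel_vec_prod)
      (rule integrable_of_real[OF integrable_inverse_one_plus_square])
  then show "integrable lborel (\<lambda>x::real^'n. 2 ^ CARD('n) * (\<Prod>i\<in>UNIV. complex_of_real (1 / (1 + (x $ i)\<^sup>2))))"
    by (rule integrable_mult_right)
  have "1 / (1 + norm x ^ (2 * CARD('n))) \<le> 2 ^ CARD('n) / (\<Prod>i\<in>UNIV. 1 + (x $ i)\<^sup>2)"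
    for x :: "real^'n"
  proof -
    have "(\<Prod>i\<in>UNIV. 1 + (x $ i)\<^sup>2) \<le> 2 ^ CARD('n) * (1 + norm x ^ (2 * CARD('n)))"
      using order.trans[OF prod_one_plus_square_le power_one_plus_le, of x]
      by (simp add: power_mult)
    moreover have "0 < (\<Prod>i\<in>UNIV. 1 + (x $ i)\<^sup>2)"
      by (intro prod_pos) (simp add: add_pos_nonneg)
    moreover have "0 < 1 + norm x ^ (2 * CARD('n))"
      by (simp add: add_pos_nonneg)
    ultimately show ?thesis
      by (simp add: field_simps)
  qed
  moreover have "norm (2 ^ CARD('n) * (\<Prod>i\<in>UNIV. complex_of_real (1 / (1 + (x $ i)\<^sup>2)))) =
      2 ^ CARD('n) / (\<Prod>i\<in>UNIV. 1 + (x $ i)\<^sup>2)" for x :: "real^'n"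
    unfolding of_real_prod[symmetric] norm_mult norm_of_real
    by (simp add: prod_dividef norm_power abs_prod)
  ultimately show "AE x in lborel. norm (1 / (1 + norm x ^ (2 * CARD('n))))
      \<le> norm (2 ^ CARD('n) * (\<Prod>i\<in>UNIV. complex_of_real (1 / (1 + ((x::real^'n) $ i)\<^sup>2))))"
    by (simp add: add_pos_nonneg)
qed measurable

section \<open>Real Gaussian integrals\<close>

lemma integrable_exp_neg_square: "integrable lborel (\<lambda>t::real. exp (- (t\<^sup>2)))"
proof (rule Bochner_Integration.integrable_bound[OF integrable_inverse_one_plus_square])
  have "exp (- (t\<^sup>2)) \<le> 1 / (1 + t\<^sup>2)" for t :: real
    using exp_ge_add_one_self[of "t\<^sup>2"] by (simp add: exp_minus divide_simps add_pos_nonneg mult.commute)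
  then show "AE t in lborel. norm (exp (- (t\<^sup>2))) \<le> norm (1 / (1 + (t::real)\<^sup>2))"
    by auto
qed measurable

text \<open>This number is \<open>sqrt pi\<close>. It stays unevaluated because it only enters as a
  constant in bounds.\<close>

definition gauss_const :: real where
  "gauss_const = (LINT t|lborel. exp (- ((t::real)\<^sup>2)))"

lemma gauss_const_nonneg: "0 \<le> gauss_const"
  unfolding gauss_const_def by simp

lemma
  assumes "0 < a"
  shows integrable_gaussian_1: "integrable lborel (\<lambda>t::real. exp (- a * t\<^sup>2))"
    and integral_gaussian_1: "(LINT t|lborel. exp (- a * (t::real)\<^sup>2)) = gauss_const * a powr (- 1/2)"
proof -
  have sq: "(sqrt a * t)\<^sup>2 = a * t\<^sup>2" for t
    using assms by (simp add: power_mult_distrib)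
  show "integrable lborel (\<lambda>t::real. exp (- a * t\<^sup>2))"
    using lborel_integrable_real_affine[OF integrable_exp_neg_square, of "sqrt a" 0] assms
    by (simp add: sq)
  have "gauss_const = sqrt a * (LINT t|lborel. exp (- a * (t::real)\<^sup>2))"
    unfolding gauss_const_def
    by (subst lborel_integral_real_affine[of "sqrt a" _ 0]) (use assms in \<open>auto simp: sq\<close>)
  then show "(LINT t|lborel. exp (- a * (t::real)\<^sup>2)) = gauss_const * a powr (- 1/2)"
    using assms by (simp add: powr_minus powr_half_sqrt field_simps)
qed

lemma norm_vec_power2: "(norm x)\<^sup>2 = (\<Sum>i\<in>UNIV. (x $ i)\<^sup>2)" for x :: "real^'n::finite"
  by (simp add: norm_vec_def L2_set_def sum_nonneg)

lemma
  assumes "0 < a"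
  shows integrable_gaussian: "integrable lborel (\<lambda>x::real^'n::finite. exp (- a * (norm x)\<^sup>2))"
    and integral_gaussian: "(LINT x|lborel. exp (- a * (norm (x::real^'n))\<^sup>2)) =
      gauss_const ^ CARD('n) * a powr (- real CARD('n) / 2)"
proof -
  have eq: "(\<Prod>i\<in>UNIV. complex_of_real (exp (- a * (x $ i)\<^sup>2))) = complex_of_real (exp (- a * (norm x)\<^sup>2))"
    for x :: "real^'n"
    by (simp add: norm_vec_power2 sum_distrib_left exp_sum[symmetric] sum_negf flip: of_real_prod)
  note i = integrable_of_real[OF integrable_gaussian_1[OF assms], where 'a = complex]
  have "integrable lborel (\<lambda>x::real^'n. complex_of_real (exp (- a * (norm x)\<^sup>2)))"
    using integrable_lborel_vec_prod[OF i, where 'n = 'n] unfolding eq .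
  then show int: "integrable lborel (\<lambda>x::real^'n. exp (- a * (norm x)\<^sup>2))"
    by (simp only: complex_of_real_integrable_eq)
  have "complex_of_real (LINT x|lborel. exp (- a * (norm (x::real^'n))\<^sup>2)) =
      (\<Prod>i\<in>(UNIV::'n set). LINT t|lborel. complex_of_real (exp (- a * t\<^sup>2)))"
    using integral_lborel_vec_prod[OF i, where 'n = 'n] unfolding eq by (simp only: integral_complex_of_real)
  also have "\<dots> = complex_of_real ((gauss_const * a powr (- 1/2)) ^ CARD('n))"
    using integral_gaussian_1[OF assms] by (simp only: integral_complex_of_real prod_constant) simp
  finally show "(LINT x|lborel. exp (- a * (norm (x::real^'n))\<^sup>2)) =
      gauss_const ^ CARD('n) * a powr (- real CARD('n) / 2)"
    unfolding of_real_eq_iff using assms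
    by (simp add: power_mult_distrib powr_powr flip: powr_realpow)
qed

section \<open>Schwartz functions and their Fourier transforms\<close>

text \<open>\<open>partial_derivs\<close> recurses on the outermost derivative, while closure of the
  Schwartz space under derivatives needs the innermost one split off.\<close>

lemma partial_derivs_snoc: "partial_derivs (js @ [i]) f = partial_derivs js (partial_deriv i f)"
  by (induction js) auto

lemma schwartz_partial_deriv: "\<phi> \<in> schwartz_space \<Longrightarrow> partial_deriv i \<phi> \<in> schwartz_space"
  unfolding schwartz_space_def by (auto simp flip: partial_derivs_snoc)

lemma schwartz_differentiable: "\<phi> \<in> schwartz_space \<Longrightarrow> \<phi> differentiable (at x)"
  unfolding schwartz_space_def by (auto dest!: spec[of _ "[]"])

lemma schwartz_borel_measurable [measurable_dest]:
  "\<phi> \<in> schwartz_space \<Longrightarrow> \<phi> \<in> borel_measurable borel"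
  by (intro borel_measurable_continuous_onI continuous_at_imp_continuous_on ballI
      differentiable_imp_continuous_within schwartz_differentiable)

lemma bdd_above_schwartz:
  "\<phi> \<in> schwartz_space \<Longrightarrow> bdd_above (range (\<lambda>x. norm x ^ k * norm (partial_derivs js \<phi> x)))"
  unfolding schwartz_space_def bounded_iff bdd_above_def by (auto simp: norm_power)

lemma schwartz_seminorm_ge:
  "\<phi> \<in> schwartz_space \<Longrightarrow> norm x ^ k * norm (partial_derivs js \<phi> x) \<le> schwartz_seminorm k js \<phi>"
  unfolding schwartz_seminorm_def by (intro cSUP_upper bdd_above_schwartz) auto

lemma schwartz_seminorm_nonneg: "\<phi> \<in> schwartz_space \<Longrightarrow> 0 \<le> schwartz_seminorm k js \<phi>"
  by (rule order.trans[OF _ schwartz_seminorm_ge[of _ 0]]) auto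

lemma schwartz_decay:
  assumes "\<phi> \<in> schwartz_space"
  shows "norm (\<phi> x) \<le> (schwartz_seminorm 0 [] \<phi> + schwartz_seminorm N [] \<phi>) * (1 / (1 + norm x ^ N))"
proof -
  have "norm (\<phi> x) * (1 + norm x ^ N) \<le> schwartz_seminorm 0 [] \<phi> + schwartz_seminorm N [] \<phi>"
    using schwartz_seminorm_ge[OF assms, of x 0 "[]"] schwartz_seminorm_ge[OF assms, of x N "[]"]
    by (simp add: algebra_simps)
  moreover have "0 < 1 + norm x ^ N"
    by (simp add: add_pos_nonneg)
  ultimately show ?thesis by (simp add: field_simps)
qed

lemma
  fixes \<phi> :: "real ^ 'n::finite \<Rightarrow> complex"
  assumes "\<phi> \<in> schwartz_space"
  shows schwartz_integrable: "integrable lborel \<phi>"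
    and schwartz_L1_le: "(LINT x|lborel. norm (\<phi> x)) \<le>
      (schwartz_seminorm 0 [] \<phi> + schwartz_seminorm (2 * CARD('n)) [] \<phi>) *
      (LINT x|lborel. 1 / (1 + norm (x :: real^'n) ^ (2 * CARD('n))))"
proof -
  let ?S = "schwartz_seminorm 0 [] \<phi> + schwartz_seminorm (2 * CARD('n)) [] \<phi>"
  have S: "0 \<le> ?S"
    using schwartz_seminorm_nonneg[OF assms] by (intro add_nonneg_nonneg)
  have [measurable]: "\<phi> \<in> borel_measurable borel"
    by (rule schwartz_borel_measurable) fact
  have b: "norm (\<phi> x) \<le> ?S * (1 / (1 + norm x ^ (2 * CARD('n))))" for x
    by (rule schwartz_decay) fact
  have i: "integrable lborel (\<lambda>x::real^'n. ?S * (1 / (1 + norm x ^ (2 * CARD('n)))))"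
    by (intro integrable_mult_right integrable_inverse_one_plus_norm_power)
  show int: "integrable lborel \<phi>"
    by (rule Bochner_Integration.integrable_bound[OF i])
      (use b S in \<open>auto simp: abs_mult intro!: AE_I2\<close>)
  have "(LINT x|lborel. norm (\<phi> x)) \<le> (LINT x|lborel. ?S * (1 / (1 + norm (x :: real^'n) ^ (2 * CARD('n)))))"
    by (rule integral_mono[OF integrable_norm[OF int] i b])
  then show "(LINT x|lborel. norm (\<phi> x)) \<le> ?S * (LINT x|lborel. 1 / (1 + norm (x :: real^'n) ^ (2 * CARD('n))))"
    by (simp only: integral_mult_right_zero)
qed

section \<open>Decay of the Fourier transform of a Schwartz function\<close>

lemma norm_exp_i_real [simp]: "norm (exp (- 2 * of_real pi * \<i> * of_real r)) = 1"
  by (simp add: norm_exp_eq_Re)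

lemma fourier_integrand_integrable:
  fixes f :: "real ^ 'n::finite \<Rightarrow> complex"
  assumes "integrable lborel f"
  shows "integrable lborel (\<lambda>x. exp (- 2 * of_real pi * \<i> * of_real (x \<bullet> \<xi>)) * f x)"
proof (rule Bochner_Integration.integrable_bound[OF assms])
  have [measurable]: "f \<in> borel_measurable borel"
    using borel_measurable_integrable[OF assms] by simp
  show "(\<lambda>x. exp (- 2 * of_real pi * \<i> * of_real (x \<bullet> \<xi>)) * f x) \<in> borel_measurable lborel"
    by measurable
qed (simp only: norm_mult norm_exp_i_real, simp)

text \<open>No integrability is assumed: if the integrand is not integrable, the left side is
  \<open>0\<close> by convention and the right side is nonnegative anyway.\<close>

lemma norm_fourier_le:
  fixes f :: "real ^ 'n::finite \<Rightarrow> complex"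
  shows "norm (fourier f \<xi>) \<le> (LINT x|lborel. norm (f x))"
proof -
  have "norm (fourier f \<xi>) \<le> (LINT x|lborel. norm (exp (- 2 * of_real pi * \<i> * of_real (x \<bullet> \<xi>)) * f x))"
    unfolding fourier_def by (rule integral_norm_bound)
  then show ?thesis by (simp only: norm_mult norm_exp_i_real mult_1)
qed

lemma fourier_measurable [measurable]:
  fixes f :: "real ^ 'n::finite \<Rightarrow> complex"
  assumes [measurable]: "f \<in> borel_measurable borel"
  shows "fourier f \<in> borel_measurable borel"
  unfolding fourier_def[abs_def] by measurable

text \<open>A shift by a vector of length at most \<open>1\<close> changes the decay weight only by
  a bounded factor. This turns decay at a nearby point into decay at the base point.\<close>

lemma inverse_one_plus_power_shift:
  fixes u v :: real
  assumes "0 \<le> u" "u \<le> v + 1" "0 \<le> v"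
  shows "1 / (1 + v ^ N) \<le> (1 + 2 ^ N) * (1 / (1 + u ^ N))"
proof -
  have "u ^ N \<le> (1 + v) ^ N"
    using assms by (intro power_mono) auto
  also have "\<dots> \<le> 2 ^ N * (1 + v ^ N)"
    by (rule power_one_plus_le) fact
  finally have "1 + u ^ N \<le> (1 + 2 ^ N) * (1 + v ^ N)"
    using assms by (simp add: algebra_simps add_increasing)
  moreover have "0 < 1 + u ^ N" "0 < 1 + v ^ N"
    using assms by (simp_all add: add_pos_nonneg)
  ultimately show ?thesis by (simp add: field_simps)
qed

lemma partial_deriv_has_vector_derivative:
  assumes "\<phi> \<in> schwartz_space"
  shows "((\<lambda>s. \<phi> (x + s *\<^sub>R axis i 1)) has_vector_derivative partial_deriv i \<phi> (x + s *\<^sub>R axis i 1)) (at s within A)"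
proof -
  have "(\<phi> has_derivative frechet_derivative \<phi> (at (x + s *\<^sub>R axis i 1))) (at (x + s *\<^sub>R axis i 1))"
    by (rule frechet_derivative_works[THEN iffD1]) (rule schwartz_differentiable[OF assms])
  moreover have "((\<lambda>s. x + s *\<^sub>R axis i 1) has_derivative (\<lambda>s. s *\<^sub>R axis i 1)) (at s within A)"
    by (auto intro!: derivative_eq_intros)
  ultimately have "((\<lambda>s. \<phi> (x + s *\<^sub>R axis i 1)) has_derivative
      (\<lambda>r. frechet_derivative \<phi> (at (x + s *\<^sub>R axis i 1)) (r *\<^sub>R axis i 1))) (at s within A)"
    by (rule has_derivative_compose[rotated])
  moreover have "linear (frechet_derivative \<phi> (at (x + s *\<^sub>R axis i 1)))"
    using schwartz_differentiable[OF assms] by (rule linear_frechet_derivative)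
  ultimately show ?thesis
    unfolding has_vector_derivative_def partial_deriv_def by (simp add: linear_cmul)
qed

text \<open>In place of integration by parts: translating \<phi> along the \<open>i\<close>-th axis
  multiplies its Fourier transform by an exponential in \<open>\<xi> $ i\<close>, and the difference
  quotients of the translates converge to the partial derivative under a common integrable majorant.
  Differentiating the exponential at \<open>0\<close> gives the factor.\<close>

lemma fourier_partial_deriv:
  fixes \<phi> :: "real ^ 'n::finite \<Rightarrow> complex"
  assumes \<phi>: "\<phi> \<in> schwartz_space"
  shows "fourier (partial_deriv i \<phi>) \<xi> = 2 * of_real pi * \<i> * of_real (\<xi> $ i) * fourier \<phi> \<xi>"
proof -
  define N where "N = 2 * CARD('n)"
  define e :: "real^'n" where "e = axis i 1"
  define E where "E x = exp (- 2 * of_real pi * \<i> * of_real (x \<bullet> \<xi>))" for x :: "real^'n"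
  define t where "t n = 1 / (1 + real n)" for n
  have t: "0 < t n" "t n \<le> 1" for n
    by (auto simp: t_def field_simps)
  have t_ne: "t n \<noteq> 0" for n
    using t(1)[of n] by simp
  have t0: "t \<longlonglongrightarrow> 0"
    unfolding t_def using LIMSEQ_inverse_real_of_nat by (simp add: inverse_eq_divide add.commute)
  have normE [simp]: "norm (E x) = 1" for x
    unfolding E_def by (rule norm_exp_i_real)
  define \<psi> where "\<psi> = partial_deriv i \<phi>"
  have \<psi>: "\<psi> \<in> schwartz_space"
    unfolding \<psi>_def by (rule schwartz_partial_deriv[OF \<phi>])
  have [measurable]: "\<phi> \<in> borel_measurable borel" "\<psi> \<in> borel_measurable borel"
    using \<phi> \<psi> by (auto intro: schwartz_borel_measurable)
  have [measurable]: "E \<in> borel_measurable borel"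
    unfolding E_def by measurable
  define K where "K = schwartz_seminorm 0 [] \<psi> + schwartz_seminorm N [] \<psi>"
  have K: "0 \<le> K"
    unfolding K_def by (intro add_nonneg_nonneg schwartz_seminorm_nonneg \<psi>)
  define q where "q n x = (\<phi> (x + t n *\<^sub>R e) - \<phi> x) / of_real (t n)" for n x
  \<comment> \<open>The common majorant: by the mean value inequality \<open>q n x\<close> is
    controlled by \<psi> on a segment of length at most \<open>1\<close> starting at
    \<open>x\<close>, and there the decay weight of \<psi> is comparable to its value at
    \<open>x\<close>.\<close>
  define w where "w x = K * (1 + 2 ^ N) * (1 / (1 + norm x ^ N))" for x :: "real^'n"
  have vd: "((\<lambda>s. \<phi> (x + s *\<^sub>R e)) has_vector_derivative \<psi> (x + s *\<^sub>R e)) (at s within A)" for x s A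
    unfolding e_def \<psi>_def by (rule partial_deriv_has_vector_derivative[OF \<phi>])
  have q_le: "norm (q n x) \<le> w x" for n x
  proof -
    have "norm (\<phi> (x + t n *\<^sub>R e) - \<phi> (x + 0 *\<^sub>R e)) \<le> w x * norm (t n - 0)"
    proof (rule differentiable_bound[where S = "{0..t n}" and f' = "\<lambda>s r. r *\<^sub>R \<psi> (x + s *\<^sub>R e)"])
      show "((\<lambda>s. \<phi> (x + s *\<^sub>R e)) has_derivative (\<lambda>r. r *\<^sub>R \<psi> (x + s *\<^sub>R e))) (at s within {0..t n})" for s
        using vd[of x s] by (simp add: has_vector_derivative_def)
      fix s assume s: "s \<in> {0..t n}"
      have "norm (s *\<^sub>R e) \<le> 1"
        using s t[of n] by (simp add: e_def norm_axis_1)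
      then have "norm x \<le> norm (x + s *\<^sub>R e) + 1"
        using norm_triangle_ineq4[of "x + s *\<^sub>R e" "s *\<^sub>R e"] by simp
      then have "1 / (1 + norm (x + s *\<^sub>R e) ^ N) \<le> (1 + 2 ^ N) * (1 / (1 + norm x ^ N))"
        by (intro inverse_one_plus_power_shift) auto
      then have "K * (1 / (1 + norm (x + s *\<^sub>R e) ^ N)) \<le> w x"
        using K unfolding w_def mult.assoc by (rule mult_left_mono)
      moreover have "norm (\<psi> (x + s *\<^sub>R e)) \<le> K * (1 / (1 + norm (x + s *\<^sub>R e) ^ N))"
        unfolding K_def by (rule schwartz_decay[OF \<psi>])
      ultimately show "onorm (\<lambda>r. r *\<^sub>R \<psi> (x + s *\<^sub>R e)) \<le> w x"
        by (intro onorm_le) (simp add: mult.commute mult_left_mono)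
    qed (use t[of n] in auto)
    then show ?thesis
      using t[of n] by (simp add: q_def norm_divide field_simps)
  qed
  have q_lim: "(\<lambda>n. q n x) \<longlonglongrightarrow> \<psi> x" for x
  proof -
    have "((\<lambda>s. (\<phi> (x + s *\<^sub>R e) - \<phi> x) /\<^sub>R s) \<longlongrightarrow> \<psi> x) (at 0)"
    proof (rule LIM_zero_cancel, rule tendsto_norm_zero_cancel)
      have "((\<lambda>s. norm (\<phi> (x + s *\<^sub>R e) - \<phi> x - s *\<^sub>R \<psi> x) / norm s) \<longlongrightarrow> 0) (at 0)"
        using vd[of x 0 UNIV] unfolding has_vector_derivative_def has_derivative_at by simp
      moreover have "\<forall>\<^sub>F s in at 0. norm (\<phi> (x + s *\<^sub>R e) - \<phi> x - s *\<^sub>R \<psi> x) / norm s =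
          norm ((\<phi> (x + s *\<^sub>R e) - \<phi> x) /\<^sub>R s - \<psi> x)"
      proof (rule eventually_mono[OF eventually_neq_at_within[of 0]])
        fix s :: real assume "s \<noteq> 0"
        then have "(\<phi> (x + s *\<^sub>R e) - \<phi> x) /\<^sub>R s - \<psi> x = (\<phi> (x + s *\<^sub>R e) - \<phi> x - s *\<^sub>R \<psi> x) /\<^sub>R s"
          by (simp add: scaleR_right_diff_distrib)
        then show "norm (\<phi> (x + s *\<^sub>R e) - \<phi> x - s *\<^sub>R \<psi> x) / norm s =
          norm ((\<phi> (x + s *\<^sub>R e) - \<phi> x) /\<^sub>R s - \<psi> x)"
          by (simp add: divide_inverse mult.commute)
      qed
      ultimately show "((\<lambda>s. norm ((\<phi> (x + s *\<^sub>R e) - \<phi> x) /\<^sub>R s - \<psi> x)) \<longlongrightarrow> 0) (at 0)"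
        by (rule Lim_transform_eventually)
    qed
    moreover have "filterlim t (at 0) sequentially"
      unfolding filterlim_at using t t0 by (auto intro!: always_eventually simp: t_ne)
    ultimately have "(\<lambda>n. (\<phi> (x + t n *\<^sub>R e) - \<phi> x) /\<^sub>R t n) \<longlonglongrightarrow> \<psi> x"
      by (rule filterlim_compose)
    then show ?thesis
      by (simp add: q_def scaleR_conv_of_real divide_inverse mult.commute)
  qed
  have "(\<lambda>n. LINT x|lborel. E x * q n x) \<longlonglongrightarrow> (LINT x|lborel. E x * \<psi> x)"
  proof (rule integral_dominated_convergence[where w = w])
    show "integrable lborel w"
      unfolding w_def N_def by (intro integrable_mult_right integrable_inverse_one_plus_norm_power)
    show "AE x in lborel. (\<lambda>n. E x * q n x) \<longlonglongrightarrow> E x * \<psi> x"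
      by (intro AE_I2 tendsto_mult_left q_lim)
    show "AE x in lborel. norm (E x * q n x) \<le> w x" for n
      using q_le by (simp add: norm_mult)
  qed (simp_all add: q_def)
  moreover have "(LINT x|lborel. E x * q n x) =
      (exp (2 * of_real pi * \<i> * of_real (\<xi> $ i) * of_real (t n)) - 1) / of_real (t n) * fourier \<phi> \<xi>" for n
  proof -
    let ?c = "exp (2 * of_real pi * \<i> * of_real (\<xi> $ i) * of_real (t n))"
    have E_add: "E (t n *\<^sub>R e + x) * ?c = E x" for x
      unfolding E_def e_def exp_add[symmetric]
      by (simp add: inner_add_left inner_axis' algebra_simps)
    have int0: "integrable lborel (\<lambda>x. E x * \<phi> x)"
      unfolding E_def by (intro fourier_integrand_integrable schwartz_integrable \<phi>)
    have "integrable (distr lborel borel ((+) (t n *\<^sub>R e))) (\<lambda>x. E x * \<phi> x)"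
      unfolding lborel_distr_plus by (rule int0)
    then have int1: "integrable lborel (\<lambda>x. E (t n *\<^sub>R e + x) * \<phi> (t n *\<^sub>R e + x))"
      by (subst (asm) integrable_distr_eq) auto
    have "(LINT x|lborel. E x * \<phi> x) = (LINT x|distr lborel borel ((+) (t n *\<^sub>R e)). E x * \<phi> x)"
      unfolding lborel_distr_plus ..
    also have "\<dots> = (LINT x|lborel. E (t n *\<^sub>R e + x) * \<phi> (t n *\<^sub>R e + x))"
      by (rule integral_distr) auto
    finally have sh: "?c * (LINT x|lborel. E x * \<phi> x) =
        (LINT x|lborel. ?c * (E (t n *\<^sub>R e + x) * \<phi> (t n *\<^sub>R e + x)))"
      by simp
    have "E x * q n x = (?c * (E (t n *\<^sub>R e + x) * \<phi> (t n *\<^sub>R e + x)) - E x * \<phi> x) / of_real (t n)" for x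
      unfolding q_def using E_add[of x] by (simp add: algebra_simps)
    then have "(LINT x|lborel. E x * q n x) =
        ((LINT x|lborel. ?c * (E (t n *\<^sub>R e + x) * \<phi> (t n *\<^sub>R e + x))) - (LINT x|lborel. E x * \<phi> x)) / of_real (t n)"
      using int0 int1 by (simp only: integral_divide_zero, subst Bochner_Integration.integral_diff) auto
    then show ?thesis
      unfolding sh[symmetric] by (simp add: fourier_def E_def algebra_simps)
  qed
  moreover have "(\<lambda>n. (exp (2 * of_real pi * \<i> * of_real (\<xi> $ i) * of_real (t n)) - 1) / of_real (t n) * fourier \<phi> \<xi>)
      \<longlonglongrightarrow> 2 * of_real pi * \<i> * of_real (\<xi> $ i) * fourier \<phi> \<xi>"
  proof (rule tendsto_mult_right)
    let ?a = "2 * of_real pi * \<i> * of_real (\<xi> $ i)"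
    have "((\<lambda>z. exp (?a * z)) has_field_derivative ?a) (at 0)"
      by (auto intro!: derivative_eq_intros)
    then have "((\<lambda>z. (exp (?a * z) - 1) / z) \<longlongrightarrow> ?a) (at 0)"
      by (simp add: has_field_derivative_iff)
    moreover have "filterlim (\<lambda>n. complex_of_real (t n)) (at 0) sequentially"
      unfolding filterlim_at using t t0
      by (auto intro!: always_eventually simp: t_ne tendsto_of_real_iff[where 'a = complex, of _ 0, simplified])
    ultimately show "(\<lambda>n. (exp (?a * of_real (t n)) - 1) / of_real (t n)) \<longlonglongrightarrow> ?a"
      by (rule filterlim_compose)
  qed
  ultimately have "(LINT x|lborel. E x * \<psi> x) = 2 * of_real pi * \<i> * of_real (\<xi> $ i) * fourier \<phi> \<xi>"
    using LIMSEQ_unique by (metis (no_types, lifting) ext)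
  then show ?thesis
    by (simp add: fourier_def E_def \<psi>_def)
qed

text \<open>Each derivative in direction \<open>i\<close> produces one factor
  \<open>2 * pi * \<bar>\<xi> $ i\<bar>\<close> and stays in the Schwartz space; hence the induction
  generalizes over \<phi>, and the start is the trivial bound by the \<open>L^1\<close>
  norm.\<close>

lemma fourier_coordinate_power_bounded:
  fixes \<phi> :: "real ^ 'n::finite \<Rightarrow> complex"
  assumes "\<phi> \<in> schwartz_space"
  shows "\<exists>C. \<forall>\<xi>. \<bar>\<xi> $ i\<bar> ^ N * norm (fourier \<phi> \<xi>) \<le> C"
  using assms
proof (induction N arbitrary: \<phi>)
  case 0
  then show ?case
    using norm_fourier_le[of \<phi>] by auto
next
  case (Suc N)
  obtain C where C: "\<And>\<xi>. \<bar>\<xi> $ i\<bar> ^ N * norm (fourier (partial_deriv i \<phi>) \<xi>) \<le> C"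
    using Suc.IH[OF schwartz_partial_deriv[OF Suc.prems]] by auto
  have "\<bar>\<xi> $ i\<bar> ^ Suc N * norm (fourier \<phi> \<xi>) \<le> C / (2 * pi)" for \<xi>
    using C[of \<xi>] by (simp add: fourier_partial_deriv[OF Suc.prems] norm_mult field_simps)
  then show ?case by blast
qed

text \<open>The functions to be transformed are merely bounded superpositions, so Fubini's theorem
  against \<open>fourier \<phi>\<close> needs \<open>fourier \<phi>\<close> itself to be integrable.
  Decay of order \<open>2 * CARD('n)\<close> is enough for this.\<close>

lemma fourier_schwartz_integrable:
  fixes \<phi> :: "real ^ 'n::finite \<Rightarrow> complex"
  assumes "\<phi> \<in> schwartz_space"
  shows "integrable lborel (fourier \<phi>)"
proof -
  define N where "N = 2 * CARD('n)"
  obtain C where C: "\<And>i \<xi>. \<bar>\<xi> $ i\<bar> ^ N * norm (fourier \<phi> \<xi>) \<le> C i"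
    using fourier_coordinate_power_bounded[OF assms, of _ N] by metis
  define L where "L = (LINT x|lborel. norm (\<phi> x)) + real CARD('n) ^ N * (\<Sum>i\<in>UNIV. \<bar>C i\<bar>)"
  have bound: "norm (fourier \<phi> \<xi>) \<le> L * (1 / (1 + norm \<xi> ^ N))" for \<xi>
  proof -
    \<comment> \<open>Only powers of single coordinates are controlled. The largest coordinate
      dominates the norm up to the factor \<open>CARD('n)\<close>; since \<open>i\<close> depends on
      \<xi>, the constants \<open>C i\<close> are summed.\<close>
    obtain i where i: "\<And>j. \<bar>\<xi> $ j\<bar> \<le> \<bar>\<xi> $ i\<bar>"
      using Max_in[of "range (\<lambda>j. \<bar>\<xi> $ j\<bar>)"] Max_ge[of "range (\<lambda>j. \<bar>\<xi> $ j\<bar>)"]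
      by (smt (verit) UNIV_not_empty finite finite_imageI image_iff image_is_empty rangeI)
    have "norm \<xi> \<le> (\<Sum>j\<in>UNIV. \<bar>\<xi> $ j\<bar>)"
      by (rule norm_le_l1_cart)
    also have "\<dots> \<le> (\<Sum>j\<in>(UNIV::'n set). \<bar>\<xi> $ i\<bar>)"
      by (intro sum_mono i)
    finally have "norm \<xi> ^ N \<le> (real CARD('n) * \<bar>\<xi> $ i\<bar>) ^ N"
      by (intro power_mono) auto
    then have "norm \<xi> ^ N * norm (fourier \<phi> \<xi>) \<le> real CARD('n) ^ N * (\<bar>\<xi> $ i\<bar> ^ N * norm (fourier \<phi> \<xi>))"
      by (metis mult.assoc mult_right_mono norm_ge_zero power_mult_distrib)
    also have "\<dots> \<le> real CARD('n) ^ N * (\<Sum>i\<in>UNIV. \<bar>C i\<bar>)"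
      using member_le_sum[of i UNIV "\<lambda>i. \<bar>C i\<bar>"] C[of \<xi> i]
      by (intro mult_left_mono) auto
    finally have "norm (fourier \<phi> \<xi>) * (1 + norm \<xi> ^ N) \<le> L"
      using norm_fourier_le[of \<phi> \<xi>] by (simp add: L_def algebra_simps)
    moreover have "0 < 1 + norm \<xi> ^ N"
      by (simp add: add_pos_nonneg)
    ultimately show ?thesis by (simp add: field_simps)
  qed
  have [measurable]: "\<phi> \<in> borel_measurable borel"
    by (rule schwartz_borel_measurable) fact
  show ?thesis
  proof (rule Bochner_Integration.integrable_bound)
    show "integrable lborel (\<lambda>x::real^'n. L * (1 / (1 + norm x ^ N)))"
      unfolding N_def by (intro integrable_mult_right integrable_inverse_one_plus_norm_power)
    show "AE x in lborel. norm (fourier \<phi> x) \<le> norm (L * (1 / (1 + norm x ^ N)))"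
      using bound by (intro AE_I2) (metis abs_ge_self order.trans real_norm_def)
  qed simp
qed

section \<open>Cauchy's theorem for rectangles\<close>

lemma contour_integral_linepath_same_Im:
  assumes "a < b"
  shows "contour_integral (linepath (Complex a c) (Complex b c)) f = integral {a..b} (\<lambda>x. f (Complex x c))"
proof -
  let ?g = "\<lambda>x. f (of_real x + \<i> * of_real c)"
  have "contour_integral (linepath (Complex a c) (Complex b c)) f =
      (Complex b c - Complex a c) * integral {0..1} (\<lambda>x. f (linepath (Complex a c) (Complex b c) x))"
    by (simp add: contour_integral_integral)
  also have "Complex b c - Complex a c = of_real b - of_real a"
    by (simp add: complex_eq_iff)
  also have "(\<lambda>x. f (linepath (Complex a c) (Complex b c) x)) = (\<lambda>x. ?g (linepath a b x))"
    by (intro ext arg_cong[of _ _ f]) (simp add: linepath_def complex_eq_iff algebra_simps)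
  also have "(of_real b - of_real a) * integral {0..1} (\<lambda>x. ?g (linepath a b x)) =
      contour_integral (linepath (of_real a) (of_real b)) (\<lambda>z. f (z + \<i> * of_real c))"
    by (simp add: contour_integral_integral linepath_def scaleR_conv_of_real)
  also have "\<dots> = integral {a..b} ?g"
    using assms by (subst contour_integral_linepath_Reals_eq) auto
  finally show ?thesis
    by (simp add: Complex_eq)
qed

lemma contour_integral_rectpath:
  assumes "a < b" "c < d" and cont: "continuous_on (path_image (rectpath (Complex a c) (Complex b d))) f"
  shows "contour_integral (rectpath (Complex a c) (Complex b d)) f =
      integral {a..b} (\<lambda>x. f (Complex x c)) + \<i> * integral {c..d} (\<lambda>y. f (Complex b y))
    - integral {a..b} (\<lambda>x. f (Complex x d)) - \<i> * integral {c..d} (\<lambda>y. f (Complex a y))"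
proof -
  define l1 l2 l3 l4 where
    "l1 = linepath (Complex a c) (Complex b c)" and "l2 = linepath (Complex b c) (Complex b d)" and
    "l3 = linepath (Complex b d) (Complex a d)" and "l4 = linepath (Complex a d) (Complex a c)"
  have rp: "rectpath (Complex a c) (Complex b d) = l1 +++ l2 +++ l3 +++ l4"
    by (simp add: rectpath_def Let_def l1_def l2_def l3_def l4_def)
  have pi: "path_image (rectpath (Complex a c) (Complex b d)) =
      path_image l1 \<union> path_image l2 \<union> path_image l3 \<union> path_image l4"
    unfolding rp by (simp add: path_image_join l1_def l2_def l3_def l4_def Un_assoc)
  have "continuous_on (path_image l1) f" "continuous_on (path_image l2) f"
    "continuous_on (path_image l3) f" "continuous_on (path_image l4) f"
    using continuous_on_subset[OF cont] unfolding pi by blast+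
  then have ci: "f contour_integrable_on l1" "f contour_integrable_on l2"
    "f contour_integrable_on l3" "f contour_integrable_on l4"
    unfolding l1_def l2_def l3_def l4_def by (simp_all add: contour_integrable_continuous_linepath)
  have "contour_integral (rectpath (Complex a c) (Complex b d)) f =
      contour_integral l1 f + (contour_integral l2 f + (contour_integral l3 f + contour_integral l4 f))"
    unfolding rp using ci
    by (subst contour_integral_join contour_integrable_join;
        simp add: l1_def l2_def l3_def l4_def)+
  moreover have "contour_integral l1 f = integral {a..b} (\<lambda>x. f (Complex x c))"
    unfolding l1_def by (rule contour_integral_linepath_same_Im) fact
  moreover have "contour_integral l2 f = \<i> * integral {c..d} (\<lambda>x. f (Complex b x))"
    unfolding l2_def by (rule contour_integral_linepath_same_Re) (use assms in auto)
  moreover have "contour_integral l3 f = - integral {a..b} (\<lambda>x. f (Complex x d))"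
    unfolding l3_def using contour_integral_linepath_same_Im[OF \<open>a < b\<close>, of d f]
      contour_integral_reversepath[of "linepath (Complex a d) (Complex b d)" f] by simp
  moreover have "contour_integral l4 f = - (\<i> * integral {c..d} (\<lambda>x. f (Complex a x)))"
    unfolding l4_def using contour_integral_linepath_same_Re[of "Complex a c" a "Complex a d" c d f] assms
      contour_integral_reversepath[of "linepath (Complex a c) (Complex a d)" f] by simp
  ultimately show ?thesis by simp
qed

text \<open>Weak inequalities are allowed because degenerate rectangles arise in the applications,
  for instance as the member \<open>n = 0\<close> of an exhausting sequence; both sides then agree
  trivially.\<close>

lemma Cauchy_rectangle:
  assumes "a \<le> b" "c \<le> d" and hol: "f holomorphic_on S"
    and sub: "\<And>z. a \<le> Re z \<Longrightarrow> Re z \<le> b \<Longrightarrow> c \<le> Im z \<Longrightarrow> Im z \<le> d \<Longrightarrow> z \<in> S"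
  shows "integral {a..b} (\<lambda>x. f (Complex x c)) + \<i> * integral {c..d} (\<lambda>y. f (Complex b y)) =
    integral {a..b} (\<lambda>x. f (Complex x d)) + \<i> * integral {c..d} (\<lambda>y. f (Complex a y))"
proof (cases "a < b \<and> c < d")
  case True
  let ?Q = "cbox (Complex a c) (Complex b d)"
  have Q: "?Q \<subseteq> S"
    using sub by (auto simp: in_cbox_complex_iff)
  have f: "f holomorphic_on ?Q"
    by (rule holomorphic_on_subset[OF hol Q])
  have P: "path_image (rectpath (Complex a c) (Complex b d)) \<subseteq> ?Q"
    using True by (intro path_image_rectpath_subset_cbox) auto
  have "(f has_contour_integral 0) (rectpath (Complex a c) (Complex b d))"
    by (rule Cauchy_theorem_convex_simple[OF f]) (use P in \<open>auto intro: convex_box\<close>)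
  then have "contour_integral (rectpath (Complex a c) (Complex b d)) f = 0"
    by (rule contour_integral_unique)
  moreover have "continuous_on (path_image (rectpath (Complex a c) (Complex b d))) f"
    using P f holomorphic_on_imp_continuous_on continuous_on_subset by blast
  ultimately show ?thesis
    using contour_integral_rectpath[of a b c d f] True by (simp add: algebra_simps)
next
  case False
  then have "a = b \<or> c = d" using assms by auto
  then show ?thesis by auto
qed

lemma residue_rectangle:
  assumes "a < Re p" "Re p < b" "c < Im p" "Im p < d" and hol: "f holomorphic_on S - {p}"
    and "open S" "connected S"
    and sub: "\<And>z. a \<le> Re z \<Longrightarrow> Re z \<le> b \<Longrightarrow> c \<le> Im z \<Longrightarrow> Im z \<le> d \<Longrightarrow> z \<in> S"
  shows "integral {a..b} (\<lambda>x. f (Complex x c)) + \<i> * integral {c..d} (\<lambda>y. f (Complex b y))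
    - integral {a..b} (\<lambda>x. f (Complex x d)) - \<i> * integral {c..d} (\<lambda>y. f (Complex a y)) =
    2 * pi * \<i> * residue f p"
proof -
  let ?R = "rectpath (Complex a c) (Complex b d)"
  let ?Q = "cbox (Complex a c) (Complex b d)"
  have Q: "?Q \<subseteq> S"
    using sub by (auto simp: in_cbox_complex_iff)
  have p: "p \<in> box (Complex a c) (Complex b d)"
    using assms by (simp add: in_box_complex_iff)
  have P: "path_image ?R \<subseteq> ?Q - {p}"
    using p path_image_rectpath_cbox_minus_box[of "Complex a c" "Complex b d"] assms by auto
  have "contour_integral ?R f = 2 * pi * \<i> * (\<Sum>p\<in>{p}. winding_number ?R p * residue f p)"
  proof (rule Residue_theorem)
    show "\<forall>z. z \<notin> S \<longrightarrow> winding_number ?R z = 0"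
      using Q assms by (auto intro!: winding_number_rectpath_outside)
  qed (use assms P Q in auto)
  moreover have "winding_number ?R p = 1"
    by (rule winding_number_rectpath[OF p])
  moreover have "continuous_on (path_image ?R) f"
    using P Q hol holomorphic_on_imp_continuous_on continuous_on_subset by (meson Diff_mono order_refl order_trans)
  ultimately show ?thesis
    using contour_integral_rectpath[of a b c d f] assms by (simp add: algebra_simps)
qed

section \<open>Complex Gaussians\<close>

lemma norm_integral_le_Icc:
  fixes f :: "real \<Rightarrow> complex"
  assumes "\<And>t. t \<in> {a..b} \<Longrightarrow> norm (f t) \<le> M" "a \<le> b" "0 \<le> M"
  shows "norm (integral {a..b} f) \<le> M * (b - a)"
proof (cases "f integrable_on {a..b}")
  case True
  then have "norm (integral {a..b} f) \<le> M * Henstock_Kurzweil_Integration.content {a..b}"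
    by (intro has_integral_bound_real[where f = f and S = "{}"]) (use assms in \<open>auto simp: integrable_integral\<close>)
  then show ?thesis using assms by simp
next
  \<comment> \<open>A non-integrable function has integral \<open>0\<close>, and
    \<open>0 \<le> M\<close> keeps the bound true.\<close>
  case False
  then show ?thesis using assms by (simp add: not_integrable_integral)
qed

lemma tendsto_vertical_integral:
  fixes f :: "complex \<Rightarrow> complex"
  assumes "c \<le> d" and "(M \<longlongrightarrow> 0) F"
    and "\<forall>\<^sub>F x in F. \<forall>y\<in>{c..d}. norm (f (Complex x y)) \<le> M x"
  shows "((\<lambda>x. integral {c..d} (\<lambda>y. f (Complex x y))) \<longlongrightarrow> 0) F"
proof (rule Lim_null_comparison)
  show "\<forall>\<^sub>F x in F. norm (integral {c..d} (\<lambda>y. f (Complex x y))) \<le> M x * (d - c)"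
    using assms(3)
  proof eventually_elim
    case (elim x)
    then have "0 \<le> M x"
      using assms(1) norm_ge_zero order.trans by (metis atLeastAtMost_iff order_refl)
    with elim show ?case
      using assms(1) by (intro norm_integral_le_Icc) auto
  qed
  show "((\<lambda>x. M x * (d - c)) \<longlongrightarrow> 0) F"
    using tendsto_mult_right[OF assms(2), of "d - c"] by simp
qed

lemma tendsto_integral_symmetric:
  fixes f :: "real \<Rightarrow> complex"
  assumes "integrable lborel f"
  shows "(\<lambda>n. integral {- real n..real n} f) \<longlonglongrightarrow> (LINT x|lborel. f x)"
proof -
  have U: "(\<Union>n. {- real n..real n}) = UNIV"
  proof (intro equalityI subsetI UNIV_I)
    fix x :: real
    obtain n where "\<bar>x\<bar> \<le> real n" using real_arch_simple by blast
    then show "x \<in> (\<Union>n. {- real n..real n})" by (intro UN_I[of n]) auto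
  qed
  have "(\<lambda>n. LINT x:{- real n..real n}|lborel. f x) \<longlonglongrightarrow> (LINT x:(\<Union>n. {- real n..real n})|lborel. f x)"
    by (rule set_integral_cont_up) (use assms U in \<open>auto simp: incseq_def set_integrable_def\<close>)
  moreover have "(LINT x:{- real n..real n}|lborel. f x) = integral {- real n..real n} f" for n
    by (rule set_borel_integral_eq_integral(2))
      (use assms in \<open>auto simp: set_integrable_def intro: integrable_mult_indicator\<close>)
  ultimately show ?thesis unfolding U by (simp add: set_lebesgue_integral_def)
qed

lemma tendsto_integral_atLeast:
  fixes f :: "real \<Rightarrow> complex"
  assumes "set_integrable lborel {a..} f"
  shows "(\<lambda>n. integral {a..a + real n} f) \<longlonglongrightarrow> (LINT x:{a..}|lborel. f x)"
proof -
  have U: "(\<Union>n. {a..a + real n}) = {a..}"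
  proof (intro equalityI subsetI)
    fix x :: real assume x: "x \<in> {a..}"
    obtain n where "x - a \<le> real n" using real_arch_simple by blast
    then show "x \<in> (\<Union>n. {a..a + real n})" using x by (intro UN_I[of n]) auto
  qed auto
  have sub: "set_integrable lborel {a..a + real n} f" for n
    by (rule set_integrable_subset[OF assms]) auto
  have "(\<lambda>n. LINT x:{a..a + real n}|lborel. f x) \<longlonglongrightarrow> (LINT x:(\<Union>n. {a..a + real n})|lborel. f x)"
    by (rule set_integral_cont_up) (use assms U in \<open>auto simp: incseq_def\<close>)
  moreover have "(LINT x:{a..a + real n}|lborel. f x) = integral {a..a + real n} f" for n
    by (rule set_borel_integral_eq_integral(2)) (rule sub)
  ultimately show ?thesis unfolding U by simp
qed

lemma integral_horizontal_shift:
  fixes f :: "complex \<Rightarrow> complex"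
  assumes "c \<le> d" and hol: "f holomorphic_on S" and sub: "\<And>w. c \<le> Im w \<Longrightarrow> Im w \<le> d \<Longrightarrow> w \<in> S"
    and int: "integrable lborel (\<lambda>x. f (Complex x c))" "integrable lborel (\<lambda>x. f (Complex x d))"
    and M: "(M \<longlongrightarrow> 0) at_top" "(M \<longlongrightarrow> 0) at_bot"
    and bound: "\<And>x y. c \<le> y \<Longrightarrow> y \<le> d \<Longrightarrow> norm (f (Complex x y)) \<le> M x"
  shows "(LINT x|lborel. f (Complex x c)) = (LINT x|lborel. f (Complex x d))"
proof -
  have top: "filterlim real at_top sequentially" and bot: "filterlim (\<lambda>n. - real n) at_bot sequentially"
    by (auto simp: filterlim_real_sequentially filterlim_uminus_at_top[symmetric])
  let ?V = "\<lambda>x. integral {c..d} (\<lambda>y. f (Complex x y))"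
  have V: "(?V \<longlongrightarrow> 0) at_top" "(?V \<longlongrightarrow> 0) at_bot"
    by (rule tendsto_vertical_integral[where M = M]; use assms in auto)+
  have "(\<lambda>n. integral {- real n..real n} (\<lambda>x. f (Complex x c)) + \<i> * ?V (real n) - \<i> * ?V (- real n))
      \<longlonglongrightarrow> (LINT x|lborel. f (Complex x c)) + \<i> * 0 - \<i> * 0"
    by (intro tendsto_intros tendsto_integral_symmetric int filterlim_compose[OF V(1) top]
        filterlim_compose[OF V(2) bot])
  moreover have "integral {- real n..real n} (\<lambda>x. f (Complex x c)) + \<i> * ?V (real n) - \<i> * ?V (- real n) =
      integral {- real n..real n} (\<lambda>x. f (Complex x d))" for n
    using Cauchy_rectangle[of "- real n" "real n" c d f S] assms by (simp add: algebra_simps)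
  moreover have "(\<lambda>n. integral {- real n..real n} (\<lambda>x. f (Complex x d))) \<longlonglongrightarrow> (LINT x|lborel. f (Complex x d))"
    by (rule tendsto_integral_symmetric[OF int(2)])
  ultimately show ?thesis
    using LIMSEQ_unique by fastforce
qed

text \<open>For \<open>Re z > 0\<close> this is the principal branch of
  \<open>sqrt (pi / z)\<close>. Kept as an integral, it requires no choice of a branch, and its
  measurability and modulus bound are immediate.\<close>

definition cgauss_const :: "complex \<Rightarrow> complex" where
  "cgauss_const z = (LINT t|lborel. exp (- z * of_real t ^ 2))"

lemma cgauss_const_measurable [measurable]: "cgauss_const \<in> borel_measurable borel"
  unfolding cgauss_const_def[abs_def] by measurable

lemma norm_exp_cgauss: "norm (exp (- z * of_real t ^ 2)) = exp (- Re z * t\<^sup>2)"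
  by (simp add: norm_exp_eq_Re flip: of_real_power)

lemma integrable_cgauss_1:
  assumes "0 < Re z"
  shows "integrable lborel (\<lambda>t::real. exp (- z * of_real t ^ 2))"
  by (rule Bochner_Integration.integrable_bound[OF integrable_gaussian_1[OF assms]])
    (simp_all only: norm_exp_cgauss, simp_all)

lemma norm_cgauss_const_le:
  assumes "0 < Re z"
  shows "norm (cgauss_const z) \<le> gauss_const * Re z powr (- 1/2)"
proof -
  have "norm (cgauss_const z) \<le> (LINT t|lborel. norm (exp (- z * of_real t ^ 2)))"
    unfolding cgauss_const_def by (rule integral_norm_bound)
  then show ?thesis
    unfolding norm_exp_cgauss integral_gaussian_1[OF assms] .
qed

text \<open>Off the real line the exponent acquires a cross term proportional to
  \<open>Im z * x * y\<close>. Completing a square absorbs it into half of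
  \<open>Re z * x\<^sup>2\<close>, so Gaussian decay in \<open>x\<close> survives uniformly for
  bounded \<open>y\<close>.\<close>

lemma norm_exp_cgauss_Complex_le:
  assumes "0 < Re z" "\<bar>y\<bar> \<le> Y"
  shows "norm (exp (- z * (Complex x y) ^ 2)) \<le>
    exp (2 * (Im z)\<^sup>2 * Y\<^sup>2 / Re z + Re z * Y\<^sup>2) * exp (- (Re z / 2) * x\<^sup>2)"
proof -
  let ?a = "Re z" and ?b = "Im z"
  have "2 * ?b * x * y \<le> 2 * ?b\<^sup>2 * y\<^sup>2 / ?a + ?a / 2 * x\<^sup>2"
  proof -
    have "0 \<le> (2 * ?b * y - ?a * x)\<^sup>2 / (2 * ?a)"
      using assms by simp
    also have "\<dots> = 2 * ?b\<^sup>2 * y\<^sup>2 / ?a + ?a / 2 * x\<^sup>2 - 2 * ?b * x * y"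
      using assms by (simp add: power2_eq_square field_simps)
    finally show ?thesis by simp
  qed
  moreover have "y\<^sup>2 \<le> Y\<^sup>2"
    using assms by (metis abs_ge_zero power2_abs power_mono)
  then have "2 * ?b\<^sup>2 * y\<^sup>2 / ?a \<le> 2 * ?b\<^sup>2 * Y\<^sup>2 / ?a" "?a * y\<^sup>2 \<le> ?a * Y\<^sup>2"
    using assms by (auto intro!: divide_right_mono mult_left_mono)
  moreover have "Re (- z * (Complex x y) ^ 2) = - ?a * x\<^sup>2 + ?a * y\<^sup>2 + 2 * ?b * x * y"
    by (simp add: power2_eq_square algebra_simps)
  ultimately have "Re (- z * (Complex x y) ^ 2) \<le> (2 * ?b\<^sup>2 * Y\<^sup>2 / ?a + ?a * Y\<^sup>2) + (- (?a / 2) * x\<^sup>2)"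
    by simp
  then show ?thesis
    unfolding norm_exp_eq_Re exp_add[symmetric] by simp
qed

lemma tendsto_exp_neg_at_top:
  fixes g :: "'a \<Rightarrow> real"
  assumes "0 < r" "filterlim g at_top F"
  shows "((\<lambda>x. exp (- r * g x)) \<longlongrightarrow> 0) F"
proof -
  have "filterlim (\<lambda>x. - r * g x) at_bot F"
    using filterlim_tendsto_pos_mult_at_top[OF tendsto_const assms] by (simp add: filterlim_uminus_at_top)
  then show ?thesis by (rule filterlim_compose[OF exp_at_bot])
qed

lemma tendsto_exp_neg_square:
  assumes "0 < (a::real)"
  shows "((\<lambda>x. exp (- a * x\<^sup>2)) \<longlongrightarrow> 0) at_top" "((\<lambda>x. exp (- a * x\<^sup>2)) \<longlongrightarrow> 0) at_bot"
proof -
  have *: "((\<lambda>x. exp (- a * x\<^sup>2)) \<longlongrightarrow> 0) F" if "filterlim (\<lambda>x. \<bar>x\<bar>) at_top F" for F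
  proof -
    have "filterlim (\<lambda>x::real. \<bar>x\<bar>\<^sup>2) at_top F"
      by (rule filterlim_pow_at_top[OF _ that]) auto
    then show ?thesis
      using tendsto_exp_neg_at_top[OF assms] by simp
  qed
  show "((\<lambda>x. exp (- a * x\<^sup>2)) \<longlongrightarrow> 0) at_top" "((\<lambda>x. exp (- a * x\<^sup>2)) \<longlongrightarrow> 0) at_bot"
    by (rule *, simp add: filterlim_abs_real filterlim_at_bot_mirror)+
qed

text \<open>The real part of \<open>w\<close> is removed by translation invariance, the imaginary
  part by moving the line of integration. This is what allows completing the square with a complex
  centre in the Fourier integral of a Gaussian.\<close>

lemma cgauss_shift:
  assumes "0 < Re z"
  shows "(LINT t|lborel. exp (- z * (of_real t + w) ^ 2)) = cgauss_const z"
proof -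
  define f where "f v = exp (- z * v ^ 2)" for v
  define K where "K Y = exp (2 * (Im z)\<^sup>2 * Y\<^sup>2 / Re z + Re z * Y\<^sup>2)" for Y
  define M where "M x = K \<bar>Im w\<bar> * exp (- (Re z / 2) * x\<^sup>2)" for x
  have [measurable]: "(\<lambda>x. f (Complex x y)) \<in> borel_measurable borel" for y
    unfolding f_def Complex_eq by measurable
  have a: "0 < Re z / 2" using assms by simp
  have M: "norm (f (Complex x y)) \<le> M x" if "\<bar>y\<bar> \<le> \<bar>Im w\<bar>" for x y
    unfolding f_def M_def K_def by (rule norm_exp_cgauss_Complex_le[OF assms that])
  have intM: "integrable lborel M"
    unfolding M_def by (intro integrable_mult_right integrable_gaussian_1 a)
  have int: "integrable lborel (\<lambda>x. f (Complex x y))" if "\<bar>y\<bar> \<le> \<bar>Im w\<bar>" for y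
    by (rule Bochner_Integration.integrable_bound[OF intM])
      (use M[OF that] in \<open>auto intro!: AE_I2 order.trans[OF _ abs_ge_self]\<close>)
  have limM: "(M \<longlongrightarrow> 0) at_top" "(M \<longlongrightarrow> 0) at_bot"
    unfolding M_def using tendsto_mult_left[OF tendsto_exp_neg_square(1)[OF a], of "K \<bar>Im w\<bar>"]
      tendsto_mult_left[OF tendsto_exp_neg_square(2)[OF a], of "K \<bar>Im w\<bar>"] by simp_all
  have shift: "(LINT x|lborel. f (Complex x c)) = (LINT x|lborel. f (Complex x d))"
    if "c \<le> d" "\<bar>c\<bar> \<le> \<bar>Im w\<bar>" "\<bar>d\<bar> \<le> \<bar>Im w\<bar>" for c d
    by (rule integral_horizontal_shift[where f = f and S = UNIV and M = M])
      (use that int limM M in \<open>auto simp: f_def[abs_def] intro!: holomorphic_intros\<close>)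
  have "(LINT t|lborel. exp (- z * (of_real t + w) ^ 2)) = (LINT t|lborel. f (Complex (Re w + 1 * t) (Im w)))"
    unfolding f_def by (intro Bochner_Integration.integral_cong arg_cong[of _ _ exp]) (auto simp: complex_eq_iff algebra_simps power2_eq_square)
  also have "\<dots> = (LINT x|lborel. f (Complex x (Im w)))"
    using lborel_integral_real_affine[of 1 "\<lambda>x. f (Complex x (Im w))" "Re w"] by simp
  also have "\<dots> = (LINT x|lborel. f (Complex x 0))"
  proof (cases "0 \<le> Im w")
    case True
    then show ?thesis by (intro shift[symmetric]) auto
  next
    case False
    then show ?thesis by (intro shift) auto
  qed
  also have "\<dots> = cgauss_const z"
    unfolding cgauss_const_def f_def by (simp add: Complex_eq)
  finally show ?thesis .
qed

lemma norm_cgauss_vec: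
  "norm (exp (- z * of_real ((norm x)\<^sup>2))) = exp (- Re z * (norm x)\<^sup>2)" for x :: "real^'n::finite"
  by (simp add: norm_exp_eq_Re del: of_real_power)

lemma integrable_cgauss:
  assumes "0 < Re z"
  shows "integrable lborel (\<lambda>x::real^'n::finite. exp (- z * of_real ((norm x)\<^sup>2)))"
  by (rule Bochner_Integration.integrable_bound[OF integrable_gaussian[OF assms]])
    (simp_all only: norm_cgauss_vec, simp_all)

lemma fourier_cgauss:
  fixes \<xi> :: "real ^ 'n::finite"
  assumes "0 < Re z"
  shows "fourier (\<lambda>x. exp (- z * of_real ((norm x)\<^sup>2))) \<xi> =
    cgauss_const z ^ CARD('n) * exp (- (of_real (pi\<^sup>2 * (norm \<xi>)\<^sup>2) / z))"
proof -
  have z: "z \<noteq> 0" using assms by auto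
  let ?g = "\<lambda>i t. exp (- 2 * of_real pi * \<i> * of_real (t * \<xi> $ i)) * exp (- z * of_real t ^ 2)"
  have int: "integrable lborel (?g i)" for i
  proof (rule Bochner_Integration.integrable_bound[OF integrable_cgauss_1[OF assms]])
    show "AE x in lborel. norm (?g i x) \<le> norm (exp (- z * of_real x ^ 2))"
      by (simp only: norm_mult norm_exp_i_real, simp)
  qed measurable
  have one: "(LINT t|lborel. ?g i t) = exp (- (of_real (pi\<^sup>2 * (\<xi> $ i)\<^sup>2) / z)) * cgauss_const z" for i
  proof -
    \<comment> \<open>Completion of the square in \<open>t\<close>; the centre
      \<open>- pi * \<i> * (\<xi> $ i) / z\<close> is genuinely complex.\<close>
    have "?g i t = exp (- (of_real (pi\<^sup>2 * (\<xi> $ i)\<^sup>2) / z)) *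
        exp (- z * (of_real t + of_real pi * \<i> * of_real (\<xi> $ i) / z) ^ 2)" for t
      unfolding exp_add[symmetric] using z
      by (intro arg_cong[of _ _ exp]) (simp add: power2_eq_square field_simps)
    then show ?thesis
      by (simp only: integral_mult_right_zero cgauss_shift[OF assms])
  qed
  have "fourier (\<lambda>x. exp (- z * of_real ((norm x)\<^sup>2))) \<xi> =
      (LINT x|lborel. (\<Prod>i\<in>UNIV. ?g i ((x::real^'n) $ i)))"
    unfolding fourier_def
  proof (intro Bochner_Integration.integral_cong refl)
    fix x :: "real^'n"
    have "(\<Prod>i\<in>UNIV. ?g i (x $ i)) =
        exp (\<Sum>i\<in>UNIV. - 2 * of_real pi * \<i> * of_real (x $ i * \<xi> $ i)) * exp (\<Sum>i\<in>UNIV. - z * of_real (x $ i) ^ 2)"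
      by (simp add: prod.distrib exp_sum)
    also have "(\<Sum>i\<in>UNIV. - 2 * of_real pi * \<i> * of_real (x $ i * \<xi> $ i)) = - 2 * of_real pi * \<i> * of_real (x \<bullet> \<xi>)"
      unfolding inner_vec_def of_real_sum sum_distrib_left by simp
    also have "(\<Sum>i\<in>UNIV. - z * of_real (x $ i) ^ 2) = - z * of_real ((norm x)\<^sup>2)"
      unfolding norm_vec_power2 of_real_sum sum_distrib_left by simp
    finally show "exp (- 2 * of_real pi * \<i> * of_real (x \<bullet> \<xi>)) * exp (- z * of_real ((norm x)\<^sup>2)) =
        (\<Prod>i\<in>UNIV. ?g i (x $ i))" by simp
  qed
  also have "\<dots> = (\<Prod>i\<in>UNIV. exp (- (of_real (pi\<^sup>2 * (\<xi> $ i)\<^sup>2) / z)) * cgauss_const z)"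
    by (subst integral_lborel_vec_prod[OF int]) (simp only: one)
  also have "\<dots> = cgauss_const z ^ CARD('n) * exp (- (of_real (pi\<^sup>2 * (norm \<xi>)\<^sup>2) / z))"
    by (simp add: prod.distrib norm_vec_power2 sum_distrib_left sum_divide_distrib sum_negf[symmetric] exp_sum)
  finally show ?thesis .
qed

lemma fourier_multiplication:
  fixes f g :: "real ^ 'n::finite \<Rightarrow> complex"
  assumes f: "integrable lborel f" and g: "integrable lborel g"
  shows "(LINT x|lborel. f x * fourier g x) = (LINT \<xi>|lborel. fourier f \<xi> * g \<xi>)"
proof -
  have [measurable]: "f \<in> borel_measurable borel" "g \<in> borel_measurable borel"
    using borel_measurable_integrable[OF f] borel_measurable_integrable[OF g] by simp_all
  define E where "E x \<xi> = exp (- 2 * of_real pi * \<i> * of_real (x \<bullet> \<xi>))" for x \<xi> :: "real^'n"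
  have normE: "norm (E x \<xi>) = 1" for x \<xi>
    unfolding E_def by (rule norm_exp_i_real)
  have [measurable]: "(\<lambda>p. E (fst p) (snd p)) \<in> borel_measurable (lborel \<Otimes>\<^sub>M lborel)"
    unfolding E_def by measurable
  have "integrable (lborel \<Otimes>\<^sub>M lborel) (\<lambda>p. f (fst p) * (E (fst p) (snd p) * g (snd p)))"
  proof (rule lborel_pair.Fubini_integrable)
    show "integrable lborel (\<lambda>x. LINT y|lborel. norm (f (fst (x, y)) * (E (fst (x, y)) (snd (x, y)) * g (snd (x, y)))))"
      using f by (simp add: norm_mult normE)
    show "AE x in lborel. integrable lborel (\<lambda>y. f (fst (x, y)) * (E (fst (x, y)) (snd (x, y)) * g (snd (x, y))))"
      using fourier_integrand_integrable[OF g] by (simp add: E_def inner_commute)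
  qed measurable
  then have "integrable (lborel \<Otimes>\<^sub>M lborel) (\<lambda>(x, y). f x * (E x y * g y))"
    by (simp add: split_beta')
  from lborel_pair.Fubini_integral[OF this]
  have "(LINT y|lborel. LINT x|lborel. f x * (E x y * g y)) = (LINT x|lborel. LINT y|lborel. f x * (E x y * g y))" .
  moreover have "(LINT y|lborel. f x * (E x y * g y)) = f x * fourier g x" for x
    unfolding fourier_def E_def by (simp add: inner_commute[of x] del: mult_eq_0_iff mult_cancel_left)
  moreover have "(LINT x|lborel. f x * (E x y * g y)) = fourier f y * g y" for y
  proof -
    have "(LINT x|lborel. f x * (E x y * g y)) = (LINT x|lborel. (E x y * f x) * g y)"
      by (simp add: mult_ac)
    then show ?thesis by (simp add: fourier_def E_def)
  qed
  ultimately show ?thesis by (simp only:)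
qed

section \<open>Superpositions of complex Gaussians\<close>

text \<open>A substitute for Hoelder's inequality with a worse constant: integrate
  \<open>v \<le> l + l powr (1 - P) * v powr P\<close> against \<open>u\<close>, with \<open>l\<close> so small that the first term
  absorbs at most half of the integral of \<open>u v\<close>.\<close>

lemma integral_mult_powr_le:
  fixes u v :: "'a \<Rightarrow> real"
  assumes P: "1 < P" and nn: "\<And>x. 0 \<le> u x" "\<And>x. 0 \<le> v x"
    and [measurable]: "v \<in> borel_measurable M"
    and u: "integrable M u" and uvP: "integrable M (\<lambda>x. u x * v x powr P)"
  shows "integrable M (\<lambda>x. u x * v x)"
    and "(LINT x|M. u x * v x) powr P \<le> 2 powr P * ((LINT x|M. u x) + 1) powr (P - 1) * (LINT x|M. u x * v x powr P)"
proof -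
  have [measurable]: "u \<in> borel_measurable M" using u by simp
  have young: "u x * v x \<le> l * u x + l powr (1 - P) * (u x * v x powr P)" if "0 < l" for l x
  proof -
    have "v x \<le> l + l powr (1 - P) * v x powr P"
    proof (cases "v x \<le> l")
      case True
      then show ?thesis by (simp add: add_increasing2)
    next
      case False
      then have "v x = v x powr (1 - P) * v x powr P"
        using that by (simp flip: powr_add)
      also have "\<dots> \<le> l powr (1 - P) * v x powr P"
        using False that P by (intro mult_right_mono) (auto simp: powr_mono2')
      finally show ?thesis using that by simp
    qed
    from mult_left_mono[OF this nn(1)[of x]] show ?thesis by (simp add: algebra_simps)
  qed
  show uv: "integrable M (\<lambda>x. u x * v x)"
  proof (rule Bochner_Integration.integrable_bound)
    show "integrable M (\<lambda>x. 1 * u x + 1 powr (1 - P) * (u x * v x powr P))"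
      using u uvP by (intro Bochner_Integration.integrable_add integrable_mult_right)
    show "AE x in M. norm (u x * v x) \<le> norm (1 * u x + 1 powr (1 - P) * (u x * v x powr P))"
      using young[of 1] nn by (auto simp: abs_mult intro!: AE_I2)
  qed measurable
  let ?A = "LINT x|M. u x * v x" and ?W = "LINT x|M. u x" and ?V = "LINT x|M. u x * v x powr P"
  have nonneg: "0 \<le> ?A" "0 \<le> ?W" "0 \<le> ?V"
    using nn by (auto intro!: integral_nonneg_AE)
  show "?A powr P \<le> 2 powr P * (?W + 1) powr (P - 1) * ?V"
  proof (cases "?A = 0")
    case True
    then show ?thesis using nonneg by simp
  next
    case False
    with nonneg have A: "0 < ?A" by simp
    \<comment> \<open>The \<open>+ 1\<close> keeps the denominator positive without a separate case
      \<open>?W = 0\<close>; it reappears in the constant of the conclusion.\<close>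
    define l where "l = ?A / (2 * (?W + 1))"
    have l: "0 < l" using A nonneg unfolding l_def by simp
    have "?A \<le> (LINT x|M. l * u x + l powr (1 - P) * (u x * v x powr P))"
      using u uvP uv young[OF l] by (intro integral_mono) auto
    also have "\<dots> = l * ?W + l powr (1 - P) * ?V"
      using u uvP by (subst Bochner_Integration.integral_add) auto
    also have "l * ?W \<le> l * (?W + 1)"
      using l by simp
    also have "l * (?W + 1) = ?A / 2"
      using nonneg unfolding l_def by (simp add: divide_simps)
    finally have "?A \<le> 2 * (l powr (1 - P) * ?V)" by simp
    then have "?A * l powr (P - 1) \<le> 2 * (l powr (1 - P) * ?V) * l powr (P - 1)"
      by (rule mult_right_mono) simp
    also have "\<dots> = 2 * ?V * (l powr (1 - P) * l powr (P - 1))" by simp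
    also have "l powr (1 - P) * l powr (P - 1) = 1"
      using l by (simp flip: powr_add)
    finally have "?A * l powr (P - 1) \<le> 2 * ?V" by simp
    moreover have "l powr (P - 1) = ?A powr (P - 1) / (2 powr (P - 1) * (?W + 1) powr (P - 1))"
      unfolding l_def powr_divide powr_mult ..
    moreover have "?A * ?A powr (P - 1) = ?A powr P"
      using A by (simp add: powr_mult_base)
    moreover have "2 powr P = 2 * (2::real) powr (P - 1)"
      by (simp add: powr_mult_base)
    moreover have "0 < (?W + 1) powr (P - 1)" using nonneg by simp
    ultimately show ?thesis
      by (simp add: field_simps)
  qed
qed

text \<open>The closed form of the transform of \<open>exp (- z |x|^2)\<close> found in
  \<open>fourier_cgauss\<close>. As an explicit expression it is jointly measurable in
  \<open>z\<close> and \<xi>, as Fubini's theorem requires.\<close>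

definition gauss_fourier :: "complex \<Rightarrow> real ^ 'n::finite \<Rightarrow> complex" where
  "gauss_fourier z \<xi> = cgauss_const z ^ CARD('n) * exp (- (of_real (pi\<^sup>2 * (norm \<xi>)\<^sup>2) / z))"

text \<open>The sector condition enters twice: it bounds \<open>Re z\<close> from below in the
  height of the Gaussian, and, since inversion maps the sector to itself, it bounds
  \<open>Re (1 / z)\<close> from below by \<open>c / norm z\<close> in the exponent.\<close>

lemma norm_gauss_fourier_le:
  fixes \<xi> :: "real ^ 'n::finite"
  assumes "0 < c" "z \<noteq> 0" "c * norm z \<le> Re z"
  shows "norm (gauss_fourier z \<xi>) \<le> gauss_const ^ CARD('n) * c powr (- real CARD('n) / 2) *
    norm z powr (- real CARD('n) / 2) * exp (- (pi\<^sup>2 * c / norm z) * (norm \<xi>)\<^sup>2)"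
proof -
  have nz: "0 < c * norm z" and Rez: "0 < Re z"
    using assms by (auto, smt (verit) mult_pos_pos zero_less_norm_iff)
  have "norm (cgauss_const z) \<le> gauss_const * Re z powr (- 1/2)"
    by (rule norm_cgauss_const_le[OF Rez])
  also have "\<dots> \<le> gauss_const * (c * norm z) powr (- 1/2)"
    using nz assms gauss_const_nonneg by (intro mult_left_mono powr_mono2') auto
  finally have "norm (cgauss_const z) ^ CARD('n) \<le> (gauss_const * (c * norm z) powr (- 1/2)) ^ CARD('n)"
    by (intro power_mono) auto
  also have "\<dots> = gauss_const ^ CARD('n) * c powr (- real CARD('n) / 2) * norm z powr (- real CARD('n) / 2)"
    using nz assms by (simp add: power_mult_distrib powr_mult powr_powr flip: powr_realpow)
  finally have 1: "norm (cgauss_const z) ^ CARD('n) \<le>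
      gauss_const ^ CARD('n) * c powr (- real CARD('n) / 2) * norm z powr (- real CARD('n) / 2)" .
  have "c / norm z \<le> Re (1 / z)"
  proof -
    have "c / norm z = c * norm z / (norm z)\<^sup>2"
      using assms by (simp add: power2_eq_square)
    also have "\<dots> \<le> Re z / (norm z)\<^sup>2"
      using assms by (intro divide_right_mono) auto
    finally show ?thesis by (simp add: Re_divide cmod_power2)
  qed
  then have "pi\<^sup>2 * (norm \<xi>)\<^sup>2 * (c / norm z) \<le> pi\<^sup>2 * (norm \<xi>)\<^sup>2 * Re (1 / z)"
    by (rule mult_left_mono) simp
  moreover have "Re (of_real (pi\<^sup>2 * (norm \<xi>)\<^sup>2) / z) = pi\<^sup>2 * (norm \<xi>)\<^sup>2 * Re (1 / z)"
    by (simp add: Re_divide)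
  ultimately have 2: "norm (exp (- (of_real (pi\<^sup>2 * (norm \<xi>)\<^sup>2) / z))) \<le> exp (- (pi\<^sup>2 * c / norm z) * (norm \<xi>)\<^sup>2)"
    unfolding norm_exp_eq_Re by (simp add: mult_ac)
  show ?thesis
    unfolding gauss_fourier_def norm_mult norm_power
    using 1 2 gauss_const_nonneg by (intro mult_mono) auto
qed

text \<open>This is \<open>distr_in_Lp p (fourier_distr (function_distr f))\<close> together with the absolute
  convergence that makes it additive in \<open>f\<close>.\<close>

definition fourier_repr :: "ennreal \<Rightarrow> (real ^ 'n::finite \<Rightarrow> complex) \<Rightarrow> bool" where
  "fourier_repr p f \<longleftrightarrow> (\<exists>g\<in>Lp_space p. \<forall>\<phi>\<in>schwartz_space.
     integrable lborel (\<lambda>x. f x * fourier \<phi> x) \<and> integrable lborel (\<lambda>x. g x * \<phi> x) \<and>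
     (LINT x|lborel. f x * fourier \<phi> x) = (LINT x|lborel. g x * \<phi> x))"

lemma Lp_space_add:
  fixes f g :: "real ^ 'n::finite \<Rightarrow> complex"
  assumes "f \<in> Lp_space p" "g \<in> Lp_space p"
  shows "(\<lambda>x. f x + g x) \<in> Lp_space p"
proof (cases "p = \<infinity>")
  case True
  then obtain C D where "AE x in lborel. norm (f x) \<le> C" "AE x in lborel. norm (g x) \<le> D"
    using assms by (auto simp: Lp_space_def)
  then have "AE x in lborel. norm (f x + g x) \<le> C + D"
    by eventually_elim (rule norm_triangle_mono)
  then show ?thesis
    using assms True by (auto simp: Lp_space_def)
next
  case False
  define P where "P = enn2real p"
  have P: "0 \<le> P" by (simp add: P_def)
  have [measurable]: "f \<in> borel_measurable borel" "g \<in> borel_measurable borel"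
    and int: "integrable lborel (\<lambda>x. norm (f x) powr P)" "integrable lborel (\<lambda>x. norm (g x) powr P)"
    using assms False by (auto simp: Lp_space_def P_def)
  have "norm (f x + g x) powr P \<le> 2 powr P * (norm (f x) powr P + norm (g x) powr P)" for x
  proof -
    have "norm (f x + g x) powr P \<le> (2 * max (norm (f x)) (norm (g x))) powr P"
      using norm_triangle_ineq[of "f x" "g x"] P by (intro powr_mono2) auto
    also have "\<dots> \<le> 2 powr P * (norm (f x) powr P + norm (g x) powr P)"
      by (auto simp: powr_mult max_def)
    finally show ?thesis .
  qed
  then have "integrable lborel (\<lambda>x. norm (f x + g x) powr P)"
    by (intro Bochner_Integration.integrable_bound[OF integrable_mult_right[OF Bochner_Integration.integrable_add[OF int], of "2 powr P"]])
      auto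
  then show ?thesis
    using False by (simp add: Lp_space_def P_def)
qed

lemma fourier_repr_add:
  assumes "fourier_repr p f" "fourier_repr p g"
  shows "fourier_repr p (\<lambda>x. f x + g x)"
proof -
  obtain F where F: "F \<in> Lp_space p" "\<And>\<phi>. \<phi> \<in> schwartz_space \<Longrightarrow>
     integrable lborel (\<lambda>x. f x * fourier \<phi> x) \<and> integrable lborel (\<lambda>x. F x * \<phi> x) \<and>
     (LINT x|lborel. f x * fourier \<phi> x) = (LINT x|lborel. F x * \<phi> x)"
    using assms(1) unfolding fourier_repr_def by blast
  obtain G where G: "G \<in> Lp_space p" "\<And>\<phi>. \<phi> \<in> schwartz_space \<Longrightarrow>
     integrable lborel (\<lambda>x. g x * fourier \<phi> x) \<and> integrable lborel (\<lambda>x. G x * \<phi> x) \<and>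
     (LINT x|lborel. g x * fourier \<phi> x) = (LINT x|lborel. G x * \<phi> x)"
    using assms(2) unfolding fourier_repr_def by blast
  show ?thesis
    unfolding fourier_repr_def
    by (rule bexI[OF _ Lp_space_add[OF F(1) G(1)]]) (use F(2) G(2) in \<open>auto simp: distrib_right\<close>)
qed

text \<open>The superposition formula goes through \<open>2 * ln (norm x)\<close> and is therefore
  available only for \<open>x \<noteq> 0\<close>; this transfers the result across that null
  set.\<close>

lemma fourier_repr_cong_AE:
  fixes f g :: "real ^ 'n::finite \<Rightarrow> complex"
  assumes "fourier_repr p f" and [measurable]: "f \<in> borel_measurable borel" "g \<in> borel_measurable borel"
    and ae: "AE x in lborel. f x = g x"
  shows "fourier_repr p g"
proof -
  obtain F where F: "F \<in> Lp_space p" "\<And>\<phi>. \<phi> \<in> schwartz_space \<Longrightarrow>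
     integrable lborel (\<lambda>x. f x * fourier \<phi> x) \<and> integrable lborel (\<lambda>x. F x * \<phi> x) \<and>
     (LINT x|lborel. f x * fourier \<phi> x) = (LINT x|lborel. F x * \<phi> x)"
    using assms(1) unfolding fourier_repr_def by blast
  have "integrable lborel (\<lambda>x. g x * fourier \<phi> x) \<and>
      (LINT x|lborel. g x * fourier \<phi> x) = (LINT x|lborel. f x * fourier \<phi> x)"
    if \<phi>: "\<phi> \<in> schwartz_space" for \<phi>
  proof -
    have [measurable]: "\<phi> \<in> borel_measurable borel" by (rule schwartz_borel_measurable[OF \<phi>])
    have e: "AE x in lborel. f x * fourier \<phi> x = g x * fourier \<phi> x"
      using ae by eventually_elim simp
    show ?thesis
      using integrable_cong_AE[OF _ _ e] integral_cong_AE[OF _ _ e] F(2)[OF \<phi>] by simp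
  qed
  with F show ?thesis
    unfolding fourier_repr_def by (intro bexI[OF _ F(1)]) auto
qed

text \<open>A bounded measurable function is tempered because the \<open>L^1\<close> norm of a
  Schwartz function is controlled by the two undifferentiated seminorms of orders \<open>0\<close>
  and \<open>2 * CARD('n)\<close>.\<close>

lemma fourier_in_LpI:
  fixes f :: "real ^ 'n::finite \<Rightarrow> complex"
  assumes [measurable]: "f \<in> borel_measurable borel" and C: "\<And>x. norm (f x) \<le> C"
    and "fourier_repr p f"
  shows "fourier_in_Lp p f"
proof -
  have C0: "0 \<le> C" using C[of 0] norm_ge_zero order.trans by blast
  define N where "N = 2 * CARD('n)"
  define I where "I = (LINT x|lborel. 1 / (1 + norm (x :: real^'n) ^ N))"
  have I: "0 \<le> I" unfolding I_def by (intro integral_nonneg_AE AE_I2) simp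
  have int: "integrable lborel (\<lambda>x. f x * \<phi> x)" if \<phi>: "\<phi> \<in> schwartz_space" for \<phi>
  proof (rule Bochner_Integration.integrable_bound)
    show "integrable lborel (\<lambda>x. C * norm (\<phi> x))"
      by (intro integrable_mult_right integrable_norm schwartz_integrable \<phi>)
    show "AE x in lborel. norm (f x * \<phi> x) \<le> norm (C * norm (\<phi> x))"
      using C C0 by (auto simp: norm_mult intro!: AE_I2 mult_right_mono)
  qed (use schwartz_borel_measurable[OF \<phi>] in measurable)
  have "norm (function_distr f \<phi>) \<le>
      C * I * (\<Sum>k\<le>N. \<Sum>js | length js \<le> N. schwartz_seminorm k js \<phi>)" if \<phi>: "\<phi> \<in> schwartz_space" for \<phi>
  proof -
    have "norm (function_distr f \<phi>) \<le> (LINT x|lborel. norm (f x * \<phi> x))"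
      unfolding function_distr_def by (rule integral_norm_bound)
    also have "\<dots> \<le> (LINT x|lborel. C * norm (\<phi> x))"
      using C integrable_norm[OF schwartz_integrable[OF \<phi>]] integrable_norm[OF int[OF \<phi>]]
      by (intro integral_mono) (auto simp: norm_mult intro!: mult_right_mono)
    also have "\<dots> = C * (LINT x|lborel. norm (\<phi> x))" by simp
    also have "\<dots> \<le> C * ((schwartz_seminorm 0 [] \<phi> + schwartz_seminorm N [] \<phi>) * I)"
      unfolding N_def I_def by (intro mult_left_mono C0 schwartz_L1_le \<phi>)
    also have "(schwartz_seminorm 0 [] \<phi> + schwartz_seminorm N [] \<phi>) \<le>
        (\<Sum>k\<le>N. \<Sum>js | length js \<le> N. schwartz_seminorm k js \<phi>)"
    proof -
      have fin: "finite {js :: 'n list. length js \<le> N}"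
        using finite_lists_length_le[of "UNIV :: 'n set" N] by simp
      have "schwartz_seminorm k [] \<phi> \<le> (\<Sum>js | length js \<le> N. schwartz_seminorm k js \<phi>)" for k
        by (rule member_le_sum) (use fin schwartz_seminorm_nonneg[OF \<phi>] in auto)
      then have "(\<Sum>k\<in>{0, N}. schwartz_seminorm k [] \<phi>) \<le>
          (\<Sum>k\<in>{0, N}. \<Sum>js | length js \<le> N. schwartz_seminorm k js \<phi>)"
        by (rule sum_mono)
      also have "\<dots> \<le> (\<Sum>k\<le>N. \<Sum>js | length js \<le> N. schwartz_seminorm k js \<phi>)"
        by (rule sum_mono2) (auto intro!: sum_nonneg schwartz_seminorm_nonneg \<phi>)
      \<comment> \<open>Otherwise \<open>{0, N}\<close> would collapse to one element and count only
        one of the two seminorms.\<close>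
      moreover have "N \<noteq> 0" by (simp add: N_def)
      ultimately show ?thesis by simp
    qed
    finally show ?thesis using C0 I by (simp add: mult_ac mult_left_mono mult_right_mono)
  qed
  then have "tempered_distribution (function_distr f)"
    unfolding tempered_distribution_def
    using int by (auto simp: function_distr_def distrib_left mult.left_commute)
  then have "tempered_function f"
    unfolding tempered_function_def using int by simp
  moreover have "distr_in_Lp p (fourier_distr (function_distr f))"
    using assms(3) unfolding fourier_repr_def distr_in_Lp_def fourier_distr_def function_distr_def by blast
  ultimately show ?thesis
    by (simp add: fourier_in_Lp_def)
qed

text \<open>The representing function is the same superposition of the transformed Gaussians. These
  have \<open>L^1\<close> norms bounded independently of \<open>w\<close>, so integrability of
  \<open>h\<close> suffices for Fubini's theorem and the duality identity. The weight
  \<open>norm (z w) powr (- q)\<close> accounts for the \<open>L^p\<close> norms of the transformed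
  Gaussians and serves only to place the result in \<open>Lp_space p\<close>.\<close>

lemma fourier_repr_gaussian_superposition:
  fixes h z :: "'a \<Rightarrow> complex"
  assumes "sigma_finite_measure M"
    and [measurable]: "z \<in> borel_measurable M"
    and c: "0 < c" and z: "\<And>w. z w \<noteq> 0" "\<And>w. c * norm (z w) \<le> Re (z w)"
    and h: "integrable M h"
    and hz: "integrable M (\<lambda>w. norm (h w) * norm (z w) powr (- q))"
    and q: "p = \<infinity> \<and> q = real CARD('n) / 2 \<or>
      (\<exists>P>1. p = ennreal P \<and> q = real CARD('n) / 2 * (1 - 1 / P))"
  shows "fourier_repr p (\<lambda>x::real^'n::finite. LINT w|M. h w * exp (- z w * of_real ((norm x)\<^sup>2)))"
proof -
  interpret M: sigma_finite_measure M by fact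
  interpret LM: pair_sigma_finite "lborel :: (real^'n) measure" M ..
  interpret SM: pair_sigma_finite M "lborel :: (real^'n) measure" ..
  define D where "D = real CARD('n)"
  have [measurable]: "h \<in> borel_measurable M" using h by simp
  define G where "G w \<xi> = gauss_fourier (z w) \<xi>" for w and \<xi> :: "real^'n"
  have [measurable]: "(\<lambda>p. G (fst p) (snd p)) \<in> borel_measurable (M \<Otimes>\<^sub>M lborel)"
    "(\<lambda>p. G (snd p) (fst p)) \<in> borel_measurable (lborel \<Otimes>\<^sub>M M)"
    "\<And>\<xi>. (\<lambda>w. G w \<xi>) \<in> borel_measurable M"
    unfolding G_def gauss_fourier_def by measurable
  have Rez: "0 < Re (z w)" for w
    using c z[of w] by (smt (verit) mult_pos_pos zero_less_norm_iff)
  define B where "B = gauss_const ^ CARD('n) * c powr (- D / 2)"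
  define b where "b = pi\<^sup>2 * c"
  have B: "0 \<le> B" unfolding B_def using gauss_const_nonneg by simp
  have b: "0 < b" unfolding b_def using c by simp
  have nz: "0 < norm (z w)" for w using z(1)[of w] by simp
  have bz: "0 < b / norm (z w)" for w using b nz[of w] by simp
  have G_le: "norm (G w \<xi>) \<le> B * norm (z w) powr (- D / 2) * exp (- (b / norm (z w)) * (norm \<xi>)\<^sup>2)" for w \<xi>
    unfolding G_def B_def b_def D_def by (rule norm_gauss_fourier_le[OF c z])
  define A where "A = B * (gauss_const ^ CARD('n) * b powr (- D / 2))"
  \<comment> \<open>Dilation invariance of the \<open>L^1\<close> norm: the height and the width of
    a transformed Gaussian contribute opposite powers of \<open>norm (z w)\<close>.\<close>
  have scale: "norm (z w) powr (- D / 2) * (a / norm (z w)) powr (- D / 2) = a powr (- D / 2)" if "0 < a" for a w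
    using nz[of w] that by (simp flip: powr_mult)
  have G_int: "integrable lborel (G w)" and G_L1: "(LINT \<xi>|lborel. norm (G w \<xi>)) \<le> A" for w
  proof -
    let ?w = "\<lambda>\<xi>::real^'n. B * norm (z w) powr (- D / 2) * exp (- (b / norm (z w)) * (norm \<xi>)\<^sup>2)"
    have i: "integrable lborel ?w"
      by (intro integrable_mult_right integrable_gaussian bz)
    have [measurable]: "G w \<in> borel_measurable borel"
      unfolding G_def[abs_def] gauss_fourier_def by measurable
    show g: "integrable lborel (G w)"
      by (rule Bochner_Integration.integrable_bound[OF i]) (use G_le[of w] B in \<open>auto intro!: AE_I2 simp: abs_mult\<close>)
    have "(LINT \<xi>|lborel. norm (G w \<xi>)) \<le> (LINT \<xi>|lborel. ?w \<xi>)"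
      by (rule integral_mono[OF integrable_norm[OF g] i G_le])
    also have "\<dots> = B * norm (z w) powr (- D / 2) * (gauss_const ^ CARD('n) * (b / norm (z w)) powr (- D / 2))"
      unfolding integral_mult_right_zero integral_gaussian[OF bz] D_def ..
    also have "\<dots> = A"
      unfolding A_def using scale[OF b, of w] by (simp add: mult_ac)
    finally show "(LINT \<xi>|lborel. norm (G w \<xi>)) \<le> A" .
  qed
  define g where "g \<xi> = (LINT w|M. h w * G w \<xi>)" for \<xi>
  have [measurable]: "g \<in> borel_measurable borel"
  proof -
    have "(\<lambda>\<xi>. LINT w|M. h w * G w \<xi>) \<in> borel_measurable lborel"
      by (rule M.borel_measurable_lebesgue_integral) (simp add: split_beta')
    then show ?thesis by (simp add: g_def[abs_def])
  qed
  have repr: "integrable lborel (\<lambda>x. (LINT w|M. h w * exp (- z w * of_real ((norm x)\<^sup>2))) * fourier \<phi> x) \<and>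
      integrable lborel (\<lambda>x. g x * \<phi> x) \<and>
      (LINT x|lborel. (LINT w|M. h w * exp (- z w * of_real ((norm x)\<^sup>2))) * fourier \<phi> x) =
      (LINT x|lborel. g x * \<phi> x)"
    if \<phi>: "\<phi> \<in> schwartz_space" for \<phi> :: "real^'n \<Rightarrow> complex"
  proof -
    have [measurable]: "\<phi> \<in> borel_measurable borel" by (rule schwartz_borel_measurable[OF \<phi>])
    have \<phi>_int: "integrable lborel \<phi>" and F_int: "integrable lborel (fourier \<phi>)"
      using \<phi> by (rule schwartz_integrable, intro fourier_schwartz_integrable)
    let ?e = "\<lambda>w x. exp (- z w * of_real ((norm (x::real^'n))\<^sup>2))"
    have e_le: "norm (?e w x) \<le> 1" for w x
      unfolding norm_cgauss_vec using Rez[of w] by simp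
    have I1: "integrable (lborel \<Otimes>\<^sub>M M) (\<lambda>p. fourier \<phi> (fst p) * (h (snd p) * ?e (snd p) (fst p)))"
    proof (rule Bochner_Integration.integrable_bound)
      show "integrable (lborel \<Otimes>\<^sub>M M) (\<lambda>p. fourier \<phi> (fst p) * h (snd p))"
      proof (rule LM.Fubini_integrable)
        show "integrable lborel (\<lambda>x. LINT y|M. norm (fourier \<phi> (fst (x, y)) * h (snd (x, y))))"
          using F_int by (simp add: norm_mult)
      qed (use h in \<open>auto intro!: AE_I2\<close>)
      show "AE p in lborel \<Otimes>\<^sub>M M. norm (fourier \<phi> (fst p) * (h (snd p) * ?e (snd p) (fst p)))
          \<le> norm (fourier \<phi> (fst p) * h (snd p))"
        unfolding norm_mult by (intro AE_I2 mult_left_mono mult_right_le_one_le e_le) auto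
    qed measurable
    have I1': "integrable (lborel \<Otimes>\<^sub>M M) (case_prod (\<lambda>x w. fourier \<phi> x * (h w * ?e w x)))"
      using I1 by (simp add: split_beta')
    have I2: "integrable (lborel \<Otimes>\<^sub>M M) (\<lambda>p. \<phi> (fst p) * (h (snd p) * G (snd p) (fst p)))"
    proof -
      obtain K where K: "\<And>x. norm (\<phi> x) \<le> K"
        using schwartz_seminorm_ge[OF \<phi>, of _ 0 "[]"] by auto
      have K0: "0 \<le> K" using K[of 0] norm_ge_zero order.trans by blast
      have "integrable (M \<Otimes>\<^sub>M lborel) (\<lambda>p. h (fst p) * (G (fst p) (snd p) * \<phi> (snd p)))"
      proof (rule SM.Fubini_integrable)
        have GK: "integrable lborel (\<lambda>\<xi>. K * norm (G w \<xi>))" for w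
          by (intro integrable_mult_right integrable_norm G_int)
        have G\<phi>: "norm (G w \<xi> * \<phi> \<xi>) \<le> K * norm (G w \<xi>)" for w \<xi>
          using mult_right_mono[OF K[of \<xi>], of "norm (G w \<xi>)"] by (simp add: norm_mult mult.commute)
        have G\<phi>_int: "integrable lborel (\<lambda>\<xi>. G w \<xi> * \<phi> \<xi>)" for w
        proof (rule Bochner_Integration.integrable_bound[OF GK])
          show "(\<lambda>\<xi>. G w \<xi> * \<phi> \<xi>) \<in> borel_measurable lborel"
            using borel_measurable_integrable[OF G_int[of w]] by simp
          show "AE \<xi> in lborel. norm (G w \<xi> * \<phi> \<xi>) \<le> norm (K * norm (G w \<xi>))"
            using G\<phi> by (intro AE_I2 order.trans[OF G\<phi>]) simp
        qed
        show "AE w in M. integrable lborel (\<lambda>\<xi>. h (fst (w, \<xi>)) * (G (fst (w, \<xi>)) (snd (w, \<xi>)) * \<phi> (snd (w, \<xi>))))"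
          using G\<phi>_int by simp
        have "(LINT \<xi>|lborel. norm (G w \<xi> * \<phi> \<xi>)) \<le> K * A" for w
        proof -
          have "(LINT \<xi>|lborel. norm (G w \<xi> * \<phi> \<xi>)) \<le> (LINT \<xi>|lborel. K * norm (G w \<xi>))"
            by (rule integral_mono[OF integrable_norm[OF G\<phi>_int] GK G\<phi>])
          also have "\<dots> \<le> K * A"
            using mult_left_mono[OF G_L1 K0] by simp
          finally show ?thesis .
        qed
        then have le: "norm (h w) * (LINT \<xi>|lborel. norm (G w \<xi> * \<phi> \<xi>)) \<le> norm (h w) * (K * A)" for w
          by (intro mult_left_mono) auto
        have "integrable M (\<lambda>w. norm (h w) * (LINT \<xi>|lborel. norm (G w \<xi> * \<phi> \<xi>)))"
        proof (rule Bochner_Integration.integrable_bound)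
          show "integrable M (\<lambda>w. norm (h w) * (K * A))"
            using h by (intro integrable_mult_left integrable_norm)
          show "AE w in M. norm (norm (h w) * (LINT \<xi>|lborel. norm (G w \<xi> * \<phi> \<xi>))) \<le> norm (norm (h w) * (K * A))"
            using le by (intro AE_I2) (smt (verit) mult_nonneg_nonneg norm_ge_zero real_norm_def Bochner_Integration.integral_nonneg)
        qed measurable
        then show "integrable M (\<lambda>w. LINT \<xi>|lborel. norm (h (fst (w, \<xi>)) * (G (fst (w, \<xi>)) (snd (w, \<xi>)) * \<phi> (snd (w, \<xi>)))))"
          by (simp add: norm_mult)
      qed measurable
      from SM.integrable_product_swap[OF this] show ?thesis
        by (simp add: split_beta' mult_ac)
    qed
    have I2': "integrable (lborel \<Otimes>\<^sub>M M) (case_prod (\<lambda>x w. \<phi> x * (h w * G w x)))"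
      using I2 by (simp add: split_beta')
    have eq1: "(LINT w|M. fourier \<phi> x * (h w * ?e w x)) = (LINT w|M. h w * ?e w x) * fourier \<phi> x" for x
      by (simp only: integral_mult_right_zero mult.commute)
    have eq2: "(LINT w|M. \<phi> x * (h w * G w x)) = g x * \<phi> x" for x
      unfolding g_def by (simp only: integral_mult_right_zero mult.commute)
    have inner: "(LINT x|lborel. fourier \<phi> x * (h w * ?e w x)) = (LINT x|lborel. \<phi> x * (h w * G w x))" for w
    proof -
      have "(LINT x|lborel. fourier \<phi> x * (h w * ?e w x)) = h w * (LINT x|lborel. ?e w x * fourier \<phi> x)"
        unfolding integral_mult_right_zero[symmetric] by (simp only: mult_ac)
      also have "(LINT x|lborel. ?e w x * fourier \<phi> x) = (LINT x|lborel. fourier (?e w) x * \<phi> x)"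
        by (rule fourier_multiplication[OF integrable_cgauss[OF Rez] \<phi>_int])
      also have "fourier (?e w) = G w"
        unfolding G_def gauss_fourier_def by (intro ext fourier_cgauss Rez)
      also have "h w * (LINT x|lborel. G w x * \<phi> x) = (LINT x|lborel. \<phi> x * (h w * G w x))"
        unfolding integral_mult_right_zero[symmetric] by (simp only: mult_ac)
      finally show ?thesis .
    qed
    have "(LINT x|lborel. (LINT w|M. h w * ?e w x) * fourier \<phi> x) = (LINT x|lborel. g x * \<phi> x)"
      unfolding eq1[symmetric] eq2[symmetric]
      using LM.Fubini_integral[OF I1'] LM.Fubini_integral[OF I2'] inner by simp
    then show ?thesis
      using LM.integrable_fst[OF I1'] LM.integrable_fst[OF I2'] unfolding eq1 eq2 by simp
  qed
  have "g \<in> Lp_space p"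
  proof (cases "p = \<infinity>")
    case True
    then have qD: "- q = - D / 2" using q by (auto simp: D_def)
    have "norm (g \<xi>) \<le> B * (LINT w|M. norm (h w) * norm (z w) powr (- q))" for \<xi>
    proof -
      have le: "norm (h w * G w \<xi>) \<le> B * (norm (h w) * norm (z w) powr (- q))" for w
      proof -
        have "B * norm (z w) powr (- D / 2) * exp (- (b / norm (z w)) * (norm \<xi>)\<^sup>2) \<le> B * norm (z w) powr (- D / 2)"
          using b nz[of w] B by (intro mult_right_le_one_le) (auto intro!: divide_nonneg_nonneg mult_nonneg_nonneg)
        then have "norm (G w \<xi>) \<le> B * norm (z w) powr (- D / 2)"
          using G_le[of w \<xi>] by linarith
        then have "norm (h w) * norm (G w \<xi>) \<le> norm (h w) * (B * norm (z w) powr (- D / 2))"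
          by (rule mult_left_mono) simp
        then show ?thesis unfolding qD by (simp add: norm_mult mult_ac)
      qed
      have i: "integrable M (\<lambda>w. B * (norm (h w) * norm (z w) powr (- q)))"
        by (intro integrable_mult_right hz)
      have "integrable M (\<lambda>w. h w * G w \<xi>)"
        by (rule Bochner_Integration.integrable_bound[OF i])
          (use le B in \<open>auto intro!: AE_I2 simp: abs_mult\<close>)
      then have "norm (g \<xi>) \<le> (LINT w|M. B * (norm (h w) * norm (z w) powr (- q)))"
        unfolding g_def using le i
        by (intro order.trans[OF integral_norm_bound] integral_mono integrable_norm)
      then show ?thesis by simp
    qed
    then show ?thesis
      using True by (auto simp: Lp_space_def)
  next
    case False
    then obtain P where P: "1 < P" "p = ennreal P" "q = D / 2 * (1 - 1 / P)"
      using q by (auto simp: D_def)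
    have Pp: "enn2real p = P" using P by simp
    \<comment> \<open>The powers of \<open>norm (z w)\<close> are split so that the integral of \<open>v w powr P\<close> does not
      depend on \<open>w\<close>.\<close>
    define u where "u w = norm (h w) * norm (z w) powr (- q)" for w
    define v where "v w \<xi> = norm (z w) powr (- D / (2 * P)) * exp (- (b / norm (z w)) * (norm \<xi>)\<^sup>2)"
      for w and \<xi> :: "real^'n"
    have u0: "0 \<le> u w" and v0: "0 \<le> v w \<xi>" for w \<xi> by (auto simp: u_def v_def)
    have u_int: "integrable M u" using hz by (simp add: u_def[abs_def])
    have [measurable]: "u \<in> borel_measurable M" "(\<lambda>p. v (snd p) (fst p)) \<in> borel_measurable (lborel \<Otimes>\<^sub>M M)"
      "(\<lambda>p. v (fst p) (snd p)) \<in> borel_measurable (M \<Otimes>\<^sub>M lborel)"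
      "\<And>\<xi>. (\<lambda>w. v w \<xi>) \<in> borel_measurable M" "\<And>w. (\<lambda>\<xi>. v w \<xi>) \<in> borel_measurable borel"
      unfolding u_def[abs_def] v_def by measurable
    have hG: "norm (h w * G w \<xi>) \<le> B * (u w * v w \<xi>)" for w \<xi>
    proof -
      have "- q + - D / (2 * P) = - D / 2"
        using P by (simp add: field_simps)
      then have "norm (z w) powr (- D / 2) = norm (z w) powr (- q) * norm (z w) powr (- D / (2 * P))"
        by (simp flip: powr_add)
      moreover have "norm (h w * G w \<xi>) \<le> norm (h w) * (B * norm (z w) powr (- D / 2) * exp (- (b / norm (z w)) * (norm \<xi>)\<^sup>2))"
        unfolding norm_mult by (intro mult_left_mono G_le) auto
      ultimately show ?thesis by (simp add: u_def v_def mult_ac)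
    qed
    have vP: "v w \<xi> powr P = norm (z w) powr (- D / 2) * exp (- (P * b / norm (z w)) * (norm \<xi>)\<^sup>2)" for w \<xi>
      unfolding v_def using P nz[of w] by (simp add: powr_mult powr_powr exp_powr_real mult_ac)
    have Pbz: "0 < P * b / norm (z w)" for w using P b nz[of w] by simp
    have vP_int: "integrable lborel (\<lambda>\<xi>. v w \<xi> powr P)" for w
      unfolding vP by (intro integrable_mult_right integrable_gaussian Pbz)
    have vP_eq: "(LINT \<xi>|lborel. v w \<xi> powr P) = gauss_const ^ CARD('n) * (P * b) powr (- D / 2)" for w
      unfolding vP integral_mult_right_zero integral_gaussian[OF Pbz]
      using scale[of "P * b" w] P b by (simp add: D_def mult_ac)
    have "integrable (M \<Otimes>\<^sub>M lborel) (\<lambda>p. u (fst p) * v (fst p) (snd p) powr P)"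
    proof (rule SM.Fubini_integrable)
      show "integrable M (\<lambda>w. LINT \<xi>|lborel. norm (u (fst (w, \<xi>)) * v (fst (w, \<xi>)) (snd (w, \<xi>)) powr P))"
        using u_int u0 by (simp add: abs_mult vP_eq)
      show "AE w in M. integrable lborel (\<lambda>\<xi>. u (fst (w, \<xi>)) * v (fst (w, \<xi>)) (snd (w, \<xi>)) powr P)"
        using vP_int by simp
    qed measurable
    from SM.integrable_product_swap[OF this]
    have I: "integrable (lborel \<Otimes>\<^sub>M M) (case_prod (\<lambda>\<xi> w. u w * v w \<xi> powr P))"
      by (simp add: split_beta')
    define W where "W = B powr P * (2 powr P * ((LINT w|M. u w) + 1) powr (P - 1))"
    have W: "0 \<le> W" by (simp add: W_def)
    \<comment> \<open>Fubini's theorem makes \<open>u w * v w \<xi> powr P\<close> integrable in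
      \<open>w\<close> only for almost every \<xi>, and the preceding inequality relies on that
      integrability.\<close>
    have ae: "AE \<xi> in lborel. norm (g \<xi>) powr P \<le> W * (LINT w|M. u w * v w \<xi> powr P)"
      using LM.AE_integrable_fst[OF I]
    proof eventually_elim
      case (elim \<xi>)
      note uv = integral_mult_powr_le[where u = u and v = "\<lambda>w. v w \<xi>" and M = M, OF P(1) u0 v0 _ u_int elim]
      have "integrable M (\<lambda>w. B * (u w * v w \<xi>))"
        using uv(1) by simp
      moreover have "integrable M (\<lambda>w. h w * G w \<xi>)"
        by (rule Bochner_Integration.integrable_bound[OF calculation])
          (use hG B u0 v0 in \<open>auto intro!: AE_I2 simp: abs_mult\<close>)
      ultimately have "norm (g \<xi>) \<le> (LINT w|M. B * (u w * v w \<xi>))"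
        unfolding g_def using hG
        by (intro order.trans[OF integral_norm_bound] integral_mono integrable_norm)
      then have "norm (g \<xi>) \<le> B * (LINT w|M. u w * v w \<xi>)" by simp
      then have "norm (g \<xi>) powr P \<le> (B * (LINT w|M. u w * v w \<xi>)) powr P"
        using P by (intro powr_mono2) auto
      also have "\<dots> = B powr P * (LINT w|M. u w * v w \<xi>) powr P"
        using B u0 v0 by (intro powr_mult)
      also have "\<dots> \<le> B powr P * (2 powr P * ((LINT w|M. u w) + 1) powr (P - 1) * (LINT w|M. u w * v w \<xi> powr P))"
        by (intro mult_left_mono uv(2)) auto
      finally show ?case by (simp add: W_def mult_ac)
    qed
    have "integrable lborel (\<lambda>\<xi>. norm (g \<xi>) powr P)"
    proof (rule Bochner_Integration.integrable_bound)
      show "integrable lborel (\<lambda>\<xi>. W * (LINT w|M. u w * v w \<xi> powr P))"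
        by (intro integrable_mult_right LM.integrable_fst I)
      show "AE \<xi> in lborel. norm (norm (g \<xi>) powr P) \<le> norm (W * (LINT w|M. u w * v w \<xi> powr P))"
        using ae by eventually_elim simp
    qed measurable
    then show ?thesis
      using False by (simp add: Lp_space_def Pp)
  qed
  with repr show ?thesis
    unfolding fourier_repr_def by blast
qed

section \<open>Hankel's integral for the reciprocal Gamma function\<close>

lemma integrable_exp_neg_abs:
  assumes "0 < (r::real)"
  shows "integrable lborel (\<lambda>x::real. exp (- r * \<bar>x\<bar>))"
proof -
  have "integrable lborel (\<lambda>x::real. exp (- \<bar>x\<bar>))"
  proof (rule Bochner_Integration.integrable_bound[OF integrable_mult_right[OF integrable_inverse_one_plus_square, of 2]])
    have "exp (- \<bar>x\<bar>) \<le> 2 * (1 / (1 + x\<^sup>2))" for x :: real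
    proof -
      have "1 + \<bar>x\<bar> + \<bar>x\<bar>\<^sup>2 / 2 \<le> exp \<bar>x\<bar>"
        by (rule exp_lower_Taylor_quadratic) simp
      then have "1 + x\<^sup>2 \<le> 2 * exp \<bar>x\<bar>" by simp
      then show ?thesis by (simp add: exp_minus field_simps add_pos_nonneg)
    qed
    then show "AE x in lborel. norm (exp (- \<bar>x\<bar>)) \<le> norm (2 * (1 / (1 + x\<^sup>2)) :: real)"
      by (simp add: abs_mult)
  qed measurable
  from lborel_integrable_real_affine[OF this, of r 0] show ?thesis
    using assms by (simp add: abs_mult)
qed

lemma tendsto_exp_neg_abs:
  assumes "0 < (r::real)"
  shows "((\<lambda>x. exp (- r * \<bar>x\<bar>)) \<longlongrightarrow> 0) at_top" "((\<lambda>x. exp (- r * \<bar>x\<bar>)) \<longlongrightarrow> 0) at_bot"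
  by (rule tendsto_exp_neg_at_top[OF assms], simp add: filterlim_abs_real filterlim_at_bot_mirror)+

text \<open>The right side is the maximum of the left, attained at \<open>x = ln (u / k)\<close>;
  the proof is the tangent line of \<open>exp\<close> at that point.\<close>

lemma linear_minus_exp_le:
  fixes u k x :: real
  assumes "0 < u" "0 < k"
  shows "u * x - k * exp x \<le> u * (ln (u / k) - 1)"
proof -
  define L where "L = ln (u / k)"
  have "k * exp x = u * exp (x - L)"
    using assms by (simp add: L_def exp_diff)
  moreover have "u * (1 + (x - L)) \<le> u * exp (x - L)"
    using assms by (intro mult_left_mono exp_ge_add_one_self) auto
  ultimately show ?thesis by (simp add: L_def algebra_simps)
qed

text \<open>Doubly exponential decay beats any exponential as \<open>x\<close> tends to infinity.
  The slope \<open>\<bar>m\<bar> + 2\<close> dominates both \<open>m * x\<close> and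
  \<open>\<bar>x\<bar>\<close> for \<open>x \<ge> 0\<close>; the terms with
  \<open>\<bar>a\<bar>\<close> in the constant pay for the bounded range
  \<open>a \<le> x < 0\<close>.\<close>

lemma exp_exp_decay:
  assumes "0 < k"
  obtains C where "0 < C" "\<And>x::real. a \<le> x \<Longrightarrow> exp (- k * exp x + m * x) \<le> C * exp (- \<bar>x\<bar>)"
proof -
  define u where "u = \<bar>m\<bar> + 2"
  have u: "0 < u" "0 \<le> \<bar>m\<bar> + 1" unfolding u_def by auto
  define C where "C = exp (u * (ln (u / k) - 1) + 2 * (u + \<bar>m\<bar>) * \<bar>a\<bar> + 2 * \<bar>a\<bar>)"
  show ?thesis
  proof (rule that[of C])
    show "0 < C" by (simp add: C_def)
    fix x :: real assume x: "a \<le> x"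
    have "m * x + \<bar>x\<bar> \<le> u * x + 2 * (u + \<bar>m\<bar>) * \<bar>a\<bar> + 2 * \<bar>a\<bar>"
    proof (cases "0 \<le> x")
      case True
      have "m * x \<le> \<bar>m\<bar> * x" using True by (intro mult_right_mono) auto
      moreover have "m * x + \<bar>x\<bar> = m * x + x" "u * x = \<bar>m\<bar> * x + 2 * x"
        using True by (auto simp: u_def algebra_simps)
      moreover have "0 \<le> 2 * (u + \<bar>m\<bar>) * \<bar>a\<bar> + 2 * \<bar>a\<bar>" using u by simp
      ultimately show ?thesis using True by linarith
    next
      case False
      then have xa: "\<bar>x\<bar> \<le> \<bar>a\<bar>" using x by simp
      have "m * x \<le> \<bar>m\<bar> * \<bar>x\<bar>" by (metis abs_ge_self abs_mult)
      moreover have "- (u * x) = u * \<bar>x\<bar>" using False by simp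
      moreover have "(\<bar>m\<bar> + u + 1) * \<bar>x\<bar> \<le> (\<bar>m\<bar> + u + 1) * \<bar>a\<bar>"
        using xa u by (intro mult_left_mono) auto
      moreover have "0 \<le> \<bar>m\<bar> * \<bar>a\<bar>" "0 \<le> u * \<bar>a\<bar>" using u by auto
      moreover have "2 * (u + \<bar>m\<bar>) * \<bar>a\<bar> = 2 * (u * \<bar>a\<bar>) + 2 * (\<bar>m\<bar> * \<bar>a\<bar>)"
        by (simp add: algebra_simps)
      ultimately show ?thesis unfolding distrib_right mult_1 by linarith
    qed
    then have "- k * exp x + m * x + \<bar>x\<bar> \<le> u * (ln (u / k) - 1) + 2 * (u + \<bar>m\<bar>) * \<bar>a\<bar> + 2 * \<bar>a\<bar>"
      using linear_minus_exp_le[OF u(1) assms, of x] by simp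
    then have "exp (- k * exp x + m * x + \<bar>x\<bar>) \<le> C"
      unfolding C_def by simp
    then have "exp (- k * exp x + m * x) * exp \<bar>x\<bar> \<le> C"
      by (simp only: exp_add)
    then show "exp (- k * exp x + m * x) \<le> C * exp (- \<bar>x\<bar>)"
      by (simp add: exp_minus field_simps)
  qed
qed

lemma set_integrable_exp_decay:
  fixes f :: "real \<Rightarrow> complex"
  assumes [measurable]: "f \<in> borel_measurable borel"
    and "\<And>x. a \<le> x \<Longrightarrow> norm (f x) \<le> C * exp (- \<bar>x\<bar>)"
  shows "set_integrable lborel {a..} f"
  unfolding set_integrable_def
proof (rule Bochner_Integration.integrable_bound)
  show "integrable lborel (\<lambda>x::real. \<bar>C\<bar> * exp (- 1 * \<bar>x\<bar>))"
    by (intro integrable_mult_right integrable_exp_neg_abs) simp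
  show "AE x in lborel. norm (indicat_real {a..} x *\<^sub>R f x) \<le> norm (\<bar>C\<bar> * exp (- 1 * \<bar>x\<bar>))"
  proof (rule AE_I2)
    fix x :: real
    have "C * exp (- \<bar>x\<bar>) \<le> \<bar>C\<bar> * exp (- \<bar>x\<bar>)" by (intro mult_right_mono) auto
    then have "norm (f x) \<le> \<bar>C\<bar> * exp (- \<bar>x\<bar>)" if "a \<le> x"
      using assms(2)[OF that] by linarith
    then show "norm (indicat_real {a..} x *\<^sub>R f x) \<le> norm (\<bar>C\<bar> * exp (- 1 * \<bar>x\<bar>))"
      by (auto simp: indicator_def)
  qed
qed measurable

text \<open>Exhausting the half-strip by rectangles, the right sides disappear in the limit, while
  the left side at \<open>Re w = a\<close> stays as the extra term.\<close>

lemma half_strip_shift: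
  fixes f :: "complex \<Rightarrow> complex"
  assumes "c \<le> d" and hol: "f holomorphic_on S"
    and sub: "\<And>w. a \<le> Re w \<Longrightarrow> c \<le> Im w \<Longrightarrow> Im w \<le> d \<Longrightarrow> w \<in> S"
    and [measurable]: "\<And>y. (\<lambda>x. f (Complex x y)) \<in> borel_measurable borel"
    and bound: "\<And>x y. a \<le> x \<Longrightarrow> c \<le> y \<Longrightarrow> y \<le> d \<Longrightarrow> norm (f (Complex x y)) \<le> C * exp (- \<bar>x\<bar>)"
  shows "(LINT x:{a..}|lborel. f (Complex x c)) =
    (LINT x:{a..}|lborel. f (Complex x d)) + \<i> * integral {c..d} (\<lambda>y. f (Complex a y))"
proof -
  have int: "set_integrable lborel {a..} (\<lambda>x. f (Complex x y))" if "c \<le> y" "y \<le> d" for y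
    by (rule set_integrable_exp_decay[where C = C]) (use bound that in auto)
  have top: "filterlim (\<lambda>n. a + real n) at_top sequentially"
    by (rule filterlim_tendsto_add_at_top[OF tendsto_const filterlim_real_sequentially])
  let ?V = "\<lambda>x. integral {c..d} (\<lambda>y. f (Complex x y))"
  have V: "(?V \<longlongrightarrow> 0) at_top"
  proof (rule tendsto_vertical_integral[where M = "\<lambda>x. C * exp (- 1 * \<bar>x\<bar>)"])
    show "((\<lambda>x. C * exp (- 1 * \<bar>x\<bar>)) \<longlongrightarrow> 0) at_top"
      using tendsto_mult_left[OF tendsto_exp_neg_abs(1)[of 1], of C] by simp
    show "\<forall>\<^sub>F x in at_top. \<forall>y\<in>{c..d}. norm (f (Complex x y)) \<le> C * exp (- 1 * \<bar>x\<bar>)"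
      using eventually_ge_at_top[of a] by eventually_elim (use bound in auto)
  qed fact
  have "(\<lambda>n. integral {a..a + real n} (\<lambda>x. f (Complex x c)) + \<i> * ?V (a + real n))
      \<longlonglongrightarrow> (LINT x:{a..}|lborel. f (Complex x c)) + \<i> * 0"
    by (intro tendsto_intros tendsto_integral_atLeast int filterlim_compose[OF V top]) (use assms in auto)
  moreover have "(\<lambda>n. integral {a..a + real n} (\<lambda>x. f (Complex x d)) + \<i> * ?V a)
      \<longlonglongrightarrow> (LINT x:{a..}|lborel. f (Complex x d)) + \<i> * ?V a"
    by (intro tendsto_intros tendsto_integral_atLeast int) (use assms in auto)
  moreover have "integral {a..a + real n} (\<lambda>x. f (Complex x c)) + \<i> * ?V (a + real n) =
      integral {a..a + real n} (\<lambda>x. f (Complex x d)) + \<i> * ?V a" for n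
    by (rule Cauchy_rectangle[OF _ assms(1) hol]) (use sub in auto)
  ultimately show ?thesis
    using LIMSEQ_unique by fastforce
qed

text \<open>In the logarithmic coordinate \<open>w = ln \<zeta>\<close>, Hankel's contour (in along the ray of
  angle \<open>- \<phi>\<close>, around the circle of radius \<open>exp a\<close>, out along the ray of angle \<open>\<phi>\<close>)
  consists of three straight pieces.\<close>

definition hankel_integral :: "real \<Rightarrow> real \<Rightarrow> (complex \<Rightarrow> complex) \<Rightarrow> complex" where
  "hankel_integral a \<phi> f = (LINT x:{a..}|lborel. f (Complex x \<phi>)) - (LINT x:{a..}|lborel. f (Complex x (- \<phi>)))
    + \<i> * integral {- \<phi>..\<phi>} (\<lambda>y. f (Complex a y))"

definition hankel_integrable :: "real \<Rightarrow> real \<Rightarrow> (complex \<Rightarrow> complex) \<Rightarrow> bool" where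
  "hankel_integrable a \<phi> f \<longleftrightarrow> set_integrable lborel {a..} (\<lambda>x. f (Complex x \<phi>)) \<and>
    set_integrable lborel {a..} (\<lambda>x. f (Complex x (- \<phi>))) \<and> (\<lambda>y. f (Complex a y)) integrable_on {- \<phi>..\<phi>}"

lemma
  assumes "hankel_integrable a \<phi> f" "hankel_integrable a \<phi> g"
  shows hankel_integrable_add: "hankel_integrable a \<phi> (\<lambda>w. f w + g w)"
    and hankel_integral_add: "hankel_integral a \<phi> (\<lambda>w. f w + g w) = hankel_integral a \<phi> f + hankel_integral a \<phi> g"
  using assms unfolding hankel_integrable_def hankel_integral_def
  by (auto intro!: set_integral_add integrable_add simp: set_integral_add Henstock_Kurzweil_Integration.integral_add algebra_simps)

lemma
  assumes "hankel_integrable a \<phi> f"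
  shows hankel_integrable_mult: "hankel_integrable a \<phi> (\<lambda>w. c * f w)"
    and hankel_integral_mult: "hankel_integral a \<phi> (\<lambda>w. c * f w) = c * hankel_integral a \<phi> f"
  using assms unfolding hankel_integrable_def hankel_integral_def
  by (auto simp: algebra_simps intro: integrable_on_mult_right)

lemma hankel_integral_sum:
  fixes n :: nat
  assumes "\<And>k. k < n \<Longrightarrow> hankel_integrable a \<phi> (f k)"
  shows "hankel_integral a \<phi> (\<lambda>w. \<Sum>k<n. f k w) = (\<Sum>k<n. hankel_integral a \<phi> (f k))"
proof -
  have "hankel_integrable a \<phi> (\<lambda>w. \<Sum>k<n. f k w) \<and> ?thesis"
    using assms
  proof (induction n)
    case 0
    then show ?case by (simp add: hankel_integrable_def hankel_integral_def set_integrable_def integrable_0)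
  next
    case (Suc n)
    then show ?case by (simp add: hankel_integrable_add hankel_integral_add)
  qed
  then show ?thesis ..
qed

lemma hankel_integrableI:
  assumes "continuous_on {w. a \<le> Re w \<and> \<bar>Im w\<bar> \<le> \<phi>} f" "0 \<le> \<phi>"
    and [measurable]: "\<And>y. (\<lambda>x. f (Complex x y)) \<in> borel_measurable borel"
    and "\<And>x y. a \<le> x \<Longrightarrow> \<bar>y\<bar> = \<phi> \<Longrightarrow> norm (f (Complex x y)) \<le> B * exp (- \<bar>x\<bar>)"
  shows "hankel_integrable a \<phi> f"
  unfolding hankel_integrable_def
proof (intro conjI)
  have "continuous_on {- \<phi>..\<phi>} (\<lambda>y. f (Complex a y))"
    by (rule continuous_on_compose2[OF assms(1)]) (auto simp: Complex_eq intro!: continuous_intros)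
  then show "(\<lambda>y. f (Complex a y)) integrable_on {- \<phi>..\<phi>}"
    by (rule integrable_continuous_interval)
qed (rule set_integrable_exp_decay[where C = B]; use assms in auto)+

lemma norm_hankel_integral_le:
  assumes B: "0 \<le> B" "0 \<le> \<phi>"
    and [measurable]: "\<And>y. (\<lambda>x. f (Complex x y)) \<in> borel_measurable borel"
    and lines: "\<And>x y. a \<le> x \<Longrightarrow> \<bar>y\<bar> = \<phi> \<Longrightarrow> norm (f (Complex x y)) \<le> B * exp (- \<bar>x\<bar>)"
    and vert: "\<And>y. \<bar>y\<bar> \<le> \<phi> \<Longrightarrow> norm (f (Complex a y)) \<le> B"
  shows "norm (hankel_integral a \<phi> f) \<le> B * (2 * (LINT x|lborel. exp (- \<bar>x::real\<bar>)) + 2 * \<phi>)"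
proof -
  let ?I = "LINT x|lborel. exp (- \<bar>x::real\<bar>)"
  have I: "integrable lborel (\<lambda>x::real. B * exp (- \<bar>x\<bar>))"
    using integrable_exp_neg_abs[of 1] by simp
  have line: "norm (LINT x:{a..}|lborel. f (Complex x y)) \<le> B * ?I" if y: "\<bar>y\<bar> = \<phi>" for y
  proof -
    have si: "set_integrable lborel {a..} (\<lambda>x. f (Complex x y))"
      by (rule set_integrable_exp_decay[where C = B]) (use lines y in auto)
    have "norm (LINT x:{a..}|lborel. f (Complex x y)) \<le> (LINT x|lborel. norm (indicat_real {a..} x *\<^sub>R f (Complex x y)))"
      unfolding set_lebesgue_integral_def by (rule integral_norm_bound)
    also have "\<dots> \<le> (LINT x|lborel. B * exp (- \<bar>x\<bar>))"
    proof (rule integral_mono[OF integrable_norm I])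
      show "integrable lborel (\<lambda>x. indicat_real {a..} x *\<^sub>R f (Complex x y))"
        using si unfolding set_integrable_def .
      show "norm (indicat_real {a..} x *\<^sub>R f (Complex x y)) \<le> B * exp (- \<bar>x\<bar>)" for x
        using lines[OF _ y, of x] B by (auto simp: indicator_def)
    qed
    also have "\<dots> = B * ?I" by simp
    finally show ?thesis .
  qed
  have v: "norm (\<i> * integral {- \<phi>..\<phi>} (\<lambda>y. f (Complex a y))) \<le> B * (2 * \<phi>)"
  proof -
    have "norm (integral {- \<phi>..\<phi>} (\<lambda>y. f (Complex a y))) \<le> B * (\<phi> - - \<phi>)"
      by (rule norm_integral_le_Icc) (use vert B in \<open>auto simp: abs_le_iff\<close>)
    then show ?thesis by (simp add: norm_mult)
  qed
  have "norm (hankel_integral a \<phi> f) \<le> norm (LINT x:{a..}|lborel. f (Complex x \<phi>)) +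
      norm (LINT x:{a..}|lborel. f (Complex x (- \<phi>))) + norm (\<i> * integral {- \<phi>..\<phi>} (\<lambda>y. f (Complex a y)))"
    unfolding hankel_integral_def by (meson norm_triangle_ineq norm_triangle_ineq4 add_right_mono order_trans)
  also have "\<dots> \<le> B * ?I + B * ?I + B * (2 * \<phi>)"
    using B by (intro add_mono line v) auto
  finally show ?thesis by (simp add: algebra_simps)
qed

text \<open>In the logarithmic coordinate, changing the radius of the circular arc is Cauchy's
  theorem on a rectangle. It is valid as long as no pole lies between the two arcs.\<close>

lemma hankel_integral_shift:
  assumes "a \<le> b" "0 \<le> \<phi>" and hol: "f holomorphic_on S"
    and sub: "\<And>w. a \<le> Re w \<Longrightarrow> Re w \<le> b \<Longrightarrow> \<bar>Im w\<bar> \<le> \<phi> \<Longrightarrow> w \<in> S"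
    and int: "hankel_integrable a \<phi> f"
  shows "hankel_integral a \<phi> f = hankel_integral b \<phi> f"
proof -
  have *: "(LINT x:{a..}|lborel. f (Complex x y)) =
      integral {a..b} (\<lambda>x. f (Complex x y)) + (LINT x:{b..}|lborel. f (Complex x y))"
    if si: "set_integrable lborel {a..} (\<lambda>x. f (Complex x y))" for y
  proof -
    have 1: "set_integrable lborel {a..b} (\<lambda>x. f (Complex x y))" and 2: "set_integrable lborel {b..} (\<lambda>x. f (Complex x y))"
      by (rule set_integrable_subset[OF si]; use assms in auto)+
    have "(LINT x:{a..}|lborel. f (Complex x y)) = (LINT x:{a..b} \<union> {b..}|lborel. f (Complex x y))"
      by (rule arg_cong[of _ _ "\<lambda>A. LINT x:A|lborel. f (Complex x y)"]) (use assms(1) in auto)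
    also have "\<dots> = (LINT x:{a..b}|lborel. f (Complex x y)) + (LINT x:{b..}|lborel. f (Complex x y))"
      by (rule set_integral_Un_AE[OF _ _ _ 1 2]) (auto intro!: AE_I[where N = "{b}"])
    also have "(LINT x:{a..b}|lborel. f (Complex x y)) = integral {a..b} (\<lambda>x. f (Complex x y))"
      by (rule set_borel_integral_eq_integral(2)[OF 1])
    finally show ?thesis .
  qed
  have "integral {a..b} (\<lambda>x. f (Complex x (- \<phi>))) + \<i> * integral {- \<phi>..\<phi>} (\<lambda>y. f (Complex b y)) =
      integral {a..b} (\<lambda>x. f (Complex x \<phi>)) + \<i> * integral {- \<phi>..\<phi>} (\<lambda>y. f (Complex a y))"
    by (rule Cauchy_rectangle[OF assms(1) _ hol]) (use assms sub in auto)
  then show ?thesis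
    using int *[of \<phi>] *[of "- \<phi>"] unfolding hankel_integral_def hankel_integrable_def
    by (simp add: algebra_simps)
qed

text \<open>This is Hankel's integrand \<open>exp \<zeta> * \<zeta> powr (- s)\<close> under
  \<open>\<zeta> = exp w\<close>; the \<open>1\<close> in \<open>1 - s\<close> comes from
  \<open>d\<zeta> = exp w dw\<close>.\<close>

definition hankel_kernel :: "real \<Rightarrow> complex \<Rightarrow> complex" where
  "hankel_kernel s w = exp (exp w + of_real (1 - s) * w)"

lemma hankel_kernel_holomorphic [holomorphic_intros]: "hankel_kernel s holomorphic_on S"
  unfolding hankel_kernel_def[abs_def] by (intro holomorphic_intros)

lemma hankel_kernel_measurable [measurable]: "(\<lambda>x. hankel_kernel s (Complex x y)) \<in> borel_measurable borel"
  unfolding hankel_kernel_def Complex_eq by measurable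

lemma norm_hankel_kernel: "norm (hankel_kernel s (Complex x y)) = exp (exp x * cos y + (1 - s) * x)"
  unfolding hankel_kernel_def norm_exp_eq_Re by (simp add: Re_exp)

lemma cos_le_cos_abs:
  assumes "\<phi> \<le> \<bar>y\<bar>" "\<bar>y\<bar> \<le> pi" "0 \<le> \<phi>"
  shows "cos y \<le> cos \<phi>"
  using cos_monotone_0_pi_le[of \<phi> "\<bar>y\<bar>"] assms by simp

text \<open>Beyond the angle \<open>pi / 2\<close> the cosine is negative, so
  \<open>exp (exp w)\<close> decays doubly exponentially. The bound is uniform over all angles
  between \<phi> and \<open>pi\<close>, as needed for rotating the rays.\<close>

lemma hankel_kernel_decay:
  assumes "pi / 2 < \<phi>" "\<phi> \<le> pi"
  obtains C where "0 < C"
    "\<And>x y. a \<le> x \<Longrightarrow> \<phi> \<le> \<bar>y\<bar> \<Longrightarrow> \<bar>y\<bar> \<le> pi \<Longrightarrow> norm (hankel_kernel s (Complex x y)) \<le> C * exp (- \<bar>x\<bar>)"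
proof -
  have "cos \<phi> < cos (pi / 2)"
    using assms by (intro cos_monotone_0_pi) (auto simp: pi_gt_zero)
  then have k: "0 < - cos \<phi>" by simp
  obtain C where C: "0 < C" "\<And>x. a \<le> x \<Longrightarrow> exp (- (- cos \<phi>) * exp x + (1 - s) * x) \<le> C * exp (- \<bar>x\<bar>)"
    using exp_exp_decay[OF k] by blast
  show ?thesis
  proof (rule that[OF C(1)])
    fix x y assume "a \<le> x" "\<phi> \<le> \<bar>y\<bar>" "\<bar>y\<bar> \<le> pi"
    have "0 \<le> \<phi>" using assms pi_gt_zero by linarith
    have "exp x * cos y \<le> exp x * cos \<phi>"
      using cos_le_cos_abs[OF \<open>\<phi> \<le> \<bar>y\<bar>\<close> \<open>\<bar>y\<bar> \<le> pi\<close> \<open>0 \<le> \<phi>\<close>] by simp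
    then have "norm (hankel_kernel s (Complex x y)) \<le> exp (- (- cos \<phi>) * exp x + (1 - s) * x)"
      unfolding norm_hankel_kernel by (simp add: mult.commute)
    also have "\<dots> \<le> C * exp (- \<bar>x\<bar>)" by (rule C(2)) fact
    finally show "norm (hankel_kernel s (Complex x y)) \<le> C * exp (- \<bar>x\<bar>)" .
  qed
qed

lemma hankel_kernel_integrable:
  assumes "pi / 2 < \<phi>" "\<phi> \<le> pi"
  shows "hankel_integrable a \<phi> (hankel_kernel s)"
proof -
  obtain C where "0 < C"
    "\<And>x y. a \<le> x \<Longrightarrow> \<phi> \<le> \<bar>y\<bar> \<Longrightarrow> \<bar>y\<bar> \<le> pi \<Longrightarrow> norm (hankel_kernel s (Complex x y)) \<le> C * exp (- \<bar>x\<bar>)"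
    using hankel_kernel_decay[OF assms] by blast
  moreover have "0 \<le> \<phi>" using assms pi_gt_zero by linarith
  ultimately show ?thesis
    using assms by (intro hankel_integrableI[where B = C] holomorphic_on_imp_continuous_on hankel_kernel_holomorphic) auto
qed

text \<open>Both rays are rotated onto the negative real axis, where the kernel becomes a Gamma
  integrand up to a phase. The pieces of the circle swept out on the way are exactly those by which
  the arc grows.\<close>

lemma hankel_integral_angle:
  assumes "pi / 2 < \<phi>" "\<phi> \<le> pi"
  shows "hankel_integral a \<phi> (hankel_kernel s) = hankel_integral a pi (hankel_kernel s)"
proof -
  let ?f = "hankel_kernel s"
  have \<phi>: "0 \<le> \<phi>" using assms pi_gt_zero by linarith
  obtain C where C: "0 < C"
    "\<And>x y. a \<le> x \<Longrightarrow> \<phi> \<le> \<bar>y\<bar> \<Longrightarrow> \<bar>y\<bar> \<le> pi \<Longrightarrow> norm (?f (Complex x y)) \<le> C * exp (- \<bar>x\<bar>)"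
    using hankel_kernel_decay[OF assms] by blast
  have 1: "(LINT x:{a..}|lborel. ?f (Complex x \<phi>)) =
      (LINT x:{a..}|lborel. ?f (Complex x pi)) + \<i> * integral {\<phi>..pi} (\<lambda>y. ?f (Complex a y))"
    by (rule half_strip_shift[where S = UNIV and C = C]) (use assms \<phi> C in \<open>auto intro: hankel_kernel_holomorphic\<close>)
  have 2: "(LINT x:{a..}|lborel. ?f (Complex x (- pi))) =
      (LINT x:{a..}|lborel. ?f (Complex x (- \<phi>))) + \<i> * integral {- pi..- \<phi>} (\<lambda>y. ?f (Complex a y))"
    by (rule half_strip_shift[where S = UNIV and C = C]) (use assms \<phi> C in \<open>auto intro: hankel_kernel_holomorphic\<close>)
  have io: "(\<lambda>y. ?f (Complex a y)) integrable_on {c..d}" for c d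
    unfolding hankel_kernel_def Complex_eq by (intro integrable_continuous_interval continuous_intros)
  have "integral {- pi..- \<phi>} (\<lambda>y. ?f (Complex a y)) + integral {- \<phi>..pi} (\<lambda>y. ?f (Complex a y)) =
      integral {- pi..pi} (\<lambda>y. ?f (Complex a y))"
    by (rule Henstock_Kurzweil_Integration.integral_combine) (use assms \<phi> io in auto)
  moreover have "integral {- \<phi>..\<phi>} (\<lambda>y. ?f (Complex a y)) + integral {\<phi>..pi} (\<lambda>y. ?f (Complex a y)) =
      integral {- \<phi>..pi} (\<lambda>y. ?f (Complex a y))"
    by (rule Henstock_Kurzweil_Integration.integral_combine) (use assms \<phi> io in auto)
  ultimately have 3: "integral {- pi..pi} (\<lambda>y. ?f (Complex a y)) = integral {- pi..- \<phi>} (\<lambda>y. ?f (Complex a y)) +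
      (integral {- \<phi>..\<phi>} (\<lambda>y. ?f (Complex a y)) + integral {\<phi>..pi} (\<lambda>y. ?f (Complex a y)))" by simp
  show ?thesis
    unfolding hankel_integral_def 1 2 3 by (simp add: algebra_simps)
qed

text \<open>The combination \<open>hankel_kernel s - s * hankel_kernel (s + 1)\<close> is the
  derivative of \<open>exp (exp w - s * w)\<close>, which vanishes at both ends of the contour. The
  identity mirrors the functional equation \<open>1 / Gamma s = s / Gamma (s + 1)\<close>.\<close>

lemma hankel_integral_kernel_rec:
  assumes "pi / 2 < \<phi>" "\<phi> \<le> pi"
  shows "hankel_integral a \<phi> (hankel_kernel s) = of_real s * hankel_integral a \<phi> (hankel_kernel (s + 1))"
proof -
  define F where "F w = exp (exp w - of_real s * w)" for w :: complex
  define f where "f w = hankel_kernel s w + (- of_real s) * hankel_kernel (s + 1) w" for w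
  have F: "(F has_field_derivative f w) (at w)" for w
  proof -
    have "(F has_field_derivative exp (exp w - of_real s * w) * (exp w - of_real s)) (at w)"
      unfolding F_def by (auto intro!: derivative_eq_intros)
    moreover have "exp (exp w - of_real s * w) * (exp w - of_real s) = f w"
    proof -
      have "hankel_kernel s w = exp (exp w - of_real s * w) * exp w" "hankel_kernel (s + 1) w = exp (exp w - of_real s * w)"
        unfolding hankel_kernel_def exp_add[symmetric] by (simp_all add: algebra_simps)
      then show ?thesis by (simp add: f_def algebra_simps)
    qed
    ultimately show ?thesis by simp
  qed
  have \<phi>: "0 \<le> \<phi>" using assms pi_gt_zero by linarith
  have f_int: "hankel_integrable a \<phi> f"
    unfolding f_def by (intro hankel_integrable_add hankel_integrable_mult hankel_kernel_integrable assms)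
  have cont: "continuous_on UNIV f"
    unfolding f_def hankel_kernel_def by (intro continuous_intros)
  have horiz: "((\<lambda>x. f (Complex x y)) has_integral (F (Complex d y) - F (Complex c y))) {c..d}" if "c \<le> d" for c d y
  proof (rule fundamental_theorem_of_calculus[OF that])
    fix x
    have "((\<lambda>x. Complex x y) has_vector_derivative 1) (at x within {c..d})"
      unfolding Complex_eq by (auto intro!: derivative_eq_intros simp: has_vector_derivative_def scaleR_conv_of_real)
    from field_vector_diff_chain_within[OF this has_field_derivative_at_within[OF F]]
    show "((\<lambda>x. F (Complex x y)) has_vector_derivative f (Complex x y)) (at x within {c..d})"
      by (simp add: comp_def)
  qed
  have vert: "((\<lambda>y. f (Complex x y)) has_integral (F (Complex x d) - F (Complex x c)) / \<i>) {c..d}" if "c \<le> d" for c d x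
  proof -
    have "((\<lambda>y. \<i> * f (Complex x y)) has_integral (F (Complex x d) - F (Complex x c))) {c..d}"
    proof (rule fundamental_theorem_of_calculus[OF that])
      fix y
      have "((\<lambda>y. Complex x y) has_vector_derivative \<i>) (at y within {c..d})"
        unfolding Complex_eq by (auto intro!: derivative_eq_intros simp: has_vector_derivative_def scaleR_conv_of_real)
      from field_vector_diff_chain_within[OF this has_field_derivative_at_within[OF F]]
      show "((\<lambda>y. F (Complex x y)) has_vector_derivative \<i> * f (Complex x y)) (at y within {c..d})"
        by (simp add: comp_def)
    qed
    from has_integral_mult_right[OF this, of "1 / \<i>"] show ?thesis by simp
  qed
  have line: "(LINT x:{a..}|lborel. f (Complex x y)) = - F (Complex a y)" if y: "\<bar>y\<bar> = \<phi>" for y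
  proof -
    have "y = \<phi> \<or> y = - \<phi>" using y by auto
    then have si: "set_integrable lborel {a..} (\<lambda>x. f (Complex x y))"
      using f_int by (auto simp: hankel_integrable_def)
    obtain C where C: "0 < C"
      "\<And>x y. a \<le> x \<Longrightarrow> \<phi> \<le> \<bar>y\<bar> \<Longrightarrow> \<bar>y\<bar> \<le> pi \<Longrightarrow> norm (hankel_kernel (s + 1) (Complex x y)) \<le> C * exp (- \<bar>x\<bar>)"
      using hankel_kernel_decay[OF assms] by blast
    have lim: "((\<lambda>x. F (Complex x y)) \<longlongrightarrow> 0) at_top"
    proof (rule Lim_null_comparison)
      have Fk: "F = hankel_kernel (s + 1)"
        by (simp add: F_def hankel_kernel_def fun_eq_iff)
      show "\<forall>\<^sub>F x in at_top. norm (F (Complex x y)) \<le> C * exp (- 1 * \<bar>x\<bar>)"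
        using eventually_ge_at_top[of a] unfolding Fk by eventually_elim (use C(2) y assms in auto)
      show "((\<lambda>x. C * exp (- 1 * \<bar>x\<bar>)) \<longlongrightarrow> 0) at_top"
        using tendsto_mult_left[OF tendsto_exp_neg_abs(1)[of 1], of C] by simp
    qed
    have "filterlim (\<lambda>n. a + real n) at_top sequentially"
      by (rule filterlim_tendsto_add_at_top[OF tendsto_const filterlim_real_sequentially])
    from tendsto_diff[OF filterlim_compose[OF lim this] tendsto_const]
    have "(\<lambda>n. F (Complex (a + real n) y) - F (Complex a y)) \<longlonglongrightarrow> 0 - F (Complex a y)" .
    moreover have "integral {a..a + real n} (\<lambda>x. f (Complex x y)) = F (Complex (a + real n) y) - F (Complex a y)" for n
      by (rule integral_unique, rule horiz) simp
    ultimately show ?thesis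
      using tendsto_integral_atLeast[OF si] LIMSEQ_unique by fastforce
  qed
  have "(LINT x:{a..}|lborel. f (Complex x \<phi>)) = - F (Complex a \<phi>)"
    "(LINT x:{a..}|lborel. f (Complex x (- \<phi>))) = - F (Complex a (- \<phi>))"
    "integral {- \<phi>..\<phi>} (\<lambda>y. f (Complex a y)) = (F (Complex a \<phi>) - F (Complex a (- \<phi>))) / \<i>"
    by (rule line, use \<phi> in simp)+ (rule integral_unique[OF vert], use \<phi> in simp)
  then have "hankel_integral a \<phi> f = 0"
    unfolding hankel_integral_def by simp
  moreover have "hankel_integral a \<phi> f =
      hankel_integral a \<phi> (hankel_kernel s) + (- of_real s) * hankel_integral a \<phi> (hankel_kernel (s + 1))"
    unfolding f_def
      hankel_integral_add[OF hankel_kernel_integrable[OF assms] hankel_integrable_mult[OF hankel_kernel_integrable[OF assms]]]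
      hankel_integral_mult[OF hankel_kernel_integrable[OF assms]] ..
  ultimately show ?thesis by (simp add: algebra_simps)
qed

text \<open>Euler's integral after the substitution \<open>t = exp x\<close>, the form in which it
  appears on the lines \<open>Im w = pi\<close> and \<open>Im w = - pi\<close>.\<close>

lemma Gamma_exp_integral:
  assumes "0 < m"
  shows "integrable lborel (\<lambda>x::real. exp (- exp x + m * x))"
    and "(LINT x|lborel. exp (- exp x + m * (x::real))) = Gamma m"
proof -
  define f where "f t = t powr (m - 1) / exp t" for t :: real
  have ga: "(f has_integral Gamma m) {0..}"
    unfolding f_def by (rule Gamma_integral_real[OF assms])
  \<comment> \<open>The range of \<open>exp\<close> is the open half-line, so the endpoint is
    dropped before changing variables.\<close>
  have "(f has_integral Gamma m) {0<..}"
    by (rule has_integral_spike_set_eq[THEN iffD1, OF _ _ ga])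
      (rule negligible_subset[of "{0}"]; auto)+
  moreover have "f t \<ge> 0" for t by (simp add: f_def)
  ultimately have abs: "f absolutely_integrable_on {0<..}" "integral {0<..} f = Gamma m"
    by (auto intro!: nonnegative_absolutely_integrable_1 simp: has_integral_integrable integral_unique)
  have "(\<lambda>x. \<bar>exp x\<bar> *\<^sub>R f (exp x)) absolutely_integrable_on UNIV \<and> integral UNIV (\<lambda>x. \<bar>exp x\<bar> *\<^sub>R f (exp x)) = Gamma m"
  proof (rule has_absolute_integral_change_of_variables_real[where h = exp and g = exp and f = f, THEN iffD2])
    show "f absolutely_integrable_on exp ` UNIV \<and> integral (exp ` UNIV) f = Gamma m"
    proof -
      have "range exp = {0::real<..}"
        by (auto simp: image_iff) (metis exp_ln)
      then show ?thesis using abs by simp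
    qed
  qed (auto intro!: derivative_eq_intros injI)
  moreover have "\<bar>exp x\<bar> *\<^sub>R f (exp x) = exp (- exp x + m * x)" for x
    by (simp add: f_def powr_def exp_minus exp_add algebra_simps exp_diff divide_simps)
  ultimately have *: "(\<lambda>x. exp (- exp x + m * x)) absolutely_integrable_on UNIV"
    "integral UNIV (\<lambda>x. exp (- exp x + m * x)) = Gamma m" by auto
  then show int: "integrable lborel (\<lambda>x::real. exp (- exp x + m * x))"
    by (subst (asm) set_integrable_def) (simp add: integrable_completion)
  show "(LINT x|lborel. exp (- exp x + m * (x::real))) = Gamma m"
    using *(2) integral_lborel[OF int] by simp
qed

text \<open>On both lines \<open>exp w = - exp x\<close>, so the two values differ only by the
  phases coming from \<open>(1 - s) * w\<close>; the difference of these phases produces the sine of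
  the reflection formula.\<close>

lemma hankel_kernel_line:
  "hankel_kernel s (Complex x pi) = of_real (exp (- exp x + (1 - s) * x)) * exp (\<i> * of_real (pi * (1 - s)))"
  "hankel_kernel s (Complex x (- pi)) = of_real (exp (- exp x + (1 - s) * x)) * exp (- \<i> * of_real (pi * (1 - s)))"
proof -
  have e: "exp (Complex x pi) = - of_real (exp x)" "exp (Complex x (- pi)) = - of_real (exp x)"
    by (simp_all add: complex_eq_iff Re_exp Im_exp)
  show "hankel_kernel s (Complex x pi) = of_real (exp (- exp x + (1 - s) * x)) * exp (\<i> * of_real (pi * (1 - s)))"
    "hankel_kernel s (Complex x (- pi)) = of_real (exp (- exp x + (1 - s) * x)) * exp (- \<i> * of_real (pi * (1 - s)))"
    unfolding hankel_kernel_def e exp_of_real[symmetric] exp_add[symmetric]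
    by (simp_all add: Complex_eq algebra_simps del: exp_of_real add: exp_of_real[symmetric])
qed

lemma norm_exp_minus_one_le:
  fixes v :: complex
  assumes "norm v \<le> 1"
  shows "norm (exp v - 1) \<le> exp 1 * norm v"
proof -
  have "norm (exp v - exp 0) \<le> exp 1 * norm (v - 0)"
  proof (rule field_differentiable_bound[where S = "cball 0 1" and f' = exp])
    show "norm (exp z) \<le> exp 1" if "z \<in> cball 0 1" for z :: complex
      using that complex_Re_le_cmod[of z] by (simp add: norm_exp_eq_Re)
  qed (use assms in \<open>auto intro: DERIV_exp has_field_derivative_at_within\<close>)
  then show ?thesis by simp
qed

text \<open>The contour is pushed to \<open>a \<longrightarrow> - \<infinity>\<close>; the contribution of the shrinking circle
  survives only for \<open>s = 1\<close>.\<close>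

lemma hankel_integral_base:
  assumes "0 < s" "s \<le> 1"
  shows "hankel_integral a pi (hankel_kernel s) = 2 * of_real pi * \<i> * of_real (rGamma s)"
proof -
  let ?f = "hankel_kernel s"
  define V where "V n = integral {- pi..pi} (\<lambda>y. ?f (Complex (- real n) y))" for n
  \<comment> \<open>The kernel is entire, so the radius of the arc is immaterial. The shift only
    goes to the right, hence the common starting point \<open>min a b\<close>.\<close>
  have const: "hankel_integral b pi ?f = hankel_integral a pi ?f" for b
  proof -
    have "hankel_integral (min a b) pi ?f = hankel_integral a pi ?f" "hankel_integral (min a b) pi ?f = hankel_integral b pi ?f"
      by (rule hankel_integral_shift[where S = UNIV];
          auto intro: hankel_kernel_holomorphic hankel_kernel_integrable)+
    then show ?thesis by simp
  qed
  define L where "L n = (LINT x:{- real n..}|lborel. complex_of_real (exp (- exp x + (1 - s) * x)))" for n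
  have H: "hankel_integral (- real n) pi ?f = L n * (2 * \<i> * of_real (sin (pi * (1 - s)))) + \<i> * V n" for n
  proof -
    have "(LINT x:{- real n..}|lborel. ?f (Complex x pi)) = L n * exp (\<i> * of_real (pi * (1 - s)))"
      "(LINT x:{- real n..}|lborel. ?f (Complex x (- pi))) = L n * exp (- \<i> * of_real (pi * (1 - s)))"
      unfolding hankel_kernel_line L_def set_lebesgue_integral_def by (simp_all flip: mult_scaleR_left)
    moreover have "exp (\<i> * of_real (pi * (1 - s))) - exp (- \<i> * of_real (pi * (1 - s))) = 2 * \<i> * of_real (sin (pi * (1 - s)))"
      unfolding sin_of_real[symmetric] sin_exp_eq by simp
    ultimately show ?thesis
      unfolding hankel_integral_def V_def by (metis right_diff_distrib)
  qed
  have expn: "(\<lambda>n. exp (- real n)) \<longlonglongrightarrow> 0"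
    using filterlim_compose[OF exp_at_bot, of "\<lambda>n. - real n" sequentially]
    by (simp add: filterlim_uminus_at_bot filterlim_real_sequentially)
  show ?thesis
  proof (cases "s = 1")
    \<comment> \<open>Here the sine vanishes, the two lines cancel, and the whole value comes from
      the arc, on which the kernel tends to \<open>1\<close>.\<close>
    case True
    have V: "V \<longlonglongrightarrow> 2 * of_real pi"
    proof (rule LIM_zero_cancel, rule Lim_null_comparison)
      show "\<forall>\<^sub>F n in sequentially. norm (V n - 2 * of_real pi) \<le> exp 1 * exp (- real n) * (pi - - pi)"
      proof (intro always_eventually allI)
        fix n
        have "V n - 2 * of_real pi = integral {- pi..pi} (\<lambda>y. ?f (Complex (- real n) y) - 1)"
        proof -
          have "(\<lambda>y. ?f (Complex (- real n) y)) integrable_on {- pi..pi}"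
            unfolding hankel_kernel_def Complex_eq by (intro integrable_continuous_interval continuous_intros)
          then show ?thesis
            by (subst Henstock_Kurzweil_Integration.integral_diff) (auto simp: V_def scaleR_conv_of_real)
        qed
        also have "norm \<dots> \<le> exp 1 * exp (- real n) * (pi - - pi)"
        proof (rule norm_integral_le_Icc)
          fix y
          let ?v = "exp (Complex (- real n) y)"
          have nv: "norm ?v = exp (- real n)" by simp
          then have "norm ?v \<le> 1" by simp
          have "norm (exp ?v - 1) \<le> exp 1 * norm ?v"
            by (rule norm_exp_minus_one_le) fact
          then show "norm (?f (Complex (- real n) y) - 1) \<le> exp 1 * exp (- real n)"
            using nv True by (simp add: hankel_kernel_def)
        qed auto
        finally show "norm (V n - 2 * of_real pi) \<le> exp 1 * exp (- real n) * (pi - - pi)" .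
      qed
      have "(\<lambda>n. exp 1 * exp (- real n) * (pi - - pi)) \<longlonglongrightarrow> exp 1 * 0 * (pi - - pi)"
        by (intro tendsto_mult tendsto_const expn)
      then show "(\<lambda>n. exp 1 * exp (- real n) * (pi - - pi)) \<longlonglongrightarrow> 0" by simp
    qed
    have "hankel_integral a pi ?f = \<i> * V n" for n
      using H[of n] const[of "- real n"] True by simp
    then have "(\<lambda>n. hankel_integral a pi ?f) \<longlonglongrightarrow> \<i> * (2 * of_real pi)"
      using tendsto_mult_left[OF V, of \<i>] by simp
    then have "hankel_integral a pi ?f = \<i> * (2 * of_real pi)"
      by (simp add: LIMSEQ_const_iff)
    then show ?thesis using True by simp
  next
    \<comment> \<open>Now the arc is of order \<open>exp (- n (1 - s))\<close> and disappears; the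
      lines tend to multiples of \<open>Gamma (1 - s)\<close>, and the reflection formula turns the
      product with the sine into \<open>pi * rGamma s\<close>.\<close>
    case False
    then have s: "0 < 1 - s" using assms by simp
    have V: "V \<longlonglongrightarrow> 0"
    proof (rule Lim_null_comparison)
      show "\<forall>\<^sub>F n in sequentially. norm (V n) \<le> exp 1 * exp (- real n) powr (1 - s) * (pi - - pi)"
      proof (intro always_eventually allI)
        fix n
        show "norm (V n) \<le> exp 1 * exp (- real n) powr (1 - s) * (pi - - pi)"
          unfolding V_def
        proof (rule norm_integral_le_Icc)
          fix y
          have "exp (- real n) * cos y \<le> exp (- real n) * 1"
            by (rule mult_left_mono) auto
          also have "\<dots> \<le> 1" by simp
          finally have "exp (- real n) * cos y \<le> 1" .
          then show "norm (?f (Complex (- real n) y)) \<le> exp 1 * exp (- real n) powr (1 - s)"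
            unfolding norm_hankel_kernel exp_add by (intro mult_mono) (auto simp: powr_def)
        qed auto
      qed
      have "(\<lambda>n. exp (- real n) powr (1 - s)) \<longlonglongrightarrow> 0 powr (1 - s)"
        by (rule tendsto_powr'[OF expn tendsto_const]) (use s in auto)
      then have "(\<lambda>n. exp 1 * exp (- real n) powr (1 - s) * (pi - - pi)) \<longlonglongrightarrow> exp 1 * 0 powr (1 - s) * (pi - - pi)"
        by (intro tendsto_mult tendsto_const)
      then show "(\<lambda>n. exp 1 * exp (- real n) powr (1 - s) * (pi - - pi)) \<longlonglongrightarrow> 0"
        by simp
    qed
    have L: "L \<longlonglongrightarrow> of_real (Gamma (1 - s))"
    proof -
      have U: "(\<Union>n. {- real n..}) = UNIV"
      proof (intro equalityI subsetI UNIV_I)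
        fix x :: real
        obtain n where "\<bar>x\<bar> \<le> real n" using real_arch_simple by blast
        then show "x \<in> (\<Union>n. {- real n..})" by (intro UN_I[of n]) auto
      qed
      have "L \<longlonglongrightarrow> (LINT x:(\<Union>n. {- real n..})|lborel. complex_of_real (exp (- exp x + (1 - s) * x)))"
        unfolding L_def
        by (rule set_integral_cont_up)
          (use Gamma_exp_integral[OF s] in \<open>auto simp: U incseq_def set_integrable_def\<close>)
      then show ?thesis
        using Gamma_exp_integral(2)[OF s] unfolding U by (simp add: set_lebesgue_integral_def)
    qed
    have "(\<lambda>n. hankel_integral (- real n) pi ?f) \<longlonglongrightarrow>
        of_real (Gamma (1 - s)) * (2 * \<i> * of_real (sin (pi * (1 - s)))) + \<i> * 0"
      unfolding H by (intro tendsto_intros L V)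
    then have "hankel_integral a pi ?f = of_real (Gamma (1 - s)) * (2 * \<i> * of_real (sin (pi * (1 - s))))"
      unfolding const[of "- real n" for n] by (simp add: LIMSEQ_const_iff)
    also have "\<dots> = 2 * \<i> * of_real (Gamma (1 - s) * sin (pi * (1 - s)))" by simp
    also have "Gamma (1 - s) * sin (pi * (1 - s)) = pi * rGamma s"
    proof -
      have "complex_of_real (Gamma s * Gamma (1 - s)) = complex_of_real (pi / sin (pi * s))"
        using Gamma_reflection_complex[of "of_real s"]
          Gamma_complex_of_real[of "1 - s"] Gamma_complex_of_real[of s] sin_of_real[of "pi * s", where 'a = complex]
        by simp
      then have "Gamma s * Gamma (1 - s) = pi / sin (pi * s)" by (simp only: of_real_eq_iff)
      moreover have "0 < sin (pi * s)"
        using assms False by (intro sin_gt_zero) auto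
      moreover have "sin (pi * (1 - s)) = sin (pi * s)"
        by (simp add: right_diff_distrib sin_diff)
      moreover have "0 < Gamma s" using assms by (simp add: Gamma_real_pos)
      ultimately show ?thesis
        by (simp add: rGamma_inverse_Gamma field_simps)
    qed
    finally show ?thesis by simp
  qed
qed

text \<open>The limit of shrinking arcs settles \<open>0 < s \<le> 1\<close>; the recurrence then
  extends the formula by unit steps, since \<open>rGamma\<close> obeys the same recurrence.\<close>

theorem Hankel:
  assumes "pi / 2 < \<phi>" "\<phi> \<le> pi" "0 < s"
  shows "hankel_integral a \<phi> (hankel_kernel s) = 2 * of_real pi * \<i> * of_real (rGamma s)"
proof -
  have *: "hankel_integral a \<phi> (hankel_kernel s) = 2 * of_real pi * \<i> * of_real (rGamma s)"
    if "0 < s" "s \<le> real (Suc n)" for n s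
    using that
  proof (induction n arbitrary: s)
    case 0
    then show ?case
      by (simp add: hankel_integral_angle[OF assms(1,2), of a s] hankel_integral_base[of s a])
  next
    case (Suc n)
    show ?case
    proof (cases "s \<le> 1")
      case True
      then show ?thesis
        using Suc.prems by (simp add: hankel_integral_angle[OF assms(1,2), of a s] hankel_integral_base[of s a])
    next
      case False
      then have "hankel_integral a \<phi> (hankel_kernel (s - 1)) = 2 * of_real pi * \<i> * of_real (rGamma (s - 1))"
        using Suc.prems by (intro Suc.IH) auto
      moreover have "rGamma (s - 1) = (s - 1) * rGamma s"
        using rGamma_plus1[of "s - 1"] by simp
      ultimately show ?thesis
        using hankel_integral_kernel_rec[OF assms(1,2), of a "s - 1"] False by simp
    qed
  qed
  obtain n where "s \<le> real n" using real_arch_simple by blast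
  then show ?thesis
    by (intro *[OF assms(3), of n]) simp
qed

section \<open>The Mittag-Leffler function in a sector\<close>

text \<open>The geometric sum of \<open>z ^ k * hankel_kernel (\<alpha> * k + \<beta>) w\<close>,
  because raising the kernel parameter by \<alpha> multiplies the kernel by
  \<open>exp (- \<alpha> * w)\<close>. Its poles are the solutions of
  \<open>exp (\<alpha> * w) = z\<close>.\<close>

definition mittag_leffler_integrand :: "real \<Rightarrow> real \<Rightarrow> complex \<Rightarrow> complex \<Rightarrow> complex" where
  "mittag_leffler_integrand \<alpha> \<beta> z w = hankel_kernel \<beta> w / (1 - z * exp (- of_real \<alpha> * w))"

lemma mittag_leffler_integrand_measurable [measurable]:
  "(\<lambda>x. mittag_leffler_integrand \<alpha> \<beta> z (Complex x y)) \<in> borel_measurable borel"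
  unfolding mittag_leffler_integrand_def hankel_kernel_def Complex_eq by measurable

lemma norm_exp_neg_mult: "norm (exp (- of_real \<alpha> * w)) = exp (- \<alpha> * Re w)"
  by (simp add: norm_exp_eq_Re)

text \<open>Hankel's formula is inserted for every coefficient. The condition on \<open>a\<close>
  makes the geometric ratio at most \<open>1 / 2\<close> on the whole contour, so the remainder
  after \<open>n\<close> terms is of order \<open>2 powr (- n)\<close>. Summability is obtained
  together with the value.\<close>

lemma mittag_leffler_sums_hankel:
  assumes "0 < \<alpha>" "0 < \<beta>" and \<phi>: "pi / 2 < \<phi>" "\<phi> \<le> pi"
    and a: "norm z * exp (- \<alpha> * a) \<le> 1 / 2"
  shows "(\<lambda>k. z ^ k / of_real (Gamma (\<alpha> * real k + \<beta>))) sums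
    (hankel_integral a \<phi> (mittag_leffler_integrand \<alpha> \<beta> z) / (2 * of_real pi * \<i>))"
proof -
  have \<phi>0: "0 \<le> \<phi>" using \<phi> pi_gt_zero by linarith
  define q where "q w = z * exp (- of_real \<alpha> * w)" for w
  define G where "G = mittag_leffler_integrand \<alpha> \<beta> z"
  have G: "G w = hankel_kernel \<beta> w / (1 - q w)" for w
    by (simp add: G_def mittag_leffler_integrand_def q_def)
  have q_le: "norm (q w) \<le> 1 / 2" if "a \<le> Re w" for w
  proof -
    have "norm (q w) \<le> norm z * exp (- \<alpha> * a)"
      unfolding q_def norm_mult norm_exp_neg_mult using assms that by (intro mult_left_mono) auto
    then show ?thesis using a by simp
  qed
  have q1: "1 / 2 \<le> norm (1 - q w)" if "a \<le> Re w" for w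
    using norm_triangle_ineq2[of 1 "q w"] q_le[OF that] by simp
  then have q_ne: "1 - q w \<noteq> 0" if "a \<le> Re w" for w
    using that by (metis half_gt_zero less_le_not_le norm_zero zero_less_one)
  obtain C where C: "0 < C"
    "\<And>x y. a \<le> x \<Longrightarrow> \<phi> \<le> \<bar>y\<bar> \<Longrightarrow> \<bar>y\<bar> \<le> pi \<Longrightarrow> norm (hankel_kernel \<beta> (Complex x y)) \<le> C * exp (- \<bar>x\<bar>)"
    using hankel_kernel_decay[OF \<phi>] by blast
  \<comment> \<open>\<open>C\<close> serves the two rays; the other number bounds the kernel on the
    arc \<open>Re w = a\<close>.\<close>
  define B where "B = max C (exp (exp a + (1 - \<beta>) * a))"
  have B: "0 \<le> B" "C \<le> B" unfolding B_def by (auto simp: le_max_iff_disj)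
  have le: "norm (q w ^ n * G w) \<le> (1 / 2) ^ n * 2 * norm (hankel_kernel \<beta> w)" if w: "a \<le> Re w" for w n
  proof -
    have "norm (G w) \<le> norm (hankel_kernel \<beta> w) / (1 / 2)"
      unfolding G norm_divide using q1[OF w] by (intro divide_left_mono mult_pos_pos) auto
    then have "norm (q w) ^ n * norm (G w) \<le> (1 / 2) ^ n * (norm (hankel_kernel \<beta> w) / (1 / 2))"
      using q_le[OF w] by (intro mult_mono power_mono) auto
    then show ?thesis by (simp add: norm_mult norm_power)
  qed
  have lines: "norm (q (Complex x y) ^ n * G (Complex x y)) \<le> (1 / 2) ^ n * 2 * B * exp (- \<bar>x\<bar>)"
    if "a \<le> x" "\<bar>y\<bar> = \<phi>" for x y n
  proof -
    have "norm (hankel_kernel \<beta> (Complex x y)) \<le> C * exp (- \<bar>x\<bar>)"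
      using that \<phi> by (intro C) auto
    also have "\<dots> \<le> B * exp (- \<bar>x\<bar>)" using B by simp
    finally have "(1 / 2) ^ n * 2 * norm (hankel_kernel \<beta> (Complex x y)) \<le> (1 / 2) ^ n * 2 * (B * exp (- \<bar>x\<bar>))"
      by (rule mult_left_mono) simp
    with le[of "Complex x y" n] that show ?thesis by (auto simp only: complex.sel mult.assoc intro: order.trans)
  qed
  have vert: "norm (q (Complex a y) ^ n * G (Complex a y)) \<le> (1 / 2) ^ n * 2 * B" for y n
  proof -
    have "exp a * cos y \<le> exp a * 1" by (rule mult_left_mono) auto
    then have "norm (hankel_kernel \<beta> (Complex a y)) \<le> B"
      unfolding norm_hankel_kernel B_def by (simp add: max.coboundedI2)
    then have "(1 / 2) ^ n * 2 * norm (hankel_kernel \<beta> (Complex a y)) \<le> (1 / 2) ^ n * 2 * B"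
      by (rule mult_left_mono) simp
    with le[of "Complex a y" n] show ?thesis by (auto simp only: complex.sel intro: order.trans)
  qed
  have meas [measurable]: "(\<lambda>x. q (Complex x y) ^ n * G (Complex x y)) \<in> borel_measurable borel" for y n
    unfolding q_def G hankel_kernel_def Complex_eq by measurable
  have int: "hankel_integrable a \<phi> (\<lambda>w. q w ^ n * G w)" for n
  proof (rule hankel_integrableI)
    show "continuous_on {w. a \<le> Re w \<and> \<bar>Im w\<bar> \<le> \<phi>} (\<lambda>w. q w ^ n * G w)"
      using q_ne unfolding G hankel_kernel_def q_def by (intro continuous_intros) auto
  qed (use lines \<phi>0 in auto)
  define R where "R n = hankel_integral a \<phi> (\<lambda>w. q w ^ n * G w)" for n
  have G_eq: "(\<lambda>w. q w ^ 0 * G w) = G" by simp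
  have R_lim: "R \<longlonglongrightarrow> 0"
  proof (rule Lim_null_comparison)
    let ?K = "2 * (LINT x|lborel. exp (- \<bar>x::real\<bar>)) + 2 * \<phi>"
    show "\<forall>\<^sub>F n in sequentially. norm (R n) \<le> (1 / 2) ^ n * 2 * B * ?K"
      unfolding R_def
      by (intro always_eventually allI norm_hankel_integral_le meas) (use B \<phi>0 lines vert in auto)
    have "(\<lambda>n. (1 / 2 :: real) ^ n) \<longlonglongrightarrow> 0" by (rule LIMSEQ_power_zero) simp
    then have "(\<lambda>n. (1 / 2 :: real) ^ n * 2 * B * ?K) \<longlonglongrightarrow> 0 * 2 * B * ?K"
      by (intro tendsto_mult tendsto_const)
    then show "(\<lambda>n. (1 / 2) ^ n * 2 * B * ?K) \<longlonglongrightarrow> 0" by simp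
  qed
  have partial: "(\<Sum>k<n. z ^ k / of_real (Gamma (\<alpha> * real k + \<beta>))) =
      (hankel_integral a \<phi> G - R n) / (2 * of_real pi * \<i>)" for n
  proof -
    have summand: "z ^ k / of_real (Gamma (\<alpha> * real k + \<beta>)) =
        hankel_integral a \<phi> (\<lambda>w. z ^ k * hankel_kernel (\<alpha> * real k + \<beta>) w) / (2 * of_real pi * \<i>)" for k
    proof -
      have "0 < \<alpha> * real k + \<beta>" using assms by (intro add_nonneg_pos) auto
      then have "hankel_integral a \<phi> (\<lambda>w. z ^ k * hankel_kernel (\<alpha> * real k + \<beta>) w) =
          z ^ k * (2 * of_real pi * \<i> * of_real (rGamma (\<alpha> * real k + \<beta>)))"
        by (subst hankel_integral_mult[OF hankel_kernel_integrable[OF \<phi>]], subst Hankel[OF \<phi>]) auto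
      then show ?thesis
        by (simp add: rGamma_inverse_Gamma inverse_eq_divide)
    qed
    have kq: "z ^ k * hankel_kernel (\<alpha> * real k + \<beta>) w = q w ^ k * hankel_kernel \<beta> w" for k w
    proof -
      have "hankel_kernel (\<alpha> * real k + \<beta>) w = exp (- of_real \<alpha> * w) ^ k * hankel_kernel \<beta> w"
        unfolding hankel_kernel_def exp_of_nat_mult[symmetric] exp_add[symmetric]
        by (simp add: algebra_simps)
      then show ?thesis by (simp add: q_def power_mult_distrib)
    qed
    have "(\<Sum>k<n. z ^ k / of_real (Gamma (\<alpha> * real k + \<beta>))) =
        hankel_integral a \<phi> (\<lambda>w. \<Sum>k<n. z ^ k * hankel_kernel (\<alpha> * real k + \<beta>) w) / (2 * of_real pi * \<i>)"
      unfolding summand sum_divide_distrib[symmetric]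
      by (subst hankel_integral_sum) (auto intro: hankel_integrable_mult hankel_kernel_integrable \<phi>)
    also have "hankel_integral a \<phi> (\<lambda>w. \<Sum>k<n. z ^ k * hankel_kernel (\<alpha> * real k + \<beta>) w) =
        hankel_integral a \<phi> (\<lambda>w. G w + (- 1) * (q w ^ n * G w))"
    proof -
      have e: "(\<Sum>k<n. z ^ k * hankel_kernel (\<alpha> * real k + \<beta>) w) = G w + (- 1) * (q w ^ n * G w)"
        if "a \<le> Re w" for w
      proof -
        have "(\<Sum>k<n. z ^ k * hankel_kernel (\<alpha> * real k + \<beta>) w) = (\<Sum>k<n. q w ^ k) * hankel_kernel \<beta> w"
          unfolding kq sum_distrib_right ..
        also have "(\<Sum>k<n. q w ^ k) = (1 - q w ^ n) / (1 - q w)"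
          using q_ne[OF that] by (subst sum_gp_strict) auto
        finally show ?thesis by (simp add: G algebra_simps diff_divide_distrib)
      qed
      show ?thesis
        unfolding hankel_integral_def
        by (intro arg_cong2[where f = "(+)"] arg_cong2[where f = "(-)"] arg_cong2[where f = "(*)"] refl
            set_lebesgue_integral_cong Henstock_Kurzweil_Integration.integral_cong) (auto simp: e)
    qed
    also have "\<dots> = hankel_integral a \<phi> G + (- 1) * R n"
      unfolding R_def using int[of 0, unfolded G_eq] int[of n]
      by (simp only: hankel_integral_add hankel_integral_mult hankel_integrable_mult)
    finally show ?thesis by simp
  qed
  have "(\<lambda>n. (hankel_integral a \<phi> G - R n) / (2 * of_real pi * \<i>)) \<longlonglongrightarrow>
      (hankel_integral a \<phi> G - 0) / (2 * of_real pi * \<i>)"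
    by (intro tendsto_intros R_lim) auto
  then show ?thesis
    unfolding sums_def partial G_def by simp
qed

text \<open>The sign of \<open>a\<close> matters later: the contour is moved from
  \<open>Re w = a\<close> to the left as far as \<open>Re w = 0\<close>.\<close>

lemma exists_contraction_exponent:
  assumes "0 < (\<alpha>::real)"
  obtains a where "0 \<le> a" "r * exp (- \<alpha> * a) \<le> 1 / 2"
proof -
  define a where "a = 2 * \<bar>r\<bar> / \<alpha>"
  have a: "0 \<le> a" using assms by (simp add: a_def)
  have "\<alpha> * a = 2 * \<bar>r\<bar>" using assms by (simp add: a_def)
  then have "2 * \<bar>r\<bar> \<le> exp (\<alpha> * a)"
    using exp_ge_add_one_self[of "\<alpha> * a"] by linarith
  then have "r \<le> 1 / 2 * exp (\<alpha> * a)" by linarith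
  then have "r * exp (- \<alpha> * a) \<le> 1 / 2 * exp (\<alpha> * a) * exp (- \<alpha> * a)"
    by (rule mult_right_mono) simp
  then show ?thesis using that[OF a] by (simp add: exp_minus)
qed

text \<open>Convergence of the power series at every point is read off the Hankel representation,
  with a contour adapted to \<open>z\<close>; no growth estimate for \<open>Gamma\<close>
  enters.\<close>

lemma mittag_leffler_holomorphic:
  assumes "0 < \<alpha>" "0 < \<beta>"
  shows "mittag_leffler \<alpha> \<beta> holomorphic_on UNIV"
proof -
  define c where "c k = 1 / complex_of_real (Gamma (\<alpha> * real k + \<beta>))" for k
  have "summable (\<lambda>k. c k * z ^ k)" for z
  proof -
    obtain a where "norm z * exp (- \<alpha> * a) \<le> 1 / 2"
      using exists_contraction_exponent[OF assms(1)] by blast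
    from mittag_leffler_sums_hankel[OF assms _ order_refl this] show ?thesis
      using sums_summable pi_gt_zero by (fastforce simp: c_def)
  qed
  from termdiffs_strong_converges_everywhere[OF this]
  have "((\<lambda>z. \<Sum>k. c k * z ^ k) has_field_derivative (\<Sum>k. diffs c k * z ^ k)) (at z)" for z .
  moreover have "mittag_leffler \<alpha> \<beta> = (\<lambda>z. \<Sum>k. c k * z ^ k)"
    by (simp add: fun_eq_iff mittag_leffler_def c_def)
  ultimately show ?thesis
    by (auto simp: holomorphic_on_def field_differentiable_def intro: has_field_derivative_at_within)
qed

text \<open>The law of cosines: the hypothesis says that the cosine of the angle between
  \<open>z\<close> and \<open>v\<close> is at most \<open>c\<close>, and \<open>c < 1\<close>
  prevents cancellation in \<open>v - z\<close>.\<close>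

lemma norm_diff_ge_of_angle:
  fixes v z :: complex
  assumes "Re (z * cnj v) \<le> c * (norm z * norm v)" "0 \<le> c" "c < 1"
  shows "sqrt ((1 - c) / 2) * (norm z + norm v) \<le> norm (v - z)"
proof (rule power2_le_imp_le)
  have "2 * (norm z * norm v) \<le> (norm z)\<^sup>2 + (norm v)\<^sup>2"
    by (metis mult.assoc sum_squares_bound)
  then have "c * (2 * (norm z * norm v)) \<le> c * ((norm z)\<^sup>2 + (norm v)\<^sup>2)"
    using assms by (intro mult_left_mono)
  moreover have "(norm (v - z))\<^sup>2 = (norm v)\<^sup>2 + (norm z)\<^sup>2 - 2 * Re (z * cnj v)"
    unfolding cmod_power2 by (simp add: algebra_simps power2_eq_square)
  ultimately have "(1 - c) * ((norm z)\<^sup>2 + (norm v)\<^sup>2) \<le> (norm (v - z))\<^sup>2"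
    using assms(1) by (simp add: algebra_simps)
  moreover have "(norm z + norm v)\<^sup>2 \<le> 2 * ((norm z)\<^sup>2 + (norm v)\<^sup>2)"
    using sum_squares_bound[of "norm z" "norm v"] by (simp add: power2_sum)
  then have "(1 - c) / 2 * (norm z + norm v)\<^sup>2 \<le> (1 - c) / 2 * (2 * ((norm z)\<^sup>2 + (norm v)\<^sup>2))"
    using assms by (intro mult_left_mono) auto
  then have "(1 - c) / 2 * (norm z + norm v)\<^sup>2 \<le> (1 - c) * ((norm z)\<^sup>2 + (norm v)\<^sup>2)"
    by (simp only: times_divide_eq_left times_divide_eq_right)
  moreover have "(sqrt ((1 - c) / 2) * (norm z + norm v))\<^sup>2 = (1 - c) / 2 * (norm z + norm v)\<^sup>2"
    using assms by (simp add: power_mult_distrib)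
  ultimately show "(sqrt ((1 - c) / 2) * (norm z + norm v))\<^sup>2 \<le> (norm (v - z))\<^sup>2"
    by linarith
qed simp

text \<open>The condition on \<open>z\<close> keeps it at a fixed angle from all
  \<open>exp (\<alpha> * w)\<close> with \<open>\<bar>Im w\<bar> \<le> \<phi>\<close>. Hence no pole
  obstructs moving the contour from its position depending on \<open>z\<close> to
  \<open>Re w = 0\<close>. There the denominator, once multiplied by
  \<open>exp (\<alpha> * w)\<close>, is at least \<open>\<kappa> * (1 + norm z)\<close>, which is
  the whole decay.\<close>

lemma mittag_leffler_sector_bound:
  assumes "0 < \<alpha>" "0 < \<beta>" and \<phi>: "pi / 2 < \<phi>" "\<phi> \<le> pi" and c: "0 \<le> c" "c < 1"
  shows "\<exists>C. \<forall>z. (\<forall>y. \<bar>y\<bar> \<le> \<phi> \<longrightarrow> Re (z * cis (- (\<alpha> * y))) \<le> c * norm z) \<longrightarrow>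
    norm (mittag_leffler \<alpha> \<beta> z) \<le> C / (1 + norm z)"
proof -
  have \<phi>0: "0 \<le> \<phi>" using \<phi> pi_gt_zero by linarith
  define \<kappa> where "\<kappa> = sqrt ((1 - c) / 2)"
  have \<kappa>: "0 < \<kappa>" using c by (simp add: \<kappa>_def)
  \<comment> \<open>The parameter is \<open>\<beta> - \<alpha>\<close> because numerator and
    denominator are both multiplied by \<open>exp (\<alpha> * w)\<close>.\<close>
  obtain C where C: "0 < C"
    "\<And>x y. 0 \<le> x \<Longrightarrow> \<phi> \<le> \<bar>y\<bar> \<Longrightarrow> \<bar>y\<bar> \<le> pi \<Longrightarrow> norm (hankel_kernel (\<beta> - \<alpha>) (Complex x y)) \<le> C * exp (- \<bar>x\<bar>)"
    using hankel_kernel_decay[OF \<phi>] by blast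
  define B where "B = max C (exp 1)"
  have B: "0 \<le> B" "C \<le> B" "exp 1 \<le> B" unfolding B_def by (auto simp: le_max_iff_disj)
  let ?K = "2 * (LINT x|lborel. exp (- \<bar>x::real\<bar>)) + 2 * \<phi>"
  have main: "norm (mittag_leffler \<alpha> \<beta> z) \<le> (B * ?K / (2 * pi * \<kappa>)) / (1 + norm z)"
    if z: "\<And>y. \<bar>y\<bar> \<le> \<phi> \<Longrightarrow> Re (z * cis (- (\<alpha> * y))) \<le> c * norm z" for z
  proof -
    let ?G = "mittag_leffler_integrand \<alpha> \<beta> z"
    have den: "\<kappa> * (norm z + exp (\<alpha> * Re w)) \<le> exp (\<alpha> * Re w) * norm (1 - z * exp (- of_real \<alpha> * w))"
      if w: "\<bar>Im w\<bar> \<le> \<phi>" for w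
    proof -
      let ?v = "exp (of_real \<alpha> * w)"
      have nv: "norm ?v = exp (\<alpha> * Re w)" by (simp add: norm_exp_eq_Re)
      have "cnj ?v = of_real (exp (\<alpha> * Re w)) * cis (- (\<alpha> * Im w))"
        by (simp add: complex_eq_iff Re_exp Im_exp)
      then have "Re (z * cnj ?v) = exp (\<alpha> * Re w) * Re (z * cis (- (\<alpha> * Im w)))"
        by (simp add: algebra_simps)
      also have "\<dots> \<le> exp (\<alpha> * Re w) * (c * norm z)"
        by (intro mult_left_mono z w) auto
      finally have "\<kappa> * (norm z + norm ?v) \<le> norm (?v - z)"
        unfolding \<kappa>_def using c by (intro norm_diff_ge_of_angle) (auto simp: nv mult_ac)
      moreover have "?v - z = ?v * (1 - z * exp (- of_real \<alpha> * w))"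
        by (simp add: right_diff_distrib exp_minus)
      ultimately show ?thesis by (metis nv norm_mult)
    qed
    have den_ne: "1 - z * exp (- of_real \<alpha> * w) \<noteq> 0" if w: "\<bar>Im w\<bar> \<le> \<phi>" for w
    proof
      assume "1 - z * exp (- of_real \<alpha> * w) = 0"
      then have "\<kappa> * (norm z + exp (\<alpha> * Re w)) \<le> 0" using den[OF w] by simp
      moreover have "0 < \<kappa> * (norm z + exp (\<alpha> * Re w))"
        using \<kappa> by (intro mult_pos_pos add_nonneg_pos) auto
      ultimately show False by simp
    qed
    have G_le: "norm (?G (Complex x y)) \<le> norm (hankel_kernel (\<beta> - \<alpha>) (Complex x y)) / (\<kappa> * (1 + norm z))"
      if x: "0 \<le> x" and y: "\<bar>y\<bar> \<le> \<phi>" for x y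
    proof -
      let ?D = "norm (1 - z * exp (- of_real \<alpha> * Complex x y))"
      have "\<kappa> * (1 + norm z) \<le> \<kappa> * (norm z + exp (\<alpha> * x))"
        using \<kappa> x assms by (intro mult_left_mono) auto
      also have "\<dots> \<le> exp (\<alpha> * x) * ?D"
        using den[of "Complex x y"] y by simp
      finally have D: "\<kappa> * (1 + norm z) \<le> exp (\<alpha> * x) * ?D" .
      have pos: "0 < \<kappa> * (1 + norm z)" using \<kappa> by (simp add: add_pos_nonneg)
      have "norm (hankel_kernel (\<beta> - \<alpha>) (Complex x y)) = norm (hankel_kernel \<beta> (Complex x y)) * exp (\<alpha> * x)"
        unfolding norm_hankel_kernel exp_add[symmetric] by (simp add: algebra_simps)
      moreover have "norm (?G (Complex x y)) = norm (hankel_kernel \<beta> (Complex x y)) * exp (\<alpha> * x) / (exp (\<alpha> * x) * ?D)"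
        by (simp add: mittag_leffler_integrand_def norm_divide)
      moreover have "norm (hankel_kernel \<beta> (Complex x y)) * exp (\<alpha> * x) / (exp (\<alpha> * x) * ?D) \<le>
          norm (hankel_kernel \<beta> (Complex x y)) * exp (\<alpha> * x) / (\<kappa> * (1 + norm z))"
        using D pos by (intro divide_left_mono) auto
      ultimately show ?thesis by simp
    qed
    have nn: "0 < \<kappa> * (1 + norm z)" using \<kappa> by (simp add: add_pos_nonneg)
    have lines: "norm (?G (Complex x y)) \<le> B / (\<kappa> * (1 + norm z)) * exp (- \<bar>x\<bar>)" if "0 \<le> x" "\<bar>y\<bar> = \<phi>" for x y
    proof -
      have "norm (hankel_kernel (\<beta> - \<alpha>) (Complex x y)) \<le> C * exp (- \<bar>x\<bar>)"
        using that \<phi> by (intro C) auto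
      also have "\<dots> \<le> B * exp (- \<bar>x\<bar>)" using B by simp
      finally have "norm (hankel_kernel (\<beta> - \<alpha>) (Complex x y)) / (\<kappa> * (1 + norm z)) \<le> B * exp (- \<bar>x\<bar>) / (\<kappa> * (1 + norm z))"
        using nn by (intro divide_right_mono) auto
      then show ?thesis using G_le[of x y] that by simp
    qed
    have vert: "norm (?G (Complex 0 y)) \<le> B / (\<kappa> * (1 + norm z))" if "\<bar>y\<bar> \<le> \<phi>" for y
    proof -
      have "norm (hankel_kernel (\<beta> - \<alpha>) (Complex 0 y)) \<le> B"
        unfolding norm_hankel_kernel using B(3) by (auto intro: order.trans[of _ "exp 1"])
      then have "norm (hankel_kernel (\<beta> - \<alpha>) (Complex 0 y)) / (\<kappa> * (1 + norm z)) \<le> B / (\<kappa> * (1 + norm z))"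
        using nn by (intro divide_right_mono) auto
      then show ?thesis using G_le[of 0 y] that by simp
    qed
    obtain a where a: "0 \<le> a" "norm z * exp (- \<alpha> * a) \<le> 1 / 2"
      using exists_contraction_exponent[OF assms(1)] by blast
    have hol: "?G holomorphic_on {w. 1 - z * exp (- of_real \<alpha> * w) \<noteq> 0}"
      unfolding mittag_leffler_integrand_def by (intro holomorphic_intros) auto
    have int: "hankel_integrable 0 \<phi> ?G"
      by (rule hankel_integrableI[OF _ \<phi>0 mittag_leffler_integrand_measurable lines])
        (auto intro!: continuous_on_subset[OF holomorphic_on_imp_continuous_on[OF hol]] den_ne simp del: right_minus_eq)
    have "mittag_leffler \<alpha> \<beta> z = hankel_integral a \<phi> ?G / (2 * of_real pi * \<i>)"
      unfolding mittag_leffler_def using mittag_leffler_sums_hankel[OF assms(1,2) \<phi> a(2)] by (simp add: sums_iff)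
    also have "hankel_integral a \<phi> ?G = hankel_integral 0 \<phi> ?G"
      by (rule hankel_integral_shift[OF a(1) \<phi>0 hol _ int, symmetric]) (use den_ne in auto)
    finally have "norm (mittag_leffler \<alpha> \<beta> z) = norm (hankel_integral 0 \<phi> ?G) / (2 * pi)"
      by (simp add: norm_divide norm_mult)
    also have "\<dots> \<le> B / (\<kappa> * (1 + norm z)) * ?K / (2 * pi)"
      by (intro divide_right_mono norm_hankel_integral_le lines vert mittag_leffler_integrand_measurable)
        (use B nn \<phi>0 in auto)
    also have "\<dots> = (B * ?K / (2 * pi * \<kappa>)) / (1 + norm z)"
      by (simp add: field_simps)
    finally show ?thesis .
  qed
  then show ?thesis by blast
qed

section \<open>An integral representation in a strip\<close>

definition strip_kernel :: "complex \<Rightarrow> complex" where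
  "strip_kernel v = exp (1 - v) / (1 - v)"

lemma norm_strip_kernel_le:
  assumes "0 \<le> Re v" "0 < b" "b \<le> norm (1 - v)"
  shows "norm (strip_kernel v) \<le> exp 1 / b"
proof -
  have "exp (1 - Re v) / norm (1 - v) \<le> exp 1 / b"
    using assms by (intro frac_le) auto
  then show ?thesis by (simp add: strip_kernel_def norm_divide norm_exp_eq_Re)
qed

text \<open>\<open>\<bar>sin \<theta>\<bar>\<close> is the distance of \<open>1\<close> from the
  line through \<open>0\<close> in direction \<open>cis \<theta>\<close>.\<close>

lemma norm_one_minus_ge_sin:
  assumes "v = of_real r * cis \<theta>"
  shows "\<bar>sin \<theta>\<bar> \<le> norm (1 - v)"
proof (rule power2_le_imp_le)
  have "(norm (1 - v))\<^sup>2 = (1 - r * cos \<theta>)\<^sup>2 + (r * sin \<theta>)\<^sup>2"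
    unfolding cmod_power2 assms by simp
  also have "(r * sin \<theta>)\<^sup>2 = r\<^sup>2 - r\<^sup>2 * (cos \<theta>)\<^sup>2"
    by (simp add: power_mult_distrib sin_squared_eq algebra_simps)
  also have "(1 - r * cos \<theta>)\<^sup>2 + (r\<^sup>2 - r\<^sup>2 * (cos \<theta>)\<^sup>2) = (r - cos \<theta>)\<^sup>2 + (1 - (cos \<theta>)\<^sup>2)"
    by (simp add: power2_eq_square algebra_simps)
  also have "1 - (cos \<theta>)\<^sup>2 = (sin \<theta>)\<^sup>2" by (simp add: sin_squared_eq)
  finally show "\<bar>sin \<theta>\<bar>\<^sup>2 \<le> (norm (1 - v))\<^sup>2" by simp
qed simp

lemma exp_Complex_polar: "exp (Complex u v) = of_real (exp u) * cis v"
  by (simp add: complex_eq_iff Re_exp Im_exp)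

text \<open>Cauchy's formula in a strip. The factor \<open>exp (1 - v)\<close> of the kernel is \<open>1\<close> at the pole
  \<open>v = 1\<close>; it is there to make \<open>v \<mapsto> strip_kernel v\<close> rapidly decreasing along the boundary.\<close>

lemma strip_representation:
  fixes H :: "complex \<Rightarrow> complex"
  assumes hol: "H holomorphic_on UNIV" and \<delta>: "0 < \<delta>" "\<delta> < pi / 2" and m: "0 < m" and K: "0 \<le> K"
    and bound: "\<And>x y. \<bar>y\<bar> \<le> \<delta> \<Longrightarrow> norm (H (Complex x y)) \<le> K * exp (- m * \<bar>x\<bar>)"
  shows "2 * of_real pi * \<i> * H (of_real t) =
    (LINT x|lborel. H (Complex x (- \<delta>)) * strip_kernel (exp (of_real t - Complex x (- \<delta>))))
    - (LINT x|lborel. H (Complex x \<delta>) * strip_kernel (exp (of_real t - Complex x \<delta>)))"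
proof -
  define f where "f w = H w * strip_kernel (exp (of_real t - w))" for w
  \<comment> \<open>This open strip contains the closed strip of half-width \<delta>, and among the
    solutions of \<open>exp (t - w) = 1\<close>, which differ by multiples of
    \<open>2 * pi * \<i>\<close>, it contains only \<open>w = t\<close>.\<close>
  define S where "S = {w. - (pi / 2) < Im w \<and> Im w < pi / 2}"
  have S: "open S" "connected S"
  proof -
    have eq: "S = {w. - (pi / 2) < Im w} \<inter> {w. Im w < pi / 2}" by (auto simp: S_def)
    then have "open S \<and> convex S"
      unfolding eq
      by (intro conjI open_Int open_halfspace_Im_gt open_halfspace_Im_lt convex_Int convex_halfspace_Im_gt convex_halfspace_Im_lt)
    then show "open S" "connected S" by (auto intro: convex_connected)
  qed
  have tS: "of_real t \<in> S" by (simp add: S_def)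
  have pole: "exp (of_real t - w) = 1 \<longleftrightarrow> w = of_real t" if "w \<in> S" for w
  proof
    assume "exp (of_real t - w) = 1"
    then obtain n where n: "Re (of_real t - w) = 0" "Im (of_real t - w) = of_int (2 * n) * pi"
      unfolding exp_eq_1 by blast
    have i: "of_int (2 * n) * pi = - Im w" using n(2) by simp
    have "\<bar>- Im w\<bar> < pi" using that pi_gt_zero unfolding S_def mem_Collect_eq by linarith
    then have "\<bar>of_int (2 * n) * pi\<bar> < 1 * pi" unfolding i by simp
    then have "\<bar>of_int (2 * n) :: real\<bar> < 1"
      unfolding abs_mult abs_of_pos[OF pi_gt_zero] mult_less_cancel_right_pos[OF pi_gt_zero] .
    then have "n = 0" by linarith
    then show "w = of_real t" using n by (simp add: complex_eq_iff)
  qed simp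
  have f_hol: "f holomorphic_on S - {of_real t}"
    unfolding f_def strip_kernel_def
    using pole by (intro holomorphic_intros holomorphic_on_subset[OF hol]) auto
  have res: "residue f (of_real t) = H (of_real t)"
  proof -
    define g where "g w = 1 - exp (of_real t - w)" for w :: complex
    define N where "N w = exp (1 - exp (of_real t - w))" for w :: complex
    have hg: "g holomorphic_on S" unfolding g_def by (intro holomorphic_intros)
    have hN: "N holomorphic_on S" unfolding N_def by (intro holomorphic_intros)
    have hH: "H holomorphic_on S" using hol holomorphic_on_subset by blast
    have dg: "(g has_field_derivative 1) (at (of_real t))"
      unfolding g_def by (auto intro!: derivative_eq_intros)
    have simple: "residue (\<lambda>w. F w / g w) (of_real t) = F (of_real t)"
      if "F holomorphic_on S" "F (of_real t) \<noteq> 0" for F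
      using residue_simple_pole_deriv[OF that(1) hg S tS dg that(2)] by (simp add: g_def)
    have f_eq: "f w = H w * N w / g w" for w
      by (simp add: f_def strip_kernel_def N_def g_def)
    show ?thesis
    proof (cases "H (of_real t) = 0")
      case False
      have "residue (\<lambda>w. (H w * N w) / g w) (of_real t) = H (of_real t) * N (of_real t)"
        by (rule simple) (use hH hN False in \<open>auto intro!: holomorphic_intros simp: N_def\<close>)
      then show ?thesis by (simp add: f_eq[abs_def] N_def)
    next
      \<comment> \<open>The residue lemma excludes a vanishing numerator, so we subtract two simple poles.\<close>
      case True
      have dh: "(\<lambda>w. F w / g w) holomorphic_on S - {of_real t}" if "F holomorphic_on S" for F
      proof (intro holomorphic_on_divide)
        show "F holomorphic_on S - {of_real t}" "g holomorphic_on S - {of_real t}"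
          using that hg by (auto intro: holomorphic_on_subset)
        show "g w \<noteq> 0" if "w \<in> S - {of_real t}" for w
          using pole[of w] that by (auto simp: g_def)
      qed
      have hF: "(\<lambda>w. H w * N w + 1) holomorphic_on S" using hH hN by (intro holomorphic_intros)
      have "f = (\<lambda>w. (H w * N w + 1) / g w - 1 / g w)"
        by (simp add: f_eq fun_eq_iff add_divide_distrib)
      then have "residue f (of_real t) = residue (\<lambda>w. (H w * N w + 1) / g w - 1 / g w) (of_real t)" by simp
      also have "\<dots> = residue (\<lambda>w. (H w * N w + 1) / g w) (of_real t) - residue (\<lambda>w. 1 / g w) (of_real t)"
        by (rule residue_diff[OF S(1) tS dh[OF hF] dh]) (intro holomorphic_intros)
      also have "residue (\<lambda>w. (H w * N w + 1) / g w) (of_real t) = 1"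
        using simple[OF hF] True by simp
      also have "residue (\<lambda>w. 1 / g w) (of_real t) = 1"
        by (rule simple) (auto intro!: holomorphic_intros)
      finally show ?thesis using True by simp
    qed
  qed
  have cos_pos: "0 \<le> cos y" if "\<bar>y\<bar> \<le> \<delta>" for y
    using that \<delta> by (intro cos_ge_zero) auto
  have E: "exp (of_real t - Complex x y) = of_real (exp (t - x)) * cis (- y)" for x y
  proof -
    have "of_real t - Complex x y = Complex (t - x) (- y)" by (simp add: complex_eq_iff)
    then show ?thesis by (simp only: exp_Complex_polar)
  qed
  have ReE: "0 \<le> Re (exp (of_real t - Complex x y))" if "\<bar>y\<bar> \<le> \<delta>" for x y
    unfolding E using cos_pos[OF that] by simp
  have sin\<delta>: "0 < sin \<delta>" using \<delta> by (intro sin_gt_zero) auto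
  have line: "norm (f (Complex x y)) \<le> exp 1 / sin \<delta> * K * exp (- m * \<bar>x\<bar>)" if y: "\<bar>y\<bar> = \<delta>" for x y
  proof -
    have "sin \<delta> \<le> \<bar>sin (- y)\<bar>" using y by (cases "0 \<le> y") auto
    also have "\<dots> \<le> norm (1 - exp (of_real t - Complex x y))"
      by (rule norm_one_minus_ge_sin[OF E])
    finally have "norm (strip_kernel (exp (of_real t - Complex x y))) \<le> exp 1 / sin \<delta>"
      using y by (intro norm_strip_kernel_le ReE sin\<delta>) auto
    then have "norm (H (Complex x y)) * norm (strip_kernel (exp (of_real t - Complex x y))) \<le>
        (K * exp (- m * \<bar>x\<bar>)) * (exp 1 / sin \<delta>)"
      using bound[of y x] y K by (intro mult_mono) auto
    then show ?thesis by (simp add: f_def norm_mult mult_ac)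
  qed
  \<comment> \<open>Inside the strip the pole has to be avoided. At horizontal distance
    \<open>1\<close> from it the exponential already has modulus at least \<open>2\<close> or at
    most \<open>1 / 2\<close>, and only distant vertical sides matter.\<close>
  have vert: "norm (f (Complex x y)) \<le> 2 * exp 1 * K * exp (- m * \<bar>x\<bar>)" if y: "\<bar>y\<bar> \<le> \<delta>" and x: "1 \<le> \<bar>t - x\<bar>" for x y
  proof -
    have nE: "norm (exp (of_real t - Complex x y)) = exp (t - x)"
      unfolding E by (simp add: norm_mult)
    have "1 / 2 \<le> \<bar>1 - exp (t - x)\<bar>"
    proof (cases "1 \<le> t - x")
      case True
      have "2 \<le> exp (t - x)" using exp_ge_add_one_self[of "t - x"] True by linarith
      then show ?thesis by linarith
    next
      case False
      then have "2 \<le> exp (x - t)" using exp_ge_add_one_self[of "x - t"] x by linarith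
      then have "inverse (exp (x - t)) \<le> inverse 2" by (intro le_imp_inverse_le) auto
      then have "exp (t - x) \<le> 1 / 2" by (simp add: exp_minus[symmetric])
      then show ?thesis by linarith
    qed
    also have "\<dots> \<le> norm (1 - exp (of_real t - Complex x y))"
      using norm_triangle_ineq3[of 1 "exp (of_real t - Complex x y)"] nE by simp
    finally have "norm (strip_kernel (exp (of_real t - Complex x y))) \<le> exp 1 / (1 / 2)"
      by (intro norm_strip_kernel_le ReE y) auto
    then have "norm (H (Complex x y)) * norm (strip_kernel (exp (of_real t - Complex x y))) \<le>
        (K * exp (- m * \<bar>x\<bar>)) * (exp 1 / (1 / 2))"
      using bound[OF y, of x] K by (intro mult_mono) auto
    then show ?thesis by (simp add: f_def norm_mult mult_ac)
  qed
  have H_meas: "(\<lambda>x. H (Complex x y)) \<in> borel_measurable borel" for y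
    unfolding Complex_eq
    by (intro borel_measurable_continuous_onI continuous_on_compose2[OF holomorphic_on_imp_continuous_on[OF hol]] continuous_intros) auto
  then have f_meas [measurable]: "(\<lambda>x. f (Complex x y)) \<in> borel_measurable borel" for y
  proof -
    note [measurable] = H_meas
    have "(\<lambda>x. H (Complex x y) * strip_kernel (exp (of_real t - (of_real x + \<i> * of_real y)))) \<in> borel_measurable borel"
      unfolding strip_kernel_def by measurable
    then show ?thesis by (simp add: f_def Complex_eq)
  qed
  have int: "integrable lborel (\<lambda>x. f (Complex x y))" if y: "\<bar>y\<bar> = \<delta>" for y
  proof (rule Bochner_Integration.integrable_bound)
    show "integrable lborel (\<lambda>x. exp 1 / sin \<delta> * K * exp (- m * \<bar>x\<bar>))"
      by (intro integrable_mult_right integrable_exp_neg_abs m)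
    show "AE x in lborel. norm (f (Complex x y)) \<le> norm (exp 1 / sin \<delta> * K * exp (- m * \<bar>x\<bar>))"
      using line[OF y] by (intro AE_I2) (metis abs_ge_self order.trans real_norm_def)
  qed measurable
  let ?V = "\<lambda>x. integral {- \<delta>..\<delta>} (\<lambda>y. f (Complex x y))"
  have limM: "((\<lambda>x. 2 * exp 1 * K * exp (- m * \<bar>x\<bar>)) \<longlongrightarrow> 0) F" if "((\<lambda>x. exp (- m * \<bar>x\<bar>)) \<longlongrightarrow> 0) F" for F
    using tendsto_mult_left[OF that, of "2 * exp 1 * K"] by simp
  have V_top: "(?V \<longlongrightarrow> 0) at_top"
  proof (rule tendsto_vertical_integral)
    show "\<forall>\<^sub>F x in at_top. \<forall>y\<in>{- \<delta>..\<delta>}. norm (f (Complex x y)) \<le> 2 * exp 1 * K * exp (- m * \<bar>x\<bar>)"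
      using eventually_ge_at_top[of "t + 1"] by eventually_elim (intro ballI vert, auto)
  qed (use \<delta> limM[OF tendsto_exp_neg_abs(1)[OF m]] in auto)
  have V_bot: "(?V \<longlongrightarrow> 0) at_bot"
  proof (rule tendsto_vertical_integral)
    show "\<forall>\<^sub>F x in at_bot. \<forall>y\<in>{- \<delta>..\<delta>}. norm (f (Complex x y)) \<le> 2 * exp 1 * K * exp (- m * \<bar>x\<bar>)"
      using eventually_le_at_bot[of "t - 1"] by eventually_elim (intro ballI vert, auto)
  qed (use \<delta> limM[OF tendsto_exp_neg_abs(2)[OF m]] in auto)
  have top: "filterlim real at_top sequentially" and bot: "filterlim (\<lambda>n. - real n) at_bot sequentially"
    by (auto simp: filterlim_real_sequentially filterlim_uminus_at_top[symmetric])
  define L where "L n = integral {- real n..real n} (\<lambda>x. f (Complex x (- \<delta>))) + \<i> * ?V (real n)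
      - integral {- real n..real n} (\<lambda>x. f (Complex x \<delta>)) - \<i> * ?V (- real n)" for n
  have "L \<longlonglongrightarrow> (LINT x|lborel. f (Complex x (- \<delta>))) + \<i> * 0 - (LINT x|lborel. f (Complex x \<delta>)) - \<i> * 0"
    unfolding L_def
    by (rule tendsto_intros tendsto_integral_symmetric int filterlim_compose[OF V_top top]
        filterlim_compose[OF V_bot bot] | use \<delta> in force)+
  moreover have "\<forall>\<^sub>F n in sequentially. L n = 2 * pi * \<i> * H (of_real t)"
    using eventually_gt_at_top[of "nat \<lceil>\<bar>t\<bar>\<rceil>"]
  proof eventually_elim
    case (elim n)
    then have "\<bar>t\<bar> < real n" by linarith
    then have "L n = 2 * pi * \<i> * residue f (of_real t)"
      unfolding L_def
      by (intro residue_rectangle[OF _ _ _ _ f_hol S]) (use \<delta> in \<open>auto simp: S_def\<close>)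
    then show ?case unfolding res .
  qed
  then have "L \<longlonglongrightarrow> 2 * pi * \<i> * H (of_real t)"
    by (rule tendsto_eventually)
  ultimately have "(LINT x|lborel. f (Complex x (- \<delta>))) - (LINT x|lborel. f (Complex x \<delta>)) = 2 * pi * \<i> * H (of_real t)"
    using LIMSEQ_unique by fastforce
  then show ?thesis by (simp add: f_def)
qed

section \<open>Boundary terms as Gaussian superpositions\<close>

lemma
  fixes a :: complex
  assumes "0 < Re a"
  shows set_integrable_exp_neg_complex: "set_integrable lborel {0..} (\<lambda>t. exp (- a * of_real t))"
    and integral_exp_neg_complex: "(LINT t:{0..}|lborel. exp (- a * of_real t)) = 1 / a"
proof -
  have a: "a \<noteq> 0" using assms by auto
  have norm: "norm (exp (- a * of_real t)) = exp (- Re a * t)" for t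
    by (simp add: norm_exp_eq_Re)
  show si: "set_integrable lborel {0..} (\<lambda>t. exp (- a * of_real t))"
    unfolding set_integrable_def
  proof (rule Bochner_Integration.integrable_bound[OF integrable_exp_neg_abs[OF assms]])
    show "AE t in lborel. norm (indicat_real {0..} t *\<^sub>R exp (- a * of_real t)) \<le> norm (exp (- Re a * \<bar>t\<bar>))"
      unfolding norm_scaleR norm by (intro AE_I2) (auto simp: indicator_def)
  qed measurable
  have lim: "((\<lambda>t. - exp (- a * of_real t) / a) \<longlongrightarrow> 0) at_top"
  proof (rule Lim_null_comparison)
    show "\<forall>\<^sub>F t in at_top. norm (- exp (- a * of_real t) / a) \<le> exp (- Re a * \<bar>t\<bar>) * (1 / norm a)"
      using eventually_ge_at_top[of 0] by eventually_elim (simp add: norm_divide norm)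
    show "((\<lambda>t. exp (- Re a * \<bar>t\<bar>) * (1 / norm a)) \<longlongrightarrow> 0) at_top"
      using tendsto_mult_right[OF tendsto_exp_neg_abs(1)[OF assms], of "1 / norm a"] by simp
  qed
  have "filterlim (\<lambda>n. 0 + real n) at_top sequentially"
    by (simp add: filterlim_real_sequentially)
  from tendsto_diff[OF filterlim_compose[OF lim this] tendsto_const]
  have "(\<lambda>n. - exp (- a * of_real (0 + real n)) / a - (- 1 / a)) \<longlonglongrightarrow> 0 - (- 1 / a)" .
  moreover have "integral {0..0 + real n} (\<lambda>t. exp (- a * of_real t)) = - exp (- a * of_real (0 + real n)) / a - (- 1 / a)" for n
  proof -
    have "((\<lambda>t. exp (- a * of_real t)) has_integral (- exp (- a * of_real (0 + real n)) / a - (- exp (- a * of_real 0) / a))) {0..0 + real n}"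
    proof (rule fundamental_theorem_of_calculus)
      fix t :: real
      have "((\<lambda>z. - exp (- a * z) / a) has_field_derivative exp (- a * of_real t)) (at (of_real t))"
        using a by (auto intro!: derivative_eq_intros)
      from has_vector_derivative_real_field[OF this]
      show "((\<lambda>t. - exp (- a * of_real t) / a) has_vector_derivative exp (- a * of_real t)) (at t within {0..0 + real n})"
        by (simp add: has_vector_derivative_at_within)
    qed simp
    then show ?thesis by (simp add: integral_unique)
  qed
  ultimately show "(LINT t:{0..}|lborel. exp (- a * of_real t)) = 1 / a"
    using tendsto_integral_atLeast[OF si] LIMSEQ_unique by fastforce
qed

text \<open>A single Gaussian is a superposition over a one-point measure space; this handles the
  subtracted term.\<close>

lemma fourier_repr_gaussian:
  assumes q: "p = \<infinity> \<and> q = real CARD('n) / 2 \<or>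
      (\<exists>P>1. p = ennreal P \<and> q = real CARD('n) / 2 * (1 - 1 / P))"
  shows "fourier_repr p (\<lambda>x::real^'n::finite. c * exp (- of_real ((norm x)\<^sup>2)))"
proof -
  have "fourier_repr p (\<lambda>x::real^'n. LINT w|count_space (UNIV :: unit set). c * exp (- 1 * of_real ((norm x)\<^sup>2)))"
    by (rule fourier_repr_gaussian_superposition[where c = 1 and q = q])
      (use q in \<open>auto intro: sigma_finite_measure_count_space_finite simp: integrable_count_space\<close>)
  then show ?thesis
    by (simp add: lebesgue_integral_count_space_finite)
qed

lemma integrable_exp_neg_abs_prod:
  assumes "0 < a" "0 < b"
  shows "integrable (lborel \<Otimes>\<^sub>M lborel) (\<lambda>(u, t). exp (- a * \<bar>u::real\<bar>) * exp (- b * \<bar>t::real\<bar>))"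
proof (rule lborel_pair.Fubini_integrable)
  show "integrable lborel (\<lambda>u::real. LINT t|lborel. norm (case (u, t) of (u, t) \<Rightarrow> exp (- a * \<bar>u\<bar>) * exp (- b * \<bar>t\<bar>)))"
    using integrable_exp_neg_abs[OF assms(1)] by (simp add: abs_mult)
  show "AE u in lborel. integrable lborel (\<lambda>t. case (u, t) of (u, t) \<Rightarrow> exp (- a * \<bar>u::real\<bar>) * exp (- b * \<bar>t::real\<bar>))"
    using integrable_exp_neg_abs[OF assms(2)] by simp
qed measurable

text \<open>On a ray, \<open>strip_kernel v = - \<kappa> \<integral> exp (1 + \<tau> \<kappa> - (1 + \<tau> \<kappa>) v) d\<tau>\<close> over \<open>\<tau> \<ge> 0\<close>, with the
  direction \<open>\<kappa>\<close> chosen so that both \<open>Re (\<kappa> v) > 0\<close> and \<open>Re \<kappa> < 0\<close>.\<close>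

lemma fourier_repr_boundary_term:
  fixes H :: "complex \<Rightarrow> complex"
  assumes hol: "H holomorphic_on UNIV" and \<delta>: "0 < \<delta>" "\<delta> < pi / 2" and y: "\<bar>y\<bar> = \<delta>"
    and rates: "0 < m" "q < l" "0 \<le> q" and K: "0 \<le> K"
    and bound: "\<And>u. norm (H (Complex u y)) \<le> K * exp (- l * u)" "\<And>u. norm (H (Complex u y)) \<le> K * exp (m * u)"
    and q: "p = \<infinity> \<and> q = real CARD('n) / 2 \<or>
      (\<exists>P>1. p = ennreal P \<and> q = real CARD('n) / 2 * (1 - 1 / P))"
  obtains T :: "real^'n::finite \<Rightarrow> complex" where "fourier_repr p T" "T \<in> borel_measurable borel"
    "\<And>x. x \<noteq> 0 \<Longrightarrow> T x = c * (LINT u|lborel. H (Complex u y) * strip_kernel (exp (of_real (2 * ln (norm x)) - Complex u y)))"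
proof -
  \<comment> \<open>Up to the sign of \<open>y\<close>, the admissible angles lie between
    \<open>pi / 2\<close> (for \<open>Re \<kappa> < 0\<close>) and \<open>pi / 2 + \<delta>\<close>
    (for \<open>Re (\<kappa> * cis (- y)) > 0\<close>). The midpoint gives both conditions the same
    margin \<open>sin (\<delta> / 2)\<close>.\<close>
  define \<kappa> where "\<kappa> = cis (sgn y * (pi / 2 + \<delta> / 2))"
  define s1 where "s1 = sin (\<delta> / 2)"
  \<comment> \<open>The sector constant: \<open>Re z\<close> has a part \<open>cos \<delta>\<close>
    from the start of the ray and a part \<open>s1\<close> per unit along it.\<close>
  define s0 where "s0 = min (cos \<delta>) s1"
  have s1: "0 < s1" unfolding s1_def using \<delta> by (intro sin_gt_zero) auto
  have "0 < cos \<delta>" using \<delta> by (intro cos_gt_zero_pi) auto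
  then have s0: "0 < s0" "s0 \<le> cos \<delta>" "s0 \<le> s1" using s1 by (auto simp: s0_def)
  have ysgn: "sgn y = 1 \<and> y = \<delta> \<or> sgn y = - 1 \<and> y = - \<delta>"
    using y \<delta> by (auto simp: sgn_if)
  have cosy: "cos y = cos \<delta>" using ysgn by auto
  have even: "cos (sgn y * a) = cos a" for a
    using ysgn by (elim disjE conjE) (auto simp only: mult_1 mult_minus1 cos_minus)
  have Re\<kappa>: "Re \<kappa> = - s1"
    unfolding \<kappa>_def s1_def cis.sel even by (simp add: cos_add)
  have "\<kappa> * cis (- y) = cis (sgn y * (pi / 2 - \<delta> / 2))"
    unfolding \<kappa>_def cis_mult using ysgn by (auto simp: algebra_simps)
  then have Re\<kappa>y: "Re (\<kappa> * cis (- y)) = s1"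
    unfolding s1_def by (simp only: cis.sel even) (simp add: cos_diff)
  have norm\<kappa>: "norm \<kappa> = 1" by (simp add: \<kappa>_def)
  have \<kappa>0: "\<kappa> \<noteq> 0" using norm\<kappa> by auto
  \<comment> \<open>The superposition is indexed by the whole plane. The absolute value of
    \<open>t\<close> keeps \<open>z\<close> in the sector for negative \<open>t\<close> as well,
    while the indicator in \<open>h\<close> confines the integral to
    \<open>t \<ge> 0\<close>.\<close>
  define z where "z = (\<lambda>(u, t). of_real (exp (- u)) * (cis (- y) * (1 + of_real \<bar>t\<bar> * \<kappa>)))"
  define h where "h = (\<lambda>(u, t). c * H (Complex u y) * of_real (indicator {0..} t) * (- exp 1 * \<kappa> * exp (of_real t * \<kappa>)))"
  have Rez: "Re (z (u, t)) = exp (- u) * (cos \<delta> + \<bar>t\<bar> * s1)" for u t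
  proof -
    have "z (u, t) = of_real (exp (- u)) * (cis (- y) + of_real \<bar>t\<bar> * (\<kappa> * cis (- y)))"
      by (simp add: z_def algebra_simps)
    then show ?thesis using Re\<kappa>y cosy by simp
  qed
  have Rez_ge: "s0 * (exp (- u) * (1 + \<bar>t\<bar>)) \<le> Re (z (u, t))" for u t
  proof -
    have "s0 * (1 + \<bar>t\<bar>) \<le> cos \<delta> + \<bar>t\<bar> * s1"
      using s0 mult_left_mono[OF s0(3), of "\<bar>t\<bar>"] by (simp add: algebra_simps)
    then have "exp (- u) * (s0 * (1 + \<bar>t\<bar>)) \<le> exp (- u) * (cos \<delta> + \<bar>t\<bar> * s1)"
      by (intro mult_left_mono) auto
    then show ?thesis unfolding Rez by (simp add: mult_ac)
  qed
  have z_le: "norm (z (u, t)) \<le> exp (- u) * (1 + \<bar>t\<bar>)" for u t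
  proof -
    have "norm (1 + of_real \<bar>t\<bar> * \<kappa>) \<le> 1 + \<bar>t\<bar>"
      by (rule order.trans[OF norm_triangle_ineq]) (simp add: norm_mult norm\<kappa>)
    then show ?thesis by (simp add: z_def norm_mult)
  qed
  have z_ge: "s0 * exp (- u) \<le> norm (z (u, t))" for u t
  proof -
    have "s0 * (exp (- u) * 1) \<le> s0 * (exp (- u) * (1 + \<bar>t\<bar>))"
      using s0 by (intro mult_left_mono) auto
    also have "\<dots> \<le> norm (z (u, t))"
      using Rez_ge complex_Re_le_cmod order.trans by blast
    finally show ?thesis by simp
  qed
  have z_pos: "0 < norm (z (u, t))" for u t
  proof -
    have "0 < s0 * exp (- u)" using s0(1) by simp
    then show ?thesis using z_ge by (rule less_le_trans)
  qed
  have z1: "z w \<noteq> 0" for w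
  proof (cases w)
    case (Pair u t)
    show ?thesis unfolding Pair using z_pos[of u t] by (simp only: zero_less_norm_iff not_False_eq_True)
  qed
  have z2: "s0 * norm (z w) \<le> Re (z w)" for w
  proof (cases w)
    case (Pair u t)
    have "s0 * norm (z (u, t)) \<le> s0 * (exp (- u) * (1 + \<bar>t\<bar>))"
      using s0 by (intro mult_left_mono z_le) auto
    also have "\<dots> \<le> Re (z (u, t))" by (rule Rez_ge)
    finally show ?thesis using Pair by simp
  qed
  have H_meas [measurable]: "(\<lambda>u. H (Complex u y)) \<in> borel_measurable borel"
    unfolding Complex_eq
    by (intro borel_measurable_continuous_onI continuous_on_compose2[OF holomorphic_on_imp_continuous_on[OF hol]] continuous_intros) auto
  have [measurable]: "z \<in> borel_measurable (lborel \<Otimes>\<^sub>M lborel)" "h \<in> borel_measurable (lborel \<Otimes>\<^sub>M lborel)"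
    unfolding z_def h_def by measurable
  define D where "D = norm c * exp 1"
  have D: "0 \<le> D" by (simp add: D_def)
  have h_le: "norm (h (u, t)) \<le> D * norm (H (Complex u y)) * exp (- s1 * \<bar>t\<bar>)" for u t
  proof -
    have "Re (of_real t * \<kappa>) = - s1 * t" by (simp add: Re\<kappa>)
    then show ?thesis
      by (auto simp: h_def D_def norm_mult norm\<kappa> norm_exp_eq_Re indicator_def)
  qed
  \<comment> \<open>On the right the weight \<open>exp (q * u)\<close> lowers the rate
    \<open>l\<close> to \<open>l - q\<close>, which is where \<open>q < l\<close> is spent; on the
    left it only helps, and the rate \<open>m\<close> remains.\<close>
  define m1 where "m1 = min (l - q) m"
  have m1: "0 < m1" using rates by (simp add: m1_def)
  have decay: "K * exp (- l * u) * exp (r * u) \<le> K * exp (- m1 * \<bar>u\<bar>)" if "0 \<le> u" "r \<le> q" for u r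
  proof -
    have "m1 * u \<le> (l - r) * u" using that by (intro mult_right_mono) (auto simp: m1_def)
    then have "- l * u + r * u \<le> - m1 * \<bar>u\<bar>" using that by (simp add: algebra_simps)
    then show ?thesis using K unfolding mult.assoc exp_add[symmetric] by (intro mult_left_mono) auto
  qed
  have decay': "K * exp (m * u) * exp (r * u) \<le> K * exp (- m1 * \<bar>u\<bar>)" if "u \<le> 0" "0 \<le> r" for u r
  proof -
    have "(m + r) * u \<le> m1 * u" using that by (intro mult_right_mono_neg) (auto simp: m1_def)
    then have "m * u + r * u \<le> - m1 * \<bar>u\<bar>" using that by (simp add: algebra_simps)
    then show ?thesis using K unfolding mult.assoc exp_add[symmetric] by (intro mult_left_mono) auto
  qed
  have H_le: "norm (H (Complex u y)) * exp (r * u) \<le> K * exp (- m1 * \<bar>u\<bar>)" if "0 \<le> r" "r \<le> q" for u r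
  proof (cases "0 \<le> u")
    case True
    have "norm (H (Complex u y)) * exp (r * u) \<le> K * exp (- l * u) * exp (r * u)"
      using bound(1) by (rule mult_right_mono) simp
    also have "\<dots> \<le> K * exp (- m1 * \<bar>u\<bar>)" by (rule decay) fact+
    finally show ?thesis .
  next
    case False
    have "norm (H (Complex u y)) * exp (r * u) \<le> K * exp (m * u) * exp (r * u)"
      using bound(2) by (rule mult_right_mono) simp
    also have "\<dots> \<le> K * exp (- m1 * \<bar>u\<bar>)" using False that by (intro decay') auto
    finally show ?thesis .
  qed
  have hz_le: "norm (h (u, t)) * exp (r * u) \<le> D * K * (exp (- m1 * \<bar>u\<bar>) * exp (- s1 * \<bar>t\<bar>))"
    if "0 \<le> r" "r \<le> q" for u t r
  proof -
    have "norm (h (u, t)) * exp (r * u) \<le> D * norm (H (Complex u y)) * exp (- s1 * \<bar>t\<bar>) * exp (r * u)"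
      by (intro mult_right_mono h_le) auto
    also have "\<dots> = D * exp (- s1 * \<bar>t\<bar>) * (norm (H (Complex u y)) * exp (r * u))" by simp
    also have "\<dots> \<le> D * exp (- s1 * \<bar>t\<bar>) * (K * exp (- m1 * \<bar>u\<bar>))"
      using D by (intro mult_left_mono H_le that) auto
    finally show ?thesis by (simp add: mult_ac)
  qed
  have major: "integrable (lborel \<Otimes>\<^sub>M lborel) (\<lambda>(u, t). A * (exp (- m1 * \<bar>u\<bar>) * exp (- s1 * \<bar>t\<bar>)))" for A :: real
    using integrable_mult_right[OF integrable_exp_neg_abs_prod[OF m1 s1], of A] by (simp add: split_beta')
  have h_int: "integrable (lborel \<Otimes>\<^sub>M lborel) h"
  proof (rule Bochner_Integration.integrable_bound[OF major[of "D * K"]])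
    show "AE w in lborel \<Otimes>\<^sub>M lborel. norm (h w) \<le> norm (case w of (u, t) \<Rightarrow> D * K * (exp (- m1 * \<bar>u\<bar>) * exp (- s1 * \<bar>t\<bar>)))"
    proof (rule AE_I2)
      fix w :: "real \<times> real"
      show "norm (h w) \<le> norm (case w of (u, t) \<Rightarrow> D * K * (exp (- m1 * \<bar>u\<bar>) * exp (- s1 * \<bar>t\<bar>)))"
        using hz_le[of 0 "fst w" "snd w"] rates K D by (cases w) (simp add: abs_mult)
    qed
  qed measurable
  have hz_int: "integrable (lborel \<Otimes>\<^sub>M lborel) (\<lambda>w. norm (h w) * norm (z w) powr (- q))"
  proof (rule Bochner_Integration.integrable_bound[OF major[of "s0 powr (- q) * (D * K)"]])
    show "AE w in lborel \<Otimes>\<^sub>M lborel. norm (norm (h w) * norm (z w) powr (- q)) \<le>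
        norm (case w of (u, t) \<Rightarrow> s0 powr (- q) * (D * K) * (exp (- m1 * \<bar>u\<bar>) * exp (- s1 * \<bar>t\<bar>)))"
    proof (rule AE_I2)
      fix w :: "real \<times> real"
      obtain u t where w: "w = (u, t)" by (cases w)
      have "norm (z (u, t)) powr (- q) \<le> (s0 * exp (- u)) powr (- q)"
        using s0 rates by (intro powr_mono2' z_ge) auto
      also have "\<dots> = s0 powr (- q) * exp (q * u)"
        by (simp add: powr_mult exp_powr_real)
      finally have "norm (h (u, t)) * norm (z (u, t)) powr (- q) \<le> norm (h (u, t)) * (s0 powr (- q) * exp (q * u))"
        by (rule mult_left_mono) simp
      also have "\<dots> = s0 powr (- q) * (norm (h (u, t)) * exp (q * u))" by simp
      also have "\<dots> \<le> s0 powr (- q) * (D * K * (exp (- m1 * \<bar>u\<bar>) * exp (- s1 * \<bar>t\<bar>)))"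
        using rates by (intro mult_left_mono hz_le) auto
      finally show "norm (norm (h w) * norm (z w) powr (- q)) \<le>
          norm (case w of (u, t) \<Rightarrow> s0 powr (- q) * (D * K) * (exp (- m1 * \<bar>u\<bar>) * exp (- s1 * \<bar>t\<bar>)))"
        using K D by (simp add: w abs_mult mult_ac)
    qed
  qed measurable
  define T where "T x = (LINT w|(lborel \<Otimes>\<^sub>M lborel). h w * exp (- z w * of_real ((norm x)\<^sup>2)))" for x :: "real^'n"
  have sf: "sigma_finite_measure (lborel \<Otimes>\<^sub>M lborel :: (real \<times> real) measure)"
    unfolding lborel_prod by (rule sigma_finite_lborel)
  show ?thesis
  proof (rule that[of T])
    show "fourier_repr p T"
      unfolding T_def
      by (rule fourier_repr_gaussian_superposition[OF sf _ s0(1) z1 z2 h_int hz_int q]) measurable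
    have "T \<in> borel_measurable lborel"
      unfolding T_def by (rule sigma_finite_measure.borel_measurable_lebesgue_integral[OF sf]) measurable
    then show "T \<in> borel_measurable borel" by simp
    fix x :: "real^'n" assume x: "x \<noteq> 0"
    define \<rho> where "\<rho> = (norm x)\<^sup>2"
    have \<rho>: "0 < \<rho>" using x by (simp add: \<rho>_def)
    define v where "v u = exp (of_real (2 * ln (norm x)) - Complex u y)" for u
    have v: "v u = of_real (\<rho> * exp (- u)) * cis (- y)" for u
    proof -
      have "of_real (2 * ln (norm x)) - Complex u y = Complex (2 * ln (norm x) + - u) (- y)"
        by (simp add: complex_eq_iff)
      moreover have "exp (2 * ln (norm x)) = \<rho>"
        using x by (simp add: \<rho>_def exp_double)
      ultimately show ?thesis unfolding v_def by (simp only: exp_Complex_polar exp_add)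
    qed
    have "integrable (lborel \<Otimes>\<^sub>M lborel) (\<lambda>w. h w * exp (- z w * of_real \<rho>))"
    proof (rule Bochner_Integration.integrable_bound[OF h_int])
      have "norm (exp (- z w * of_real \<rho>)) \<le> 1" for w
      proof -
        have "0 \<le> s0 * norm (z w)" using s0 by simp
        then have "0 \<le> Re (z w)" using z2[of w] by linarith
        then show ?thesis using \<rho> by (simp add: norm_exp_eq_Re)
      qed
      then show "AE w in lborel \<Otimes>\<^sub>M lborel. norm (h w * exp (- z w * of_real \<rho>)) \<le> norm (h w)"
        unfolding norm_mult by (intro AE_I2 mult_right_le_one_le) auto
    qed measurable
    from lborel_pair.integral_fst'[OF this]
    have "T x = (LINT u|lborel. LINT t|lborel. h (u, t) * exp (- z (u, t) * of_real \<rho>))"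
      unfolding T_def \<rho>_def by simp
    also have "(\<lambda>u. LINT t|lborel. h (u, t) * exp (- z (u, t) * of_real \<rho>)) = (\<lambda>u. c * (H (Complex u y) * strip_kernel (v u)))"
    proof
      fix u
      \<comment> \<open>The rate of the exponential in \<open>t\<close>. The two sign conditions on
        \<kappa> both contribute positively to its real part, which also shows
        \<open>v u \<noteq> 1\<close>.\<close>
      let ?a = "\<kappa> * (v u - 1)"
      have "?a = of_real (\<rho> * exp (- u)) * (\<kappa> * cis (- y)) - \<kappa>"
        unfolding v by (simp add: algebra_simps)
      then have "Re ?a = \<rho> * exp (- u) * s1 + s1"
        using Re\<kappa>y Re\<kappa> by simp
      then have a: "0 < Re ?a" using \<rho> s1 by (simp add: add_pos_pos)
      then have v1: "v u \<noteq> 1" by auto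
      have "h (u, t) * exp (- z (u, t) * of_real \<rho>) =
          (c * H (Complex u y) * (- exp 1 * \<kappa>) * exp (- v u)) * (indicat_real {0..} t *\<^sub>R exp (- ?a * of_real t))" for t
      proof (cases "0 \<le> t")
        case True
        then have "exp (of_real t * \<kappa>) * exp (- z (u, t) * of_real \<rho>) = exp (- v u) * exp (- ?a * of_real t)"
          unfolding exp_add[symmetric] z_def v by (simp add: algebra_simps)
        with True show ?thesis by (simp add: h_def)
      qed (simp add: h_def)
      then have "(LINT t|lborel. h (u, t) * exp (- z (u, t) * of_real \<rho>)) =
          (c * H (Complex u y) * (- exp 1 * \<kappa>) * exp (- v u)) * (LINT t:{0..}|lborel. exp (- ?a * of_real t))"
        unfolding set_lebesgue_integral_def by (simp only: integral_mult_right_zero)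
      also have "(LINT t:{0..}|lborel. exp (- ?a * of_real t)) = 1 / ?a"
        by (rule integral_exp_neg_complex[OF a])
      also have "(c * H (Complex u y) * (- exp 1 * \<kappa>) * exp (- v u)) * (1 / ?a) = c * (H (Complex u y) * strip_kernel (v u))"
        using \<kappa>0 v1 by (simp add: strip_kernel_def exp_diff exp_minus divide_simps) (simp add: algebra_simps)
      finally show "(LINT t|lborel. h (u, t) * exp (- z (u, t) * of_real \<rho>)) = c * (H (Complex u y) * strip_kernel (v u))" .
    qed
    finally show "T x = c * (LINT u|lborel. H (Complex u y) * strip_kernel (exp (of_real (2 * ln (norm x)) - Complex u y)))"
      by (simp add: v_def)
  qed
qed

section \<open>The Fourier transform of the Mittag-Leffler function\<close>

text \<open>Up to sign, the angle \<open>pi * s + u\<close> lies between \<epsilon> and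
  \<open>2 * pi - \<epsilon>\<close>, hence at distance at least \<epsilon> from the multiples of
  \<open>2 * pi\<close>, where the cosine is \<open>1\<close>.\<close>

lemma cos_le_of_margin:
  assumes "\<bar>u\<bar> \<le> pi * \<bar>s\<bar> - \<epsilon>" "\<bar>s\<bar> \<le> 1" "0 \<le> \<epsilon>"
  shows "cos (pi * s + u) \<le> cos \<epsilon>"
proof -
  have le: "cos \<theta> \<le> cos \<epsilon>" if "\<epsilon> \<le> \<theta>" "\<theta> \<le> 2 * pi - \<epsilon>" for \<theta>
  proof (cases "\<theta> \<le> pi")
    case True
    then show ?thesis using that assms by (intro cos_monotone_0_pi_le) auto
  next
    case False
    then have "cos (2 * pi - \<theta>) \<le> cos \<epsilon>"
      using that assms by (intro cos_monotone_0_pi_le) auto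
    then show ?thesis by simp
  qed
  have "pi * \<bar>s\<bar> \<le> pi * 1" using assms by (intro mult_left_mono) auto
  then have b: "pi * \<bar>s\<bar> \<le> pi" by simp
  have u: "u \<le> pi * \<bar>s\<bar> - \<epsilon>" "- u \<le> pi * \<bar>s\<bar> - \<epsilon>" using assms(1) by linarith+
  show ?thesis
  proof (cases "0 \<le> s")
    case True
    then have "pi * s = pi * \<bar>s\<bar>" by simp
    then show ?thesis using u b by (intro le) linarith+
  next
    case False
    then have "pi * s = - (pi * \<bar>s\<bar>)" by simp
    then have "cos (- (pi * s + u)) \<le> cos \<epsilon>" using u b by (intro le) linarith+
    then show ?thesis by (simp only: cos_minus)
  qed
qed

text \<open>The condition \<open>\<alpha> / 2 < \<bar>s\<bar>\<close> leaves an angular gap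
  \<open>g = pi * (\<bar>s\<bar> - \<alpha> / 2)\<close>. At most a quarter of it is spent on
  opening \<phi> beyond \<open>pi / 2\<close> (so that Hankel's integral converges) and a quarter on
  the width of the strip; the remaining half is the margin behind \<open>cos (g / 2)\<close>. The
  maximum with \<open>0\<close> supplies the sign of \<open>c\<close> needed in the law of
  cosines.\<close>

lemma sector_parameters:
  fixes \<alpha> \<gamma> s :: real
  assumes "0 < \<alpha>" "0 < \<gamma>" "\<alpha> / 2 < \<bar>s\<bar>" "\<bar>s\<bar> \<le> 1"
  obtains \<phi> \<delta> c where "pi / 2 < \<phi>" "\<phi> \<le> pi" "0 < \<delta>" "\<delta> < pi / 2" "0 \<le> c" "c < 1"
    "\<And>v y. \<bar>v\<bar> \<le> \<delta> \<Longrightarrow> \<bar>y\<bar> \<le> \<phi> \<Longrightarrow> cos (pi * s + (\<gamma> / 2 * v - \<alpha> * y)) \<le> c"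
proof -
  define g where "g = pi * \<bar>s\<bar> - pi * (\<alpha> / 2)"
  have g: "0 < g" using assms mult_strict_left_mono[OF assms(3) pi_gt_zero] by (simp add: g_def)
  define \<phi> where "\<phi> = pi / 2 + min (pi / 2) (g / (4 * \<alpha>))"
  define \<delta> where "\<delta> = min (pi / 4) (g / (2 * \<gamma>))"
  define c where "c = max 0 (cos (g / 2))"
  have "pi * \<bar>s\<bar> \<le> pi * 1" using assms by (intro mult_left_mono) auto
  then have gpi: "g \<le> pi" using assms pi_gt_zero unfolding g_def by (smt (verit) divide_pos_pos mult_pos_pos)
  have "cos (g / 2) < cos 0"
    using g gpi by (intro cos_monotone_0_pi) auto
  then have c: "0 \<le> c" "c < 1" by (auto simp: c_def)
  have "cos (pi * s + (\<gamma> / 2 * v - \<alpha> * y)) \<le> c" if v: "\<bar>v\<bar> \<le> \<delta>" and y: "\<bar>y\<bar> \<le> \<phi>" for v y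
  proof -
    have "\<gamma> / 2 * \<bar>v\<bar> \<le> \<gamma> / 2 * (g / (2 * \<gamma>))"
      using v assms unfolding \<delta>_def by (intro mult_left_mono) auto
    also have "\<dots> = g / 4" using assms by simp
    finally have 1: "\<gamma> / 2 * \<bar>v\<bar> \<le> g / 4" .
    have "\<alpha> * \<bar>y\<bar> \<le> \<alpha> * (pi / 2 + g / (4 * \<alpha>))"
      using y assms unfolding \<phi>_def by (intro mult_left_mono) auto
    also have "\<dots> = pi * (\<alpha> / 2) + g / 4" using assms by (simp add: distrib_left)
    finally have 2: "\<alpha> * \<bar>y\<bar> \<le> pi * (\<alpha> / 2) + g / 4" .
    have "\<bar>\<gamma> / 2 * v - \<alpha> * y\<bar> \<le> \<bar>\<gamma> / 2 * v\<bar> + \<bar>\<alpha> * y\<bar>" by (rule abs_triangle_ineq4)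
    also have "\<dots> = \<gamma> / 2 * \<bar>v\<bar> + \<alpha> * \<bar>y\<bar>" using assms by (simp add: abs_mult)
    also have "\<dots> \<le> pi * \<bar>s\<bar> - g / 2" using 1 2 g_def by linarith
    finally have "cos (pi * s + (\<gamma> / 2 * v - \<alpha> * y)) \<le> cos (g / 2)"
      using assms g by (intro cos_le_of_margin) auto
    then show ?thesis by (simp add: c_def)
  qed
  moreover have "pi / 2 < \<phi>" "\<phi> \<le> pi" "0 < \<delta>" "\<delta> < pi / 2"
    using g assms pi_gt_zero by (auto simp: \<phi>_def \<delta>_def min_def field_simps)
  ultimately show ?thesis using c by (intro that) auto
qed

text \<open>The two ends of the subtracted Gaussian in the strip. On the right
  \<open>cos v \<ge> cos \<delta> > 0\<close> preserves doubly exponential decay, so any rate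
  \<open>l\<close> is available; on the left the Gaussian approaches \<open>1\<close> at rate
  \<open>exp u\<close>.\<close>

lemma exp_neg_exp_bounds:
  assumes "\<bar>v\<bar> \<le> \<delta>" "0 \<le> \<delta>" "\<delta> < pi / 2" "0 < l"
  shows "norm (exp (- exp (Complex u v))) \<le> exp (l * (ln (l / cos \<delta>) - 1)) * exp (- l * u)"
    and "norm (1 - exp (- exp (Complex u v))) \<le> exp 1 * exp u"
proof -
  have cos\<delta>: "0 < cos \<delta>" using assms by (intro cos_gt_zero_pi) auto
  have cosv: "cos \<delta> \<le> cos v"
    using cos_monotone_0_pi_le[of "\<bar>v\<bar>" \<delta>] assms by simp
  have n: "norm (exp (- exp (Complex u v))) = exp (- (exp u * cos v))"
    by (simp add: norm_exp_eq_Re Re_exp)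
  have "- (exp u * cos v) \<le> - (cos \<delta> * exp u)"
    using cosv by (simp add: mult.commute)
  also have "\<dots> \<le> l * (ln (l / cos \<delta>) - 1) + - l * u"
    using linear_minus_exp_le[OF assms(4) cos\<delta>, of u] by simp
  finally show "norm (exp (- exp (Complex u v))) \<le> exp (l * (ln (l / cos \<delta>) - 1)) * exp (- l * u)"
    unfolding n exp_add[symmetric] by simp
  show "norm (1 - exp (- exp (Complex u v))) \<le> exp 1 * exp u"
  proof (cases "u \<le> 0")
    case True
    then have "norm (- exp (Complex u v)) \<le> 1" by simp
    from norm_exp_minus_one_le[OF this] show ?thesis
      by (simp add: norm_minus_commute)
  next
    case False
    have "0 \<le> exp u * cos v" using cos\<delta> cosv by simp
    then have "norm (exp (- exp (Complex u v))) \<le> 1" unfolding n by simp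
    then have "norm (1 - exp (- exp (Complex u v))) \<le> 2"
      using norm_triangle_ineq4[of 1 "exp (- exp (Complex u v))"] unfolding norm_one by linarith
    also have "\<dots> \<le> exp 1 * 1" using exp_ge_add_one_self[of 1] by simp
    also have "\<dots> \<le> exp 1 * exp u" using False by (intro mult_left_mono) auto
    finally show ?thesis .
  qed
qed

text \<open>Applied to the Mittag-Leffler function, this gives the decay of its difference from the
  value at \<open>0\<close> towards the left end of the strip.\<close>

lemma entire_lipschitz_at_0:
  assumes "f holomorphic_on UNIV"
  obtains L where "0 \<le> L" "\<And>z. norm z \<le> 1 \<Longrightarrow> norm (f z - f 0) \<le> L * norm z"
proof -
  have "continuous_on (cball 0 1) (deriv f)"
    using assms by (intro holomorphic_on_imp_continuous_on holomorphic_on_subset[OF holomorphic_deriv[OF assms open_UNIV]]) auto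
  then have "bounded (deriv f ` cball 0 1)"
    by (intro compact_imp_bounded compact_continuous_image) auto
  then obtain L where "\<forall>w\<in>deriv f ` cball 0 1. norm w \<le> L"
    unfolding bounded_iff by blast
  then have L: "norm (deriv f z) \<le> L" if "norm z \<le> 1" for z
    using that by simp
  show ?thesis
  proof (rule that[of L])
    have "norm (deriv f 0) \<le> L" by (rule L) simp
    then show "0 \<le> L" by (rule order.trans[OF norm_ge_zero])
    fix z :: complex assume z: "norm z \<le> 1"
    have "norm (f z - f 0) \<le> L * norm (z - 0)"
    proof (rule field_differentiable_bound[where S = "cball 0 1" and f' = "deriv f"])
      show "(f has_field_derivative deriv f w) (at w within cball 0 1)" for w
        by (rule has_field_derivative_at_within[OF holomorphic_derivI[OF assms]]) auto
    qed (use z L in auto)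
    then show "norm (f z - f 0) \<le> L * norm z" by simp
  qed
qed

text \<open>Finite and infinite \<open>p\<close> are treated together through \<open>q\<close>, so
  the condition on \<gamma> no longer mentions \<open>p\<close>.\<close>

lemma fourier_in_Lp_mittag_leffler:
  fixes \<alpha> \<beta> \<gamma> s :: real and f :: "real ^ 'n::finite \<Rightarrow> complex"
  assumes \<alpha>: "0 < \<alpha>" and \<beta>: "0 < \<beta>" and \<gamma>: "0 < \<gamma>" and s: "\<alpha> / 2 < \<bar>s\<bar>" "\<bar>s\<bar> \<le> 1"
    and q: "p = \<infinity> \<and> q = real CARD('n) / 2 \<or>
      (\<exists>P>1. p = ennreal P \<and> q = real CARD('n) / 2 * (1 - 1 / P))" and q\<gamma>: "q < \<gamma> / 2"
  shows "fourier_in_Lp p (\<lambda>x::real^'n. mittag_leffler \<alpha> \<beta> (exp (\<i> * of_real (pi * s)) * of_real (norm x powr \<gamma>)))"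
proof -
  let ?E = "mittag_leffler \<alpha> \<beta>"
  define f where "f x = ?E (exp (\<i> * of_real (pi * s)) * of_real (norm x powr \<gamma>))" for x :: "real^'n"
  obtain \<phi> \<delta> c where \<phi>: "pi / 2 < \<phi>" "\<phi> \<le> pi" and \<delta>: "0 < \<delta>" "\<delta> < pi / 2" and c: "0 \<le> c" "c < 1"
    and sector: "\<And>v y. \<bar>v\<bar> \<le> \<delta> \<Longrightarrow> \<bar>y\<bar> \<le> \<phi> \<Longrightarrow> cos (pi * s + (\<gamma> / 2 * v - \<alpha> * y)) \<le> c"
    using sector_parameters[OF \<alpha> \<gamma> s] by blast
  obtain C0 where C0: "\<And>z. (\<And>y. \<bar>y\<bar> \<le> \<phi> \<Longrightarrow> Re (z * cis (- (\<alpha> * y))) \<le> c * norm z) \<Longrightarrow> norm (?E z) \<le> C0 / (1 + norm z)"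
    using mittag_leffler_sector_bound[OF \<alpha> \<beta> \<phi> c] by blast
  have E_hol: "?E holomorphic_on UNIV" by (rule mittag_leffler_holomorphic[OF \<alpha> \<beta>])
  define F where "F w = ?E (exp (\<i> * of_real (pi * s)) * exp (of_real (\<gamma> / 2) * w))" for w
  define F0 where "F0 = ?E 0"
  define H where "H w = F w - F0 * exp (- exp w)" for w
  have arg: "exp (\<i> * of_real (pi * s)) * exp (of_real (\<gamma> / 2) * Complex u v) =
      of_real (exp (\<gamma> / 2 * u)) * cis (pi * s + \<gamma> / 2 * v)" for u v
  proof -
    have "\<i> * of_real (pi * s) + of_real (\<gamma> / 2) * Complex u v = Complex (\<gamma> / 2 * u) (pi * s + \<gamma> / 2 * v)"
      by (simp add: complex_eq_iff)
    then show ?thesis unfolding exp_add[symmetric] by (simp only: exp_Complex_polar)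
  qed
  \<comment> \<open>One estimate with three uses: the whole strip, the function itself at
    \<open>v = 0\<close>, and the value at the origin at \<open>r = 0\<close>.\<close>
  have bound_r: "norm (?E (of_real r * cis (pi * s + \<gamma> / 2 * v))) \<le> C0 / (1 + r)" if "\<bar>v\<bar> \<le> \<delta>" "0 \<le> r" for r v
  proof -
    have "norm (?E (of_real r * cis (pi * s + \<gamma> / 2 * v))) \<le> C0 / (1 + norm (of_real r * cis (pi * s + \<gamma> / 2 * v)))"
    proof (rule C0)
      fix y assume y: "\<bar>y\<bar> \<le> \<phi>"
      have "of_real r * cis (pi * s + \<gamma> / 2 * v) * cis (- (\<alpha> * y)) = of_real r * cis (pi * s + (\<gamma> / 2 * v - \<alpha> * y))"
        unfolding mult.assoc cis_mult by (simp add: algebra_simps)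
      then have "Re (of_real r * cis (pi * s + \<gamma> / 2 * v) * cis (- (\<alpha> * y))) = r * cos (pi * s + (\<gamma> / 2 * v - \<alpha> * y))"
        by (simp only: Re_rcis[unfolded rcis_def])
      also have "\<dots> \<le> r * c" using sector[OF that(1) y] that(2) by (rule mult_left_mono)
      finally show "Re (of_real r * cis (pi * s + \<gamma> / 2 * v) * cis (- (\<alpha> * y))) \<le> c * norm (of_real r * cis (pi * s + \<gamma> / 2 * v))"
        using that(2) by (simp add: norm_mult mult.commute)
    qed
    then show ?thesis using that(2) by (simp add: norm_mult)
  qed
  have F0_le: "norm F0 \<le> C0" using bound_r[of 0 0] \<delta> by (simp add: F0_def)
  then have C0_nonneg: "0 \<le> C0" using norm_ge_zero order.trans by blast
  have f_le: "norm (f x) \<le> C0" for x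
  proof -
    have "norm (f x) \<le> C0 / (1 + norm x powr \<gamma>)"
      using bound_r[of 0 "norm x powr \<gamma>"] \<delta> by (simp add: f_def cis_conv_exp mult.commute)
    also have "\<dots> \<le> C0 / 1" using C0_nonneg by (intro divide_left_mono) (auto simp: add_pos_nonneg)
    finally show ?thesis by simp
  qed
  have F_le: "norm (F (Complex u v)) \<le> C0 / (1 + exp (\<gamma> / 2 * u))" if "\<bar>v\<bar> \<le> \<delta>" for u v
    unfolding F_def arg by (rule bound_r) (use that in auto)
  obtain L where L: "0 \<le> L" "\<And>z. norm z \<le> 1 \<Longrightarrow> norm (?E z - ?E 0) \<le> L * norm z"
    using entire_lipschitz_at_0[OF E_hol] by blast
  define l where "l = \<gamma> / 2"
  \<comment> \<open>The rate at the left end: the Mittag-Leffler part approaches its limit like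
    \<open>exp (l * u)\<close>, the Gaussian like \<open>exp u\<close>.\<close>
  define m where "m = min l 1"
  have l: "0 < l" and m: "0 < m" "m \<le> l" "m \<le> 1" using \<gamma> by (auto simp: l_def m_def)
  define M where "M = exp (l * (ln (l / cos \<delta>) - 1))"
  have M: "0 \<le> M" by (simp add: M_def)
  define K where "K = C0 + C0 * M + L + C0 * exp 1"
  have K: "0 \<le> K" "C0 + C0 * M \<le> K" "L + C0 * exp 1 \<le> K" using C0_nonneg M L by (auto simp: K_def)
  have H_le1: "norm (H (Complex u v)) \<le> K * exp (- l * u)" if v: "\<bar>v\<bar> \<le> \<delta>" for u v
  proof -
    have "C0 / (1 + exp (l * u)) \<le> C0 / exp (l * u)"
      using C0_nonneg by (intro divide_left_mono) (auto simp: add_pos_pos)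
    also have "\<dots> = C0 * exp (- l * u)"
      by (simp add: exp_minus field_simps)
    finally have 1: "norm (F (Complex u v)) \<le> C0 * exp (- l * u)"
      using F_le[OF v, of u] unfolding l_def by linarith
    have "norm F0 * norm (exp (- exp (Complex u v))) \<le> C0 * (M * exp (- l * u))"
      unfolding M_def using v \<delta> l C0_nonneg by (intro mult_mono F0_le exp_neg_exp_bounds) auto
    then have "norm (H (Complex u v)) \<le> (C0 + C0 * M) * exp (- l * u)"
      using norm_triangle_ineq4[of "F (Complex u v)" "F0 * exp (- exp (Complex u v))"] 1
      by (simp add: H_def norm_mult distrib_right)
    also have "\<dots> \<le> K * exp (- l * u)" using K by (intro mult_right_mono) auto
    finally show ?thesis .
  qed
  have H_le2: "norm (H (Complex u v)) \<le> K * exp (m * u)" if v: "\<bar>v\<bar> \<le> \<delta>" for u v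
  proof (cases "u \<le> 0")
    case True
    let ?z = "of_real (exp (\<gamma> / 2 * u)) * cis (pi * s + \<gamma> / 2 * v)"
    have nz: "norm ?z = exp (l * u)" by (simp add: norm_mult l_def)
    have "l * u \<le> 0" using True l by (simp add: mult_nonneg_nonpos)
    then have "norm ?z \<le> 1" unfolding nz by simp
    from L(2)[OF this] have "norm (F (Complex u v) - F0) \<le> L * exp (l * u)"
      unfolding nz F_def arg F0_def .
    also have "\<dots> \<le> L * exp (m * u)"
      using True m L by (intro mult_left_mono) (auto intro: mult_right_mono_neg)
    finally have 1: "norm (F (Complex u v) - F0) \<le> L * exp (m * u)" .
    have "norm (1 - exp (- exp (Complex u v))) \<le> exp 1 * exp u"
      by (rule exp_neg_exp_bounds(2)[OF v _ \<delta>(2) l]) (use \<delta> in simp)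
    also have "\<dots> \<le> exp 1 * exp (m * u)"
      using mult_right_mono_neg[OF m(3) True] by simp
    finally have "norm F0 * norm (1 - exp (- exp (Complex u v))) \<le> C0 * (exp 1 * exp (m * u))"
      using F0_le C0_nonneg by (intro mult_mono) auto
    \<comment> \<open>Regrouped so that each summand tends to \<open>0\<close> on the left.\<close>
    moreover have "H (Complex u v) = (F (Complex u v) - F0) + F0 * (1 - exp (- exp (Complex u v)))"
      by (simp add: H_def algebra_simps)
    ultimately have "norm (H (Complex u v)) \<le> (L + C0 * exp 1) * exp (m * u)"
      using norm_triangle_ineq[of "F (Complex u v) - F0" "F0 * (1 - exp (- exp (Complex u v)))"] 1
      by (simp add: norm_mult distrib_right)
    also have "\<dots> \<le> K * exp (m * u)" using K by (intro mult_right_mono) auto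
    finally show ?thesis .
  next
    case False
    have "norm (H (Complex u v)) \<le> K * exp (- l * u)" by (rule H_le1[OF v])
    also have "\<dots> \<le> K * exp (m * u)"
    proof (intro mult_left_mono K(1))
      have "- l * u \<le> 0" "0 \<le> m * u" using False l m by auto
      then show "exp (- l * u) \<le> exp (m * u)" by simp
    qed
    finally show ?thesis .
  qed
  have H_le: "norm (H (Complex u v)) \<le> K * exp (- m * \<bar>u\<bar>)" if v: "\<bar>v\<bar> \<le> \<delta>" for u v
  proof (cases "0 \<le> u")
    case True
    have "K * exp (- l * u) \<le> K * exp (- m * u)"
      using True m K by (intro mult_left_mono) (auto intro: mult_right_mono)
    then show ?thesis using H_le1[OF v, of u] True by simp
  next
    case False
    then show ?thesis using H_le2[OF v, of u] by simp
  qed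
  have F_hol: "F holomorphic_on UNIV"
  proof -
    have "(?E \<circ> (\<lambda>w. exp (\<i> * of_real (pi * s)) * exp (of_real (\<gamma> / 2) * w))) holomorphic_on UNIV"
      by (intro holomorphic_on_compose holomorphic_intros holomorphic_on_subset[OF E_hol]) auto
    then show ?thesis by (simp add: F_def[abs_def] comp_def)
  qed
  then have H_hol: "H holomorphic_on UNIV"
    unfolding H_def by (intro holomorphic_intros)
  have q0: "0 \<le> q" using q
  proof (elim disjE exE conjE)
    fix P :: real assume "1 < P" and q_eq: "q = real CARD('n) / 2 * (1 - 1 / P)"
    then have "0 \<le> 1 - 1 / P" by simp
    then show ?thesis unfolding q_eq by (intro mult_nonneg_nonneg) auto
  qed simp
  have ql: "q < l" using q\<gamma> by (simp add: l_def)
  have d1: "\<bar>- \<delta>\<bar> = \<delta>" "\<bar>\<delta>\<bar> = \<delta>" using \<delta> by auto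
  let ?k = "1 / (2 * of_real pi * \<i>)"
  obtain T1 :: "real^'n \<Rightarrow> complex" where T1: "fourier_repr p T1" "T1 \<in> borel_measurable borel"
    "\<And>x. x \<noteq> 0 \<Longrightarrow> T1 x = ?k * (LINT u|lborel. H (Complex u (- \<delta>)) * strip_kernel (exp (of_real (2 * ln (norm x)) - Complex u (- \<delta>))))"
    by (rule fourier_repr_boundary_term[OF H_hol \<delta> d1(1) m(1) ql q0 K(1) H_le1 H_le2 q, of ?k]) (use d1 in auto)
  obtain T2 :: "real^'n \<Rightarrow> complex" where T2: "fourier_repr p T2" "T2 \<in> borel_measurable borel"
    "\<And>x. x \<noteq> 0 \<Longrightarrow> T2 x = - ?k * (LINT u|lborel. H (Complex u \<delta>) * strip_kernel (exp (of_real (2 * ln (norm x)) - Complex u \<delta>)))"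
    by (rule fourier_repr_boundary_term[OF H_hol \<delta> d1(2) m(1) ql q0 K(1) H_le1 H_le2 q, of "- ?k"]) (use d1 in auto)
  have repr: "f x = F0 * exp (- of_real ((norm x)\<^sup>2)) + (T1 x + T2 x)" if x: "x \<noteq> 0" for x
  proof -
    define t where "t = 2 * ln (norm x)"
    have nx: "0 < norm x" using x by simp
    have "exp t = (norm x)\<^sup>2" using nx by (simp add: t_def exp_double)
    then have e1: "exp (of_real t) = complex_of_real ((norm x)\<^sup>2)"
      unfolding exp_of_real by (rule arg_cong)
    have "exp (\<gamma> / 2 * t) = norm x powr \<gamma>" using nx by (simp add: t_def powr_def)
    then have "exp (of_real (\<gamma> / 2) * of_real t) = complex_of_real (norm x powr \<gamma>)"
      unfolding of_real_mult[symmetric] exp_of_real by (rule arg_cong)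
    then have F: "F (of_real t) = f x" by (simp add: F_def f_def)
    have solve_linear: "h = ?k * a + - ?k * b" if "2 * of_real pi * \<i> * h = a - b" for h a b :: complex
    proof -
      have "h = ?k * (2 * of_real pi * \<i> * h)" by simp
      also have "\<dots> = ?k * a + - ?k * b" unfolding that by (simp add: right_diff_distrib)
      finally show ?thesis .
    qed
    have "2 * of_real pi * \<i> * H (of_real t) =
        (LINT u|lborel. H (Complex u (- \<delta>)) * strip_kernel (exp (of_real t - Complex u (- \<delta>))))
        - (LINT u|lborel. H (Complex u \<delta>) * strip_kernel (exp (of_real t - Complex u \<delta>)))"
      by (rule strip_representation[OF H_hol \<delta> m(1) K(1) H_le])
    then have "H (of_real t) = ?k * (LINT u|lborel. H (Complex u (- \<delta>)) * strip_kernel (exp (of_real t - Complex u (- \<delta>))))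
        + - ?k * (LINT u|lborel. H (Complex u \<delta>) * strip_kernel (exp (of_real t - Complex u \<delta>)))"
      by (rule solve_linear)
    then have "H (of_real t) = T1 x + T2 x"
      unfolding T1(3)[OF x] T2(3)[OF x] t_def .
    moreover have "f x = F0 * exp (- exp (of_real t)) + H (of_real t)"
      by (simp add: H_def F)
    ultimately show ?thesis unfolding e1 by simp
  qed
  have f_meas: "f \<in> borel_measurable borel"
  proof -
    have [measurable]: "?E \<in> borel_measurable borel"
      by (intro borel_measurable_continuous_onI holomorphic_on_imp_continuous_on E_hol)
    show ?thesis unfolding f_def[abs_def] by measurable
  qed
  have "fourier_repr p (\<lambda>x::real^'n. F0 * exp (- of_real ((norm x)\<^sup>2)) + (T1 x + T2 x))"
    by (intro fourier_repr_add fourier_repr_gaussian[OF q] T1(1) T2(1))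
  then have "fourier_repr p f"
  proof (rule fourier_repr_cong_AE)
    show "(\<lambda>x::real^'n. F0 * exp (- of_real ((norm x)\<^sup>2)) + (T1 x + T2 x)) \<in> borel_measurable borel"
      using T1(2) T2(2) by measurable
    show "AE x in lborel. F0 * exp (- of_real ((norm x)\<^sup>2)) + (T1 x + T2 x) = f x"
      using AE_lborel_singleton[of 0] by eventually_elim (simp add: repr)
  qed (rule f_meas)
  then have "fourier_in_Lp p f"
    by (rule fourier_in_LpI[OF f_meas f_le])
  then show ?thesis by (simp add: f_def[abs_def])
qed

theorem theorem1p2:
  fixes \<alpha> \<beta> \<gamma> s :: real and f :: "real ^ 'n::finite \<Rightarrow> complex"
  assumes "0 < \<alpha>" and "\<alpha> < 2" and "0 < \<beta>" and "0 < \<gamma>"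
    and "\<alpha> / 2 < \<bar>s\<bar>" and "\<bar>s\<bar> \<le> 1"
  defines "f \<equiv> (\<lambda>x. mittag_leffler \<alpha> \<beta> (exp (\<i> * of_real (pi * s)) * of_real (norm x powr \<gamma>)))"
  shows "(\<forall>p p' :: ennreal. 1 < p \<longrightarrow> 1 / p + 1 / p' = 1 \<longrightarrow>
            ennreal \<gamma> * p' > of_nat CARD('n) \<longrightarrow> fourier_in_Lp p f) \<and>
         (\<gamma> < real CARD('n) \<longrightarrow>
            (\<forall>p. 1 < p \<and> p < ennreal (real CARD('n) / (real CARD('n) - \<gamma>)) \<longrightarrow> fourier_in_Lp p f)) \<and>
         (\<gamma> = real CARD('n) \<longrightarrow> (\<forall>p. 1 < p \<and> p < \<infinity> \<longrightarrow> fourier_in_Lp p f)) \<and>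
         (\<gamma> > real CARD('n) \<longrightarrow> (\<forall>p. 1 < p \<and> p \<le> \<infinity> \<longrightarrow> fourier_in_Lp p f))"
proof -
  let ?d = "real CARD('n)"
  have d: "0 < ?d" by simp
  have top: "fourier_in_Lp \<infinity> f" if "?d < \<gamma>"
    unfolding f_def using assms that by (intro fourier_in_Lp_mittag_leffler[where q = "?d / 2"]) auto
  \<comment> \<open>Since \<open>1 / P' = 1 - 1 / P\<close> for the conjugate exponent
    \<open>P'\<close>, this is \<open>\<gamma> * P' > d\<close> in a form without \<open>P'\<close>,
    to which every range of finite exponents is reduced.\<close>
  have finite: "fourier_in_Lp (ennreal P) f" if P: "1 < P" "?d * (1 - 1 / P) < \<gamma>" for P
  proof -
    have "?d / 2 * (1 - 1 / P) < \<gamma> / 2" using P(2) by simp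
    moreover have "\<exists>P'>1. ennreal P = ennreal P' \<and> ?d / 2 * (1 - 1 / P) = ?d / 2 * (1 - 1 / P')"
      using P(1) by blast
    ultimately show ?thesis
      unfolding f_def using assms by (intro fourier_in_Lp_mittag_leffler[where q = "?d / 2 * (1 - 1 / P)"]) auto
  qed
  have lt_d: "?d * (1 - 1 / P) < ?d" if "1 < P" for P
    using that by (simp add: field_simps)
  have real_p: "\<exists>P>1. p = ennreal P" if p: "1 < p" "p \<noteq> \<infinity>" for p :: ennreal
  proof -
    obtain P where P: "p = ennreal P" "0 \<le> P" using p(2) by (cases p) auto
    then show ?thesis using p(1) by auto
  qed
  have A: "fourier_in_Lp p f" if p: "1 < p" and conj: "1 / p + 1 / p' = 1" and gt: "ennreal \<gamma> * p' > of_nat CARD('n)"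
    for p p' :: ennreal
  proof (cases "p = \<infinity>")
    case True
    then have "1 / p' = 1" using conj by simp
    have "p' = 1"
    proof (cases p')
      case (real r)
      then show ?thesis using \<open>1 / p' = 1\<close>
        by (cases "r = 0") (auto simp: divide_ennreal simp flip: ennreal_1)
    next
      case top
      then show ?thesis using \<open>1 / p' = 1\<close> by simp
    qed
    then have "?d < \<gamma>"
      using gt by (simp add: ennreal_of_nat_eq_real_of_nat ennreal_less_iff)
    then show ?thesis unfolding True by (rule top)
  next
    case False
    then obtain P where P: "1 < P" "p = ennreal P" using real_p[OF p] by auto
    have ip: "1 / p = ennreal (1 / P)" using P by (simp add: divide_ennreal flip: ennreal_1)
    \<comment> \<open>In \<open>ennreal\<close> the quotient \<open>1 / 0\<close> is \<infinity>, so
      the conjugacy relation excludes \<open>p' = 0\<close>; \<open>p' = \<infinity>\<close> would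
      force \<open>P = 1\<close>.\<close>
    have "p' \<noteq> 0"
      using conj by auto
    moreover have "p' \<noteq> \<infinity>"
    proof
      assume "p' = \<infinity>"
      then have "ennreal (1 / P) = ennreal 1" using conj ip by simp
      then show False using P by (simp del: ennreal_1)
    qed
    ultimately obtain R where R: "0 < R" "p' = ennreal R"
      by (cases p') (auto simp: less_le)
    have "ennreal (1 / P + 1 / R) = ennreal 1"
      using conj ip R P by (simp add: divide_ennreal ennreal_plus flip: ennreal_1)
    then have "1 / P + 1 / R = 1" using P R by (subst (asm) ennreal_inj) auto
    then have "1 - 1 / P = 1 / R" by simp
    moreover have "?d < \<gamma> * R"
      using gt R assms by (simp add: ennreal_of_nat_eq_real_of_nat ennreal_less_iff flip: ennreal_mult)
    then have "?d * (1 / R) < \<gamma>" using R by (simp add: pos_divide_less_eq)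
    ultimately have "?d * (1 - 1 / P) < \<gamma>" by simp
    then show ?thesis unfolding P(2) using P(1) by (intro finite)
  qed
  have B: "fourier_in_Lp p f" if p: "\<gamma> < ?d" "1 < p" "p < ennreal (?d / (?d - \<gamma>))" for p
  proof -
    have "p < \<infinity>" using p(3) ennreal_less_top by (simp add: less_trans)
    then obtain P where P: "1 < P" "p = ennreal P" using real_p[OF p(2)] by auto
    then have "P < ?d / (?d - \<gamma>)" using p(3) by (simp add: ennreal_less_iff)
    then have "?d * (1 - 1 / P) < \<gamma>" using p(1) P(1) by (simp add: field_simps)
    then show ?thesis unfolding P(2) using P(1) by (intro finite)
  qed
  have C: "fourier_in_Lp p f" if p: "\<gamma> \<ge> ?d" "1 < p" "p \<noteq> \<infinity>" for p
  proof -
    obtain P where P: "1 < P" "p = ennreal P" using real_p[OF p(2,3)] by auto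
    then show ?thesis using finite[OF P(1)] lt_d[OF P(1)] p(1) by auto
  qed
  show ?thesis
  proof (intro conjI allI impI)
    fix p :: ennreal assume "?d < \<gamma>" "1 < p \<and> p \<le> \<infinity>"
    then show "fourier_in_Lp p f" using C[of p] top by (cases "p = \<infinity>") auto
  qed (auto intro: A B C)
qed

end
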